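(* Let $(B,\omega)$ be a closed connected symplectic manifold such that the de Rham cohomology class $-[\omega/2\pi]$ is integral, and let $\pi\colon M\rightarrow B$ be the principal $S^1$-bundle of Euler class $-[\omega/2\pi]$, equipped with a connection $1$-form $\alpha$ satisfying $\mathrm{d}\alpha=\pi^*\omega$. Let $H\colon B\rightarrow\mathbb{R}$ be a smooth function whose Hamiltonian vector field $X$, defined by $i_X\omega=-\mathrm{d}H$, induces an action on $B$ by the circle $S^1=\mathbb{R}/2\pi\mathbb{Z}$ (i.e. the flow of $X$ is $2\pi$-periodic). Assume that $H>0$ and that $H(p_0)\in\mathbb{N}$ at some chosen zero $p_0\in B$ of $X$. Let $R$ be the Reeb vector field of $\alpha$, let $\widetilde{H}:=H\circ\pi$, let $X_{\mathrm{h}}$ be the horizontal lift of $X$ to $M$, and set $\widetilde{X}:=\widetilde{H}R+X_{\mathrm{h}}$. Then $\widetilde{X}$ defines an action of $S^1=\mathbb{R}/2\pi\mathbb{Z}$ on $M$, i.e. the flow of $\widetilde{X}$ is $2\pi$-periodic.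
   Context: Conventions: $S^1=\mathbb{R}/2\pi\mathbb{Z}$. A connection $1$-form $\alpha$ on the principal $S^1$-bundle $\pi\colon M\to B$ is a real-valued $S^1$-invariant $1$-form on $M$ taking the value $1$ on the vector field generating the $S^1$-action on the fibres (so each fibre has $\alpha$-length $2\pi$). Since $\omega$ is symplectic and $\mathrm{d}\alpha=\pi^*\omega$, the form $\alpha$ is a contact form on $M$; such $(M,\alpha)$ is called a Boothby--Wang bundle over $(B,\omega)$. The Reeb vector field $R$ of a contact form $\alpha$ is the unique vector field with $i_R\mathrm{d}\alpha=0$ and $\alpha(R)=1$; here it generates the $S^1$-action on the fibres of $M$. The horizontal lift $X_{\mathrm{h}}$ of a vector field $X$ on $B$ is the vector field on $M$ determined by $\alpha(X_{\mathrm{h}})=0$ and $T\pi(X_{\mathrm{h}})=X$. *)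

theory Defs
  imports "HOL-Analysis.Analysis" "HOL-Homology.Homology"
begin

section \<open>Smooth maps between open subsets of normed spaces\<close>

primrec Ck_on :: "nat \<Rightarrow> 'a::real_normed_vector set \<Rightarrow> ('a \<Rightarrow> 'b::real_normed_vector) \<Rightarrow> bool" where
  "Ck_on 0 S f \<longleftrightarrow> continuous_on S f"
| "Ck_on (Suc k) S f \<longleftrightarrow>
     (\<forall>x\<in>S. f differentiable (at x)) \<and>
     (\<forall>v. Ck_on k S (\<lambda>x. frechet_derivative f (at x) v))"

text \<open>Only meant for open \<open>S\<close> in a finite-dimensional space, where continuity of all iterated
  directional derivatives is the usual notion of smoothness.\<close>

definition smooth_on :: "'a::real_normed_vector set \<Rightarrow> ('a \<Rightarrow> 'b::real_normed_vector) \<Rightarrow> bool" where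
  "smooth_on S f \<longleftrightarrow> (\<forall>k. Ck_on k S f)"

section \<open>Manifolds\<close>

text \<open>A chart is a pair of its domain and its coordinate map; the values of the coordinate map
  outside the domain are irrelevant. The underlying space of a manifold is a whole (Hausdorff,
  second countable) type, and its smooth structure is given by a smooth atlas, which need not be
  maximal. Charts are onto open subsets of the model space, so there is no boundary.\<close>

type_synonym ('p, 'e) chart = "'p set \<times> ('p \<Rightarrow> 'e)"

abbreviation chart_inv :: "('p, 'e) chart \<Rightarrow> 'e \<Rightarrow> 'p" where
  "chart_inv C \<equiv> inv_into (fst C) (snd C)"

abbreviation chart_image :: "('p, 'e) chart \<Rightarrow> 'e set" where
  "chart_image C \<equiv> snd C ` fst C"

definition smooth_atlas ::
  "('p::{t2_space,second_countable_topology}, 'e::euclidean_space) chart set \<Rightarrow> bool" where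
  "smooth_atlas A \<longleftrightarrow>
     (\<Union>C\<in>A. fst C) = UNIV \<and>
     (\<forall>C\<in>A. open (fst C) \<and> open (chart_image C) \<and>
        homeomorphism (fst C) (chart_image C) (snd C) (chart_inv C)) \<and>
     (\<forall>C\<in>A. \<forall>D\<in>A. smooth_on (snd C ` (fst C \<inter> fst D)) (snd D \<circ> chart_inv C))"

definition charts_around :: "('p, 'e) chart set \<Rightarrow> 'p \<Rightarrow> ('p, 'e) chart set" where
  "charts_around A p = {C \<in> A. p \<in> fst C}"

definition chart_at :: "('p, 'e) chart set \<Rightarrow> 'p \<Rightarrow> ('p, 'e) chart" where
  "chart_at A p = (SOME C. C \<in> charts_around A p)"

definition euclid_atlas :: "('e, 'e) chart set" where
  "euclid_atlas = {(UNIV, id)}"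

definition prod_atlas ::
  "('p, 'e) chart set \<Rightarrow> ('q, 'f) chart set \<Rightarrow> ('p \<times> 'q, 'e \<times> 'f) chart set" where
  "prod_atlas A B = (\<lambda>(C, D). (fst C \<times> fst D, map_prod (snd C) (snd D))) ` (A \<times> B)"

definition smooth_map_on ::
  "('p::topological_space, 'e::real_normed_vector) chart set \<Rightarrow>
   ('q::topological_space, 'f::real_normed_vector) chart set \<Rightarrow> 'p set \<Rightarrow> ('p \<Rightarrow> 'q) \<Rightarrow> bool" where
  "smooth_map_on A B S f \<longleftrightarrow>
     open S \<and> continuous_on S f \<and>
     (\<forall>C\<in>A. \<forall>D\<in>B.
        smooth_on (snd C ` (fst C \<inter> S \<inter> f -` fst D)) (snd D \<circ> f \<circ> chart_inv C))"

abbreviation smooth_map where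
  "smooth_map A B \<equiv> smooth_map_on A B UNIV"

section \<open>Tangent vectors\<close>

text \<open>A tangent vector at \<open>p\<close> is the family of its coordinate representations in all charts
  around \<open>p\<close>, which are related by the derivatives of the coordinate changes. It is extended by
  \<open>0\<close> to all other charts, so that equality of tangent vectors is equality of functions; the
  vector space operations are pointwise.\<close>

type_synonym ('p, 'e) tangent = "('p, 'e) chart \<Rightarrow> 'e"

definition tangent_space ::
  "('p, 'e::real_normed_vector) chart set \<Rightarrow> 'p \<Rightarrow> ('p, 'e) tangent set" where
  "tangent_space A p =
     {v. (\<forall>C. C \<notin> charts_around A p \<longrightarrow> v C = 0) \<and>
         (\<forall>C\<in>charts_around A p. \<forall>D\<in>charts_around A p.
            v D = frechet_derivative (snd D \<circ> chart_inv C) (at (snd C p)) (v C))}"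

text \<open>The tangent vector at \<open>p\<close> with representation \<open>e\<close> in the chart \<open>C\<close>.\<close>

definition coord_vec ::
  "('p, 'e::real_normed_vector) chart set \<Rightarrow> ('p, 'e) chart \<Rightarrow> 'p \<Rightarrow> 'e \<Rightarrow> ('p, 'e) tangent" where
  "coord_vec A C p e =
     (\<lambda>D. if D \<in> charts_around A p
          then frechet_derivative (snd D \<circ> chart_inv C) (at (snd C p)) e else 0)"

definition tangent_map ::
  "('p, 'e::real_normed_vector) chart set \<Rightarrow> ('q, 'f::real_normed_vector) chart set \<Rightarrow>
   ('p \<Rightarrow> 'q) \<Rightarrow> 'p \<Rightarrow> ('p, 'e) tangent \<Rightarrow> ('q, 'f) tangent" where
  "tangent_map A B f p v =
     (let C = chart_at A p in
      (\<lambda>D. if D \<in> charts_around B (f p)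
           then frechet_derivative (snd D \<circ> f \<circ> chart_inv C) (at (snd C p)) (v C) else 0))"

definition velocity ::
  "('p, 'e::real_normed_vector) chart set \<Rightarrow> (real \<Rightarrow> 'p) \<Rightarrow> real \<Rightarrow> ('p, 'e) tangent" where
  "velocity A c t =
     (\<lambda>C. if C \<in> charts_around A (c t) then vector_derivative (snd C \<circ> c) (at t) else 0)"

definition vector_field ::
  "('p, 'e::real_normed_vector) chart set \<Rightarrow> ('p \<Rightarrow> ('p, 'e) tangent) \<Rightarrow> bool" where
  "vector_field A X \<longleftrightarrow>
     (\<forall>p. X p \<in> tangent_space A p) \<and>
     (\<forall>C\<in>A. smooth_on (chart_image C) (\<lambda>x. X (chart_inv C x) C))"

section \<open>Differential forms\<close>

definition one_form ::
  "('p, 'e::real_normed_vector) chart set \<Rightarrow> ('p \<Rightarrow> ('p, 'e) tangent \<Rightarrow> real) \<Rightarrow> bool" where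
  "one_form A \<alpha> \<longleftrightarrow>
     (\<forall>p. \<forall>u\<in>tangent_space A p. \<forall>v\<in>tangent_space A p. \<forall>a b.
        \<alpha> p (\<lambda>C. a *\<^sub>R u C + b *\<^sub>R v C) = a * \<alpha> p u + b * \<alpha> p v) \<and>
     (\<forall>C\<in>A. \<forall>e. smooth_on (chart_image C)
        (\<lambda>x. \<alpha> (chart_inv C x) (coord_vec A C (chart_inv C x) e)))"

definition two_form ::
  "('p, 'e::real_normed_vector) chart set \<Rightarrow>
   ('p \<Rightarrow> ('p, 'e) tangent \<Rightarrow> ('p, 'e) tangent \<Rightarrow> real) \<Rightarrow> bool" where
  "two_form A \<omega> \<longleftrightarrow>
     (\<forall>p. \<forall>u\<in>tangent_space A p. \<forall>v\<in>tangent_space A p. \<omega> p u v = - \<omega> p v u) \<and>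
     (\<forall>p. \<forall>u\<in>tangent_space A p. \<forall>v\<in>tangent_space A p. \<forall>w\<in>tangent_space A p. \<forall>a b.
        \<omega> p (\<lambda>C. a *\<^sub>R u C + b *\<^sub>R v C) w = a * \<omega> p u w + b * \<omega> p v w) \<and>
     (\<forall>C\<in>A. \<forall>e e'. smooth_on (chart_image C)
        (\<lambda>x. \<omega> (chart_inv C x) (coord_vec A C (chart_inv C x) e) (coord_vec A C (chart_inv C x) e')))"

text \<open>Exterior derivatives of functions, 1-forms and 2-forms, computed in a chart; the values do
  not depend on the chart. The normalisation is
  \<open>d\<alpha>(X,Y) = X(\<alpha>(Y)) - Y(\<alpha>(X)) - \<alpha>([X,Y])\<close>.\<close>

definition d_fun ::
  "('p, 'e::real_normed_vector) chart set \<Rightarrow> ('p \<Rightarrow> real) \<Rightarrow> 'p \<Rightarrow> ('p, 'e) tangent \<Rightarrow> real" where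
  "d_fun A f p v =
     (let C = chart_at A p in frechet_derivative (f \<circ> chart_inv C) (at (snd C p)) (v C))"

definition d_one_form ::
  "('p, 'e::real_normed_vector) chart set \<Rightarrow> ('p \<Rightarrow> ('p, 'e) tangent \<Rightarrow> real) \<Rightarrow>
   'p \<Rightarrow> ('p, 'e) tangent \<Rightarrow> ('p, 'e) tangent \<Rightarrow> real" where
  "d_one_form A \<alpha> p u v =
     (let C = chart_at A p;
          a = (\<lambda>e x. \<alpha> (chart_inv C x) (coord_vec A C (chart_inv C x) e));
          D = (\<lambda>f. frechet_derivative f (at (snd C p)))
      in D (a (v C)) (u C) - D (a (u C)) (v C))"

definition d_two_form ::
  "('p, 'e::real_normed_vector) chart set \<Rightarrow>
   ('p \<Rightarrow> ('p, 'e) tangent \<Rightarrow> ('p, 'e) tangent \<Rightarrow> real) \<Rightarrow>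
   'p \<Rightarrow> ('p, 'e) tangent \<Rightarrow> ('p, 'e) tangent \<Rightarrow> ('p, 'e) tangent \<Rightarrow> real" where
  "d_two_form A \<omega> p u v w =
     (let C = chart_at A p;
          b = (\<lambda>e e' x. \<omega> (chart_inv C x) (coord_vec A C (chart_inv C x) e)
                                          (coord_vec A C (chart_inv C x) e'));
          D = (\<lambda>f. frechet_derivative f (at (snd C p)))
      in D (b (v C) (w C)) (u C) - D (b (u C) (w C)) (v C) + D (b (u C) (v C)) (w C))"

definition closed_two_form where
  "closed_two_form A \<omega> \<longleftrightarrow> two_form A \<omega> \<and>
     (\<forall>p. \<forall>u\<in>tangent_space A p. \<forall>v\<in>tangent_space A p. \<forall>w\<in>tangent_space A p.
        d_two_form A \<omega> p u v w = 0)"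

text \<open>\<open>d\<alpha> = \<pi>\<^sup>*\<omega>\<close> for \<open>\<pi>\<close> from the manifold with atlas \<open>AM\<close> to the one with atlas \<open>AB\<close>. Forms are
  compared on tangent vectors only: they carry no information elsewhere.\<close>

definition d_eq_pullback where
  "d_eq_pullback AM AB \<pi> \<alpha> \<omega> \<longleftrightarrow>
     (\<forall>m. \<forall>u\<in>tangent_space AM m. \<forall>v\<in>tangent_space AM m.
        d_one_form AM \<alpha> m u v = \<omega> (\<pi> m) (tangent_map AM AB \<pi> m u) (tangent_map AM AB \<pi> m v))"

definition symplectic_form where
  "symplectic_form A \<omega> \<longleftrightarrow> closed_two_form A \<omega> \<and>
     (\<forall>p. \<forall>u\<in>tangent_space A p.
        (\<forall>v\<in>tangent_space A p. \<omega> p u v = 0) \<longrightarrow> u = (\<lambda>_. 0))"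

definition hamiltonian_vector_field where
  "hamiltonian_vector_field A \<omega> H X \<longleftrightarrow> vector_field A X \<and>
     (\<forall>p. \<forall>v\<in>tangent_space A p. \<omega> p (X p) v = - d_fun A H p v)"

section \<open>De Rham classes of degree two\<close>

definition de_rham_class where
  "de_rham_class A \<omega> =
     {\<omega>'. closed_two_form A \<omega>' \<and>
        (\<exists>\<beta>. one_form A \<beta> \<and>
           (\<forall>p. \<forall>u\<in>tangent_space A p. \<forall>v\<in>tangent_space A p.
              \<omega>' p u v - \<omega> p u v = d_one_form A \<beta> p u v))}"

text \<open>The parametrisation of the standard 2-simplex by the triangle with vertices
  \<open>(0,0), (1,0), (0,1)\<close>.\<close>

definition bary :: "real \<times> real \<Rightarrow> nat \<Rightarrow> real" where
  "bary = (\<lambda>(s, t) i. if i = 0 then 1 - s - t else if i = 1 then s else if i = 2 then t else 0)"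

definition smooth_2simplex ::
  "('p::topological_space, 'e::real_normed_vector) chart set \<Rightarrow> ((nat \<Rightarrow> real) \<Rightarrow> 'p) \<Rightarrow> bool" where
  "smooth_2simplex A \<sigma> \<longleftrightarrow>
     (\<exists>W f. {(s, t). 0 \<le> s \<and> 0 \<le> t \<and> s + t \<le> 1} \<subseteq> W \<and> smooth_map_on euclid_atlas A W f \<and>
        (\<forall>s t. 0 \<le> s \<and> 0 \<le> t \<and> s + t \<le> 1 \<longrightarrow> f (s, t) = \<sigma> (bary (s, t))))"

text \<open>The integral is taken over the open triangle (the boundary is a null set), where both
  partial derivatives of the simplex are two-sided.\<close>

definition simplex_integral ::
  "('p, 'e::real_normed_vector) chart set \<Rightarrow>
   ('p \<Rightarrow> ('p, 'e) tangent \<Rightarrow> ('p, 'e) tangent \<Rightarrow> real) \<Rightarrow> ((nat \<Rightarrow> real) \<Rightarrow> 'p) \<Rightarrow> real" where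
  "simplex_integral A \<omega> \<sigma> =
     integral {(s, t). 0 < s \<and> 0 < t \<and> s + t < 1}
       (\<lambda>(s, t). \<omega> (\<sigma> (bary (s, t))) (velocity A (\<lambda>s'. \<sigma> (bary (s', t))) s)
                                     (velocity A (\<lambda>t'. \<sigma> (bary (s, t'))) t))"

definition chain_integral where
  "chain_integral A \<omega> c =
     (\<Sum>\<sigma>\<in>Poly_Mapping.keys c. of_int (Poly_Mapping.lookup c \<sigma>) * simplex_integral A \<omega> \<sigma>)"

text \<open>By de Rham's theorem, the class of a closed 2-form lies in the image of the integral
  cohomology iff its periods over all smooth integral 2-cycles are integers.\<close>

definition integral_class where
  "integral_class A \<omega> \<longleftrightarrow> closed_two_form A \<omega> \<and>
     (\<forall>c. singular_relcycle 2 euclidean {} c \<and> (\<forall>\<sigma>\<in>Poly_Mapping.keys c. smooth_2simplex A \<sigma>)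
        \<longrightarrow> chain_integral A \<omega> c \<in> \<int>)"

section \<open>Flows and circle actions\<close>

text \<open>The circle is \<open>\<real>/2\<pi>\<int>\<close>, so its smooth actions are the smooth \<open>2\<pi>\<close>-periodic actions of \<open>\<real>\<close>.\<close>

definition flow ::
  "('p::topological_space, 'e::real_normed_vector) chart set \<Rightarrow> (real \<Rightarrow> 'p \<Rightarrow> 'p) \<Rightarrow> bool" where
  "flow A \<phi> \<longleftrightarrow>
     smooth_map (prod_atlas euclid_atlas A) A (\<lambda>(t, p). \<phi> t p) \<and>
     (\<forall>p. \<phi> 0 p = p) \<and> (\<forall>s t p. \<phi> (s + t) p = \<phi> s (\<phi> t p))"

definition circle_action where
  "circle_action A \<phi> \<longleftrightarrow> flow A \<phi> \<and> (\<forall>t p. \<phi> (t + 2 * pi) p = \<phi> t p)"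

definition flow_of where
  "flow_of A X \<phi> \<longleftrightarrow> flow A \<phi> \<and> (\<forall>t p. velocity A (\<lambda>t. \<phi> t p) t = X (\<phi> t p))"

definition defines_circle_action where
  "defines_circle_action A X \<longleftrightarrow> (\<exists>\<phi>. flow_of A X \<phi> \<and> circle_action A \<phi>)"

section \<open>Principal circle bundles\<close>

text \<open>Local trivialisations are equivariant diffeomorphisms \<open>(\<pi>, \<tau>) : \<pi>\<^sup>-\<^sup>1(U) \<rightarrow> U \<times> S\<^sup>1\<close>, with
  \<open>S\<^sup>1\<close> the unit circle in the complex plane. Smoothness of the inverse is expressed via the
  covering \<open>\<real> \<rightarrow> S\<^sup>1\<close>, \<open>t \<mapsto> cis t\<close>, which is a local diffeomorphism.\<close>

definition principal_circle_bundle ::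
  "('m::topological_space, 'f::real_normed_vector) chart set \<Rightarrow>
   ('b::topological_space, 'e::real_normed_vector) chart set \<Rightarrow>
   ('m \<Rightarrow> 'b) \<Rightarrow> (real \<Rightarrow> 'm \<Rightarrow> 'm) \<Rightarrow> bool" where
  "principal_circle_bundle AM AB \<pi> \<rho> \<longleftrightarrow>
     smooth_map AM AB \<pi> \<and> circle_action AM \<rho> \<and> (\<forall>t m. \<pi> (\<rho> t m) = \<pi> m) \<and>
     (\<forall>b. \<exists>U. \<exists>\<tau> :: 'm \<Rightarrow> complex. open U \<and> b \<in> U \<and>
        smooth_map_on AM euclid_atlas (\<pi> -` U) \<tau> \<and>
        (\<forall>m\<in>\<pi> -` U. \<forall>t. \<tau> (\<rho> t m) = cis t * \<tau> m) \<and>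
        bij_betw (\<lambda>m. (\<pi> m, \<tau> m)) (\<pi> -` U) (U \<times> sphere 0 1) \<and>
        smooth_map_on (prod_atlas AB euclid_atlas) AM (U \<times> UNIV)
          (\<lambda>(x, t). inv_into (\<pi> -` U) (\<lambda>m. (\<pi> m, \<tau> m)) (x, cis t)))"

definition connection_form where
  "connection_form AM \<rho> \<alpha> \<longleftrightarrow> one_form AM \<alpha> \<and>
     (\<forall>t m. \<forall>v\<in>tangent_space AM m. \<alpha> (\<rho> t m) (tangent_map AM AM (\<rho> t) m v) = \<alpha> m v) \<and>
     (\<forall>m. \<alpha> m (velocity AM (\<lambda>t. \<rho> t m) 0) = 1)"

text \<open>The Euler class in de Rham cohomology, by Chern--Weil theory: it is \<open>-[\<Omega>/2\<pi>]\<close>, where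
  \<open>\<Omega>\<close> is the curvature form on the base of an arbitrary connection form \<open>\<alpha>\<close>, that is
  \<open>d\<alpha> = \<pi>\<^sup>*\<Omega>\<close>. All connections give the same class, so this set is a single de Rham class.\<close>

definition euler_class where
  "euler_class AM AB \<pi> \<rho> =
     (\<Union>(\<alpha>, \<Omega>) \<in> {(\<alpha>, \<Omega>). connection_form AM \<rho> \<alpha> \<and> two_form AB \<Omega> \<and> d_eq_pullback AM AB \<pi> \<alpha> \<Omega>}.
        de_rham_class AB (\<lambda>p u v. - \<Omega> p u v / (2 * pi)))"

definition reeb_vector_field where
  "reeb_vector_field A \<alpha> R \<longleftrightarrow> vector_field A R \<and>
     (\<forall>m. \<forall>v\<in>tangent_space A m. d_one_form A \<alpha> m (R m) v = 0) \<and>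
     (\<forall>m. \<alpha> m (R m) = 1)"

definition horizontal_lift where
  "horizontal_lift AM AB \<pi> \<alpha> X Y \<longleftrightarrow> vector_field AM Y \<and>
     (\<forall>m. \<alpha> m (Y m) = 0) \<and> (\<forall>m. tangent_map AM AB \<pi> m (Y m) = X (\<pi> m))"

end

(* Write Z for the lifted vector field: it is characterised by T pi (Z) = X and alpha(Z) = H.
   Over a trivialising set U with section sigma and angular coordinate tau, a curve c in M over an
   integral curve of X is an integral curve of Z iff tau o c rotates with speed
   H - alpha(T sigma X). Hence the local flow of Z is obtained from the flow of X by a quadrature
   depending smoothly on parameters; compactness of B makes its time of existence uniform, so Z
   has a global flow Phi.

   Since L_Z alpha = d(alpha(Z)) + i_Z d alpha = dH + i_X omega = 0, the map Phi_{2 pi} preserves alpha.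
   It covers the identity of B, as the flow of X is 2 pi-periodic, so it rotates the fibres by an
   angle that is locally constant on B, thus constant. Over the zero p_0 of X the field Z is H(p_0)
   times the generator of the circle action, so this angle is 2 pi H(p_0), a multiple of 2 pi. *)
theory Submission
  imports Defs
begin

section \<open>Calculus of smooth functions\<close>

text \<open>No existence or uniqueness theorem for differential equations enters. The flow of
  \<open>X\<close> is part of the data, so only an angle along known base curves is sought, and two
  integral curves of \<open>Z\<close> over one base curve are compared by the product of \<tau> on
  one with the conjugate of \<tau> on the other. Such unit complex numbers replace angles; a
  logarithm appears only where an angle has to be smooth. Tangent vectors are families over all
  charts. As each is the velocity of a curve, most statements about them are reduced to curves.
  Invariance of \<alpha> is read off the two-parameter map (s, r) -> Phi_s(c(r)), where it rests on
  d commuting with pullback, hence on the symmetry of second derivatives. The field \<open>R\<close>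
  is specified by \<alpha> alone; that it is vertical, so that T pi (Z) = X, follows from
  nondegeneracy of \<omega> and surjectivity of T pi. The holonomy angle is never named as a
  function on B: the set of base points whose whole fibre is fixed by Phi_{2 pi} contains p_0 and is
  open and closed.\<close>

lemma Ck_on_continuous: "Ck_on k S f \<Longrightarrow> continuous_on S f"
  by (cases k) (auto simp: continuous_on_eq_continuous_at differentiable_imp_continuous_within
      intro!: continuous_at_imp_continuous_on)

lemma Ck_on_Suc_imp: "Ck_on (Suc k) S f \<Longrightarrow> Ck_on k S f"
proof (induction k arbitrary: f)
  case 0
  then show ?case using Ck_on_continuous[of "Suc 0" S f] by simp
next
  case (Suc k)
  then show ?case by (metis Ck_on.simps(2))
qed

lemma Ck_on_SucD: "Ck_on (Suc k) S f \<Longrightarrow> x \<in> S \<Longrightarrow> (f has_derivative frechet_derivative f (at x)) (at x)"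
  by (auto simp: frechet_derivative_works)

text \<open>Derivatives at a point see a whole neighbourhood, so agreement on \<open>S\<close>
  determines them only because \<open>S\<close> is open.\<close>

lemma Ck_on_cong:
  assumes "open S" "\<And>x. x \<in> S \<Longrightarrow> f x = g x" "Ck_on k S f"
  shows "Ck_on k S g"
  using assms(2,3)
proof (induction k arbitrary: f g)
  case 0
  then show ?case by (auto cong: continuous_on_cong)
next
  case (Suc k)
  have der: "(g has_derivative frechet_derivative f (at x)) (at x)" if "x \<in> S" for x
    using has_derivative_transform_within_open[OF Ck_on_SucD[OF Suc.prems(2) that] assms(1) that] Suc.prems(1)
    by blast
  have eq: "frechet_derivative f (at x) = frechet_derivative g (at x)" if "x \<in> S" for x
    using frechet_derivative_at[OF der[OF that]] .
  show ?case unfolding Ck_on.simps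
  proof (intro conjI ballI allI)
    show "g differentiable at x" if "x \<in> S" for x using der[OF that] by (auto simp: differentiable_def)
    show "Ck_on k S (\<lambda>x. frechet_derivative g (at x) v)" for v
      by (rule Suc.IH[where f = "\<lambda>x. frechet_derivative f (at x) v"]) (use eq Suc.prems(2) in auto)
  qed
qed

text \<open>Lets any explicit derivative stand in for the choice made by
  \<open>frechet_derivative\<close>. The closure properties below are mostly inductions through this
  rule.\<close>

lemma Ck_on_SucI:
  assumes "open S" "\<And>x. x \<in> S \<Longrightarrow> (f has_derivative f' x) (at x)" "\<And>v. Ck_on k S (\<lambda>x. f' x v)"
  shows "Ck_on (Suc k) S f"
  unfolding Ck_on.simps
proof (intro conjI ballI allI)
  show "f differentiable at x" if "x \<in> S" for x using assms(2)[OF that] by (auto simp: differentiable_def)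
  show "Ck_on k S (\<lambda>x. frechet_derivative f (at x) v)" for v
    by (rule Ck_on_cong[OF assms(1) _ assms(3)[of v]]) (use assms(2) frechet_derivative_at in metis)
qed

lemma Ck_on_subset: "Ck_on k S f \<Longrightarrow> T \<subseteq> S \<Longrightarrow> Ck_on k T f"
  by (induction k arbitrary: f) (auto intro: continuous_on_subset)

lemma Ck_on_local:
  assumes "\<And>x. x \<in> S \<Longrightarrow> \<exists>T. open T \<and> x \<in> T \<and> Ck_on k T f"
  shows "Ck_on k S f"
  using assms
proof (induction k arbitrary: f)
  case 0
  have "isCont f x" if x: "x \<in> S" for x
  proof -
    obtain T where T: "open T" "x \<in> T" "Ck_on 0 T f" using 0[OF x] by blast
    then show ?thesis using continuous_on_eq_continuous_at[of T f] by simp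
  qed
  then show ?case using continuous_at_imp_continuous_on[of S f] by simp
next
  case (Suc k)
  show ?case unfolding Ck_on.simps
  proof (intro conjI ballI allI)
    show "f differentiable at x" if "x \<in> S" for x using Suc.prems[OF that] by auto
    show "Ck_on k S (\<lambda>x. frechet_derivative f (at x) v)" for v
      by (rule Suc.IH) (use Suc.prems in fastforce)
  qed
qed

lemma Ck_on_const: "Ck_on k S (\<lambda>x. c)"
  by (induction k arbitrary: c) (auto)

lemma Ck_on_add:
  assumes "open S" "Ck_on k S f" "Ck_on k S g"
  shows "Ck_on k S (\<lambda>x. f x + g x)"
  using assms(2,3)
proof (induction k arbitrary: f g)
  case 0
  then show ?case by (auto intro: continuous_intros)
next
  case (Suc k)
  show ?case
  proof (rule Ck_on_SucI[OF assms(1)])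
    show "((\<lambda>x. f x + g x) has_derivative
        (\<lambda>v. frechet_derivative f (at x) v + frechet_derivative g (at x) v)) (at x)" if "x \<in> S" for x
      using Ck_on_SucD[OF Suc.prems(1) that] Ck_on_SucD[OF Suc.prems(2) that] by (rule has_derivative_add)
    show "Ck_on k S (\<lambda>x. frechet_derivative f (at x) v + frechet_derivative g (at x) v)" for v
      using Suc.prems by (auto intro: Suc.IH)
  qed
qed

lemma Ck_on_bounded_linear:
  assumes "open S" "bounded_linear h" "Ck_on k S f"
  shows "Ck_on k S (\<lambda>x. h (f x))"
  using assms(3)
proof (induction k arbitrary: f)
  case 0
  then show ?case using assms(2) by (auto intro: bounded_linear.continuous_on)
next
  case (Suc k)
  show ?case
  proof (rule Ck_on_SucI[OF assms(1)])
    show "((\<lambda>x. h (f x)) has_derivative (\<lambda>v. h (frechet_derivative f (at x) v))) (at x)" if "x \<in> S" for x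
      using bounded_linear.has_derivative[OF assms(2) Ck_on_SucD[OF Suc.prems that]] .
    show "Ck_on k S (\<lambda>x. h (frechet_derivative f (at x) v))" for v
      using Suc.prems by (auto intro: Suc.IH)
  qed
qed

lemma Ck_on_id: "open S \<Longrightarrow> Ck_on k S (\<lambda>x. x)"
proof (cases k)
  case (Suc k)
  assume "open S"
  then show ?thesis unfolding Suc
    by (rule Ck_on_SucI[where f' = "\<lambda>x v. v"]) (auto simp: Ck_on_const has_derivative_ident)
qed simp

lemma Ck_on_bounded_bilinear:
  assumes "open S" "bounded_bilinear h" "Ck_on k S f" "Ck_on k S g"
  shows "Ck_on k S (\<lambda>x. h (f x) (g x))"
  using assms(3,4)
proof (induction k arbitrary: f g)
  case 0
  then show ?case by (auto intro: bounded_bilinear.continuous_on[OF assms(2)])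
next
  case (Suc k)
  show ?case
  proof (rule Ck_on_SucI[OF assms(1)])
    show "((\<lambda>x. h (f x) (g x)) has_derivative
        (\<lambda>v. h (f x) (frechet_derivative g (at x) v) + h (frechet_derivative f (at x) v) (g x))) (at x)"
      if "x \<in> S" for x
      using bounded_bilinear.FDERIV[OF assms(2) Ck_on_SucD[OF Suc.prems(1) that] Ck_on_SucD[OF Suc.prems(2) that]] .
    show "Ck_on k S (\<lambda>x. h (f x) (frechet_derivative g (at x) v) + h (frechet_derivative f (at x) v) (g x))" for v
      using Suc.prems Ck_on_Suc_imp[OF Suc.prems(1)] Ck_on_Suc_imp[OF Suc.prems(2)]
      by (intro Ck_on_add assms Suc.IH) auto
  qed
qed

lemma Ck_on_sum:
  assumes "open S" "\<And>i. i \<in> I \<Longrightarrow> Ck_on k S (f i)"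
  shows "Ck_on k S (\<lambda>x. \<Sum>i\<in>I. f i x)"
  using assms(2)
  by (induction I rule: infinite_finite_induct) (auto intro: Ck_on_add[OF assms(1)] Ck_on_const)

lemma linear_euclidean_expand:
  fixes e :: "'a::euclidean_space"
  assumes "linear g"
  shows "g e = (\<Sum>b\<in>Basis. (e \<bullet> b) *\<^sub>R g b)"
  by (metis (no_types, lifting) assms euclidean_representation linear_scale linear_sum sum.cong)

text \<open>The direction in which \<open>g\<close> is differentiated,
  \<open>frechet_derivative f (at x) v\<close>, moves with \<open>x\<close>, while
  \<open>Ck_on\<close> speaks of fixed directions only. Expanding it in a basis of the middle space,
  which is why that space is Euclidean, leaves products of terms covered by the induction.\<close>

lemma Ck_on_compose:
  fixes f :: "'a::real_normed_vector \<Rightarrow> 'b::euclidean_space"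
  assumes "open S" "open T" "Ck_on k S f" "Ck_on k T g" "\<And>x. x \<in> S \<Longrightarrow> f x \<in> T"
  shows "Ck_on k S (\<lambda>x. g (f x))"
  using assms(3,4)
proof (induction k arbitrary: g)
  case 0
  then show ?case using assms(5) by (auto intro: continuous_on_compose2)
next
  case (Suc k)
  have dg: "(g has_derivative frechet_derivative g (at (f x))) (at (f x))" if "x \<in> S" for x
    using Ck_on_SucD[OF Suc.prems(2) assms(5)[OF that]] .
  have exp: "frechet_derivative g (at (f x)) e = (\<Sum>b\<in>Basis. (e \<bullet> b) *\<^sub>R frechet_derivative g (at (f x)) b)"
    if "x \<in> S" for x e
    using has_derivative_bounded_linear[OF dg[OF that]] bounded_linear.linear linear_euclidean_expand by blast
  show ?case
  proof (rule Ck_on_SucI[OF assms(1)])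
    show "((\<lambda>x. g (f x)) has_derivative (\<lambda>v. \<Sum>b\<in>Basis. (frechet_derivative f (at x) v \<bullet> b) *\<^sub>R
          frechet_derivative g (at (f x)) b)) (at x)" if "x \<in> S" for x
      using has_derivative_compose[OF Ck_on_SucD[OF Suc.prems(1) that] dg[OF that]]
      by (subst (asm) exp[OF that]) simp
    show "Ck_on k S (\<lambda>x. \<Sum>b\<in>Basis. (frechet_derivative f (at x) v \<bullet> b) *\<^sub>R frechet_derivative g (at (f x)) b)" for v
    proof (intro Ck_on_sum assms(1) Ck_on_bounded_bilinear[OF assms(1) bounded_bilinear_scaleR])
      fix b :: 'b
      show "Ck_on k S (\<lambda>x. frechet_derivative f (at x) v \<bullet> b)"
        using Suc.prems(1) by (intro Ck_on_bounded_linear[OF assms(1) bounded_linear_inner_left]) auto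
      show "Ck_on k S (\<lambda>x. frechet_derivative g (at (f x)) b)"
        using Suc.prems(2) Ck_on_Suc_imp[OF Suc.prems(1)] by (intro Suc.IH) auto
    qed
  qed
qed

text \<open>The derivative is built from inversion itself, so the induction feeds on its own
  hypothesis.\<close>

lemma Ck_on_inverse:
  fixes S :: "'a::real_normed_div_algebra set"
  assumes "open S" "0 \<notin> S"
  shows "Ck_on k S inverse"
proof (induction k)
  case 0
  then show ?case using assms by (auto intro!: continuous_intros)
next
  case (Suc k)
  show ?case
  proof (rule Ck_on_SucI[OF assms(1)])
    show "(inverse has_derivative (\<lambda>h. - (inverse x * h * inverse x))) (at x)" if "x \<in> S" for x
      using that assms(2) by (intro has_derivative_inverse') auto
    show "Ck_on k S (\<lambda>x. - (inverse x * v * inverse x))" for v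
      by (intro Ck_on_bounded_linear[OF assms(1) bounded_linear_minus[OF bounded_linear_ident]]
          Ck_on_bounded_bilinear[OF assms(1) bounded_bilinear_mult] Suc Ck_on_const)
  qed
qed

lemma Ck_on_Ln: "Ck_on k (- \<real>\<^sub>\<le>\<^sub>0) Ln"
proof (cases k)
  case 0
  then show ?thesis by (auto intro!: continuous_on_Ln)
next
  case (Suc k)
  have o: "open (- \<real>\<^sub>\<le>\<^sub>0 :: complex set)" by auto
  show ?thesis unfolding Suc
  proof (rule Ck_on_SucI[OF o])
    show "(Ln has_derivative (\<lambda>h. inverse x * h)) (at x)" if "x \<in> - \<real>\<^sub>\<le>\<^sub>0" for x
      using has_field_derivative_Ln[of x] that by (auto simp: has_field_derivative_def)
    show "Ck_on k (- \<real>\<^sub>\<le>\<^sub>0) (\<lambda>x::complex. inverse x * v)" for v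
      by (intro Ck_on_bounded_bilinear[OF o bounded_bilinear_mult] Ck_on_inverse Ck_on_const o) auto
  qed
qed

lemma smooth_on_continuous: "smooth_on S f \<Longrightarrow> continuous_on S f"
  using Ck_on_continuous unfolding smooth_on_def by blast

lemma smooth_on_has_derivative:
  "smooth_on S f \<Longrightarrow> x \<in> S \<Longrightarrow> (f has_derivative frechet_derivative f (at x)) (at x)"
  using Ck_on_SucD unfolding smooth_on_def by blast

lemma smooth_on_linear_deriv: "smooth_on S f \<Longrightarrow> x \<in> S \<Longrightarrow> linear (frechet_derivative f (at x))"
  using smooth_on_has_derivative has_derivative_bounded_linear bounded_linear.linear by blast

lemma smooth_on_frechet_derivative: "smooth_on S f \<Longrightarrow> smooth_on S (\<lambda>x. frechet_derivative f (at x) v)"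
  unfolding smooth_on_def by (metis Ck_on.simps(2))

lemma smooth_on_cong: "open S \<Longrightarrow> (\<And>x. x \<in> S \<Longrightarrow> f x = g x) \<Longrightarrow> smooth_on S f \<Longrightarrow> smooth_on S g"
  unfolding smooth_on_def using Ck_on_cong by metis

lemma smooth_on_subset: "smooth_on S f \<Longrightarrow> T \<subseteq> S \<Longrightarrow> smooth_on T f"
  unfolding smooth_on_def using Ck_on_subset by blast

lemma smooth_on_local:
  "(\<And>x. x \<in> S \<Longrightarrow> \<exists>T. open T \<and> x \<in> T \<and> smooth_on T f) \<Longrightarrow> smooth_on S f"
  unfolding smooth_on_def using Ck_on_local[of S _ f] by meson

lemma smooth_on_const: "smooth_on S (\<lambda>x. c)"
  by (simp add: smooth_on_def Ck_on_const)

lemma smooth_on_id: "open S \<Longrightarrow> smooth_on S (\<lambda>x. x)"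
  by (simp add: smooth_on_def Ck_on_id)

lemma smooth_on_add: "open S \<Longrightarrow> smooth_on S f \<Longrightarrow> smooth_on S g \<Longrightarrow> smooth_on S (\<lambda>x. f x + g x)"
  by (simp add: smooth_on_def Ck_on_add)

lemma smooth_on_bounded_linear:
  "open S \<Longrightarrow> bounded_linear h \<Longrightarrow> smooth_on S f \<Longrightarrow> smooth_on S (\<lambda>x. h (f x))"
  by (simp add: smooth_on_def Ck_on_bounded_linear)

lemma smooth_on_bounded_bilinear:
  "open S \<Longrightarrow> bounded_bilinear h \<Longrightarrow> smooth_on S f \<Longrightarrow> smooth_on S g \<Longrightarrow> smooth_on S (\<lambda>x. h (f x) (g x))"
  by (simp add: smooth_on_def Ck_on_bounded_bilinear)

lemma smooth_on_sum:
  "open S \<Longrightarrow> (\<And>i. i \<in> I \<Longrightarrow> smooth_on S (f i)) \<Longrightarrow> smooth_on S (\<lambda>x. \<Sum>i\<in>I. f i x)"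
  by (simp add: smooth_on_def Ck_on_sum)

lemma smooth_on_minus: "open S \<Longrightarrow> smooth_on S f \<Longrightarrow> smooth_on S (\<lambda>x. - f x)"
  by (rule smooth_on_bounded_linear[OF _ bounded_linear_minus[OF bounded_linear_ident]])

lemma smooth_on_diff: "open S \<Longrightarrow> smooth_on S f \<Longrightarrow> smooth_on S g \<Longrightarrow> smooth_on S (\<lambda>x. f x - g x)"
  using smooth_on_add[of S f "\<lambda>x. - g x"] smooth_on_minus[of S g] by simp

lemma smooth_on_Pair:
  assumes "open S" "smooth_on S f" "smooth_on S g"
  shows "smooth_on S (\<lambda>x. (f x, g x))"
proof -
  have "smooth_on S (\<lambda>x. (f x, 0) + (0, g x))"
    by (intro smooth_on_add assms(1) smooth_on_bounded_linear[OF assms(1) _ assms(2)]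
        smooth_on_bounded_linear[OF assms(1) _ assms(3)]
        bounded_linear_Pair bounded_linear_ident bounded_linear_zero)
  then show ?thesis by simp
qed

lemma smooth_on_compose:
  fixes f :: "'a::real_normed_vector \<Rightarrow> 'b::euclidean_space"
  shows "open S \<Longrightarrow> open T \<Longrightarrow> smooth_on S f \<Longrightarrow> smooth_on T g \<Longrightarrow> (\<And>x. x \<in> S \<Longrightarrow> f x \<in> T)
    \<Longrightarrow> smooth_on S (\<lambda>x. g (f x))"
  unfolding smooth_on_def using Ck_on_compose by metis

lemma smooth_on_Ln: "smooth_on (- \<real>\<^sub>\<le>\<^sub>0) Ln"
  by (simp add: smooth_on_def Ck_on_Ln)

section \<open>Integrals that depend on a parameter\<close>

lemma has_derivative_integral_param:
  fixes G :: "real \<times> 'a::euclidean_space \<Rightarrow> 'b::euclidean_space"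
  assumes "open S" "{0..1} \<times> S \<subseteq> \<Omega>" "Ck_on (Suc 0) \<Omega> G" "x \<in> S"
  shows "((\<lambda>p. integral {0..1} (\<lambda>u. G (u, p))) has_derivative
    (\<lambda>v. integral {0..1} (\<lambda>u. frechet_derivative G (at (u, x)) (0, v)))) (at x)"
proof -
  obtain r where r: "r > 0" "ball x r \<subseteq> S" using assms(1,4) openE by blast
  define U where "U = ball x r"
  have mem: "(u, p) \<in> \<Omega>" if "u \<in> {0..1}" "p \<in> U" for u p using that assms(2) r(2) unfolding U_def by blast
  \<comment> \<open>\<open>leibniz_rule\<close> wants the derivative as a continuous map into
    bounded linear functions; continuity is then checked on basis vectors, where it is part of
    \<open>Ck_on\<close>.\<close>
  define fx where "fx p u = Blinfun (\<lambda>v. frechet_derivative G (at (u, p)) (0, v))" for p u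
  have dG: "(G has_derivative frechet_derivative G (at (u, p))) (at (u, p))" if "u \<in> {0..1}" "p \<in> U" for u p
    by (rule Ck_on_SucD[OF assms(3) mem[OF that]])
  have bl: "bounded_linear (\<lambda>v. frechet_derivative G (at (u, p)) (0, v))" if "u \<in> {0..1}" "p \<in> U" for u p
    using bounded_linear_compose[OF has_derivative_bounded_linear[OF dG[OF that]]
        bounded_linear_Pair[OF bounded_linear_zero bounded_linear_ident]] .
  have app: "blinfun_apply (fx p u) = (\<lambda>v. frechet_derivative G (at (u, p)) (0, v))"
    if "u \<in> {0..1}" "p \<in> U" for u p
    unfolding fx_def by (rule bounded_linear_Blinfun_apply[OF bl[OF that]])
  have cont: "continuous_on (U \<times> {0..1}) (\<lambda>(p, u). fx p u)"
  proof (rule continuous_on_blinfun_componentwise)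
    fix i :: 'a
    have "continuous_on \<Omega> (\<lambda>z. frechet_derivative G (at z) (0, i))" using assms(3) by simp
    then have "continuous_on (U \<times> {0..1}) (\<lambda>z. frechet_derivative G (at (snd z, fst z)) (0, i))"
      by (rule continuous_on_compose2) (auto intro!: continuous_intros mem)
    then show "continuous_on (U \<times> {0..1}) (\<lambda>z. blinfun_apply (case z of (p, u) \<Rightarrow> fx p u) i)"
      by (rule continuous_on_eq) (auto simp: app)
  qed
  have "((\<lambda>p. integral (cbox 0 1) (\<lambda>u. G (u, p))) has_derivative integral (cbox 0 1) (fx x)) (at x within U)"
  proof (rule leibniz_rule)
    show "((\<lambda>p. G (t, p)) has_derivative blinfun_apply (fx p t)) (at p within U)"
      if "p \<in> U" "t \<in> cbox 0 1" for p t
    proof -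
      have t: "t \<in> {0..1}" using that by simp
      have "((\<lambda>q. (t, q)) has_derivative (\<lambda>v. (0, v))) (at p within U)"
        by (auto intro!: derivative_eq_intros)
      from has_derivative_compose[OF this dG[OF t that(1)]] show ?thesis by (simp add: app[OF t that(1)])
    qed
    show "(\<lambda>u. G (u, p)) integrable_on cbox 0 1" if "p \<in> U" for p
    proof (rule integrable_continuous)
      show "continuous_on (cbox 0 1) (\<lambda>u. G (u, p))"
        by (rule continuous_on_compose2[OF Ck_on_continuous[OF assms(3)]])
          (auto intro!: continuous_intros mem that)
    qed
  qed (use cont r in \<open>auto simp: U_def\<close>)
  then have main: "((\<lambda>p. integral {0..1} (\<lambda>u. G (u, p))) has_derivative integral (cbox 0 1) (fx x)) (at x)"
    using r(1) by (simp add: U_def at_within_open[of x "ball x r"])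
  have xU: "x \<in> U" using r(1) by (simp add: U_def)
  have int: "fx x integrable_on cbox 0 1"
    by (rule integrable_continuous, rule continuous_on_compose2[OF cont, of _ "\<lambda>u. (x, u)", simplified])
      (auto intro!: continuous_intros xU)
  have "blinfun_apply (integral (cbox 0 1) (fx x)) v = integral {0..1} (\<lambda>u. frechet_derivative G (at (u, x)) (0, v))" for v
  proof -
    have "blinfun_apply (integral (cbox 0 1) (fx x)) v = integral (cbox 0 1) (\<lambda>u. blinfun_apply (fx x u) v)"
      using integral_linear[OF int blinfun.bounded_linear_left[of v]] by (simp add: o_def)
    also have "\<dots> = integral {0..1} (\<lambda>u. frechet_derivative G (at (u, x)) (0, v))"
      by (auto intro!: integral_cong simp: app xU)
    finally show ?thesis .
  qed
  then have "blinfun_apply (integral (cbox 0 1) (fx x)) =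
      (\<lambda>v. integral {0..1} (\<lambda>u. frechet_derivative G (at (u, x)) (0, v)))" by blast
  with main show ?thesis by simp
qed

text \<open>Each directional derivative of the integral is the integral of
  \<open>frechet_derivative G\<close> in the direction \<open>(0, v)\<close>, so the statement
  reproduces itself. A separate \<Omega> is carried along because \<open>{0..1} \<times> S\<close>
  is not open, whereas smoothness is only meant for open sets.\<close>

lemma Ck_on_integral_param:
  fixes G :: "real \<times> 'a::euclidean_space \<Rightarrow> 'b::euclidean_space"
  assumes "open S" "{0..1} \<times> S \<subseteq> \<Omega>" "Ck_on k \<Omega> G"
  shows "Ck_on k S (\<lambda>p. integral {0..1} (\<lambda>u. G (u, p)))"
  using assms(3)
proof (induction k arbitrary: G)
  case 0
  have "continuous_on (S \<times> cbox 0 1) (\<lambda>(p, u). G (u, p))"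
    unfolding split_def
    by (rule continuous_on_compose2[OF Ck_on_continuous[OF 0]]) (use assms(2) in \<open>auto intro!: continuous_intros\<close>)
  from integral_continuous_on_param[OF this] show ?case by simp
next
  case (Suc k)
  have 1: "Ck_on (Suc 0) \<Omega> G"
    using Suc.prems by (auto intro: Ck_on_continuous)
  show ?case
    by (rule Ck_on_SucI[OF assms(1) has_derivative_integral_param[OF assms(1,2) 1]])
      (use Suc.prems in \<open>auto intro: Suc.IH\<close>)
qed

lemma smooth_on_integral_param:
  fixes G :: "real \<times> 'a::euclidean_space \<Rightarrow> 'b::euclidean_space"
  shows "open S \<Longrightarrow> {0..1} \<times> S \<subseteq> \<Omega> \<Longrightarrow> smooth_on \<Omega> G
    \<Longrightarrow> smooth_on S (\<lambda>p. integral {0..1} (\<lambda>u. G (u, p)))"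
  unfolding smooth_on_def using Ck_on_integral_param by blast

lemma has_vector_derivative_compose_derivative:
  assumes "(c has_vector_derivative v) (at t within T)" "(g has_derivative g') (at (c t))"
  shows "((\<lambda>t. g (c t)) has_vector_derivative g' v) (at t within T)"
  using has_derivative_compose[OF assms(1)[unfolded has_vector_derivative_def] assms(2)]
    bounded_linear.linear[OF has_derivative_bounded_linear[OF assms(2)]]
  by (simp add: has_vector_derivative_def linear_scale)

text \<open>Hadamard's argument: f(x + s w) - f(x) = s J(s, x) with \<open>J\<close> smooth and J(0,
  x) the derivative of \<open>f\<close> along \<open>w\<close>. Differentiating both sides along
  \<open>u\<close> at \<open>p\<close> leaves s L(s) on the right. Then L(0) is both mixed
  derivatives: the s-derivative at 0 of the left side, and the derivative of J(0, x) along
  \<open>u\<close>.\<close>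

lemma smooth_on_symmetric_second_derivative:
  fixes f :: "'a::euclidean_space \<Rightarrow> 'b::euclidean_space"
  assumes S: "open S" "smooth_on S f" "p \<in> S"
  shows "frechet_derivative (\<lambda>x. frechet_derivative f (at x) w) (at p) u =
    frechet_derivative (\<lambda>x. frechet_derivative f (at x) u) (at p) w"
proof -
  define f1 where "f1 v x = frechet_derivative f (at x) v" for v x
  have sm1: "smooth_on S (f1 v)" for v unfolding f1_def by (rule smooth_on_frechet_derivative[OF S(2)])
  obtain r where r: "r > 0" "ball p r \<subseteq> S" using S(1,3) openE by blast
  \<comment> \<open>Chosen so that d |w| < r/2: a point of \<open>B\<close> moved by at most
    \<open>d\<close> times \<open>w\<close> stays in the ball of radius \<open>r\<close>. The
    summand 1 covers w = 0.\<close>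
  define d where "d = r / (2 * (1 + norm w))"
  have dpos: "d > 0" using r(1) by (simp add: d_def add_pos_nonneg)
  have dw: "d * norm w < r / 2"
  proof -
    have "d * norm w < d * (1 + norm w)" using dpos by simp
    also have "\<dots> = r / 2" by (simp add: d_def add_pos_nonneg add_nonneg_eq_0_iff field_simps)
    finally show ?thesis .
  qed
  define I where "I = ball (0::real) d"
  define B where "B = ball p (r / 2)"
  have oIB: "open (I \<times> B)" by (simp add: I_def B_def open_Times)
  have pB: "p \<in> B" and I0: "0 \<in> I" using r(1) dpos by (auto simp: B_def I_def)
  have mem: "x + (c * s) *\<^sub>R w \<in> S" if "c \<in> {0..1}" "x \<in> B" "s \<in> I" for c s x
  proof -
    have "\<bar>c\<bar> * \<bar>s\<bar> \<le> 1 * d" using that by (intro mult_mono) (auto simp: I_def)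
    then have "norm ((c * s) *\<^sub>R w) \<le> d * norm w" by (simp add: abs_mult mult_right_mono)
    moreover have "dist p (x + (c * s) *\<^sub>R w) \<le> dist p x + norm ((c * s) *\<^sub>R w)"
      by (metis add_diff_cancel_left' dist_commute dist_norm dist_triangle)
    ultimately have "x + (c * s) *\<^sub>R w \<in> ball p r" using that(2) dw unfolding B_def by simp
    then show ?thesis using r(2) by blast
  qed
  have mem1: "x + s *\<^sub>R w \<in> S" if "x \<in> B" "s \<in> I" for s x using mem[of 1 x s] that by simp
  have memS: "x \<in> S" if "x \<in> B" for x using mem[of 0 x 0] that I0 by simp
  define h where "h = (\<lambda>z :: real \<times> real \<times> 'a. snd (snd z) + (fst z * fst (snd z)) *\<^sub>R w)"
  define G where "G = (\<lambda>z. f1 w (h z))"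
  have smh: "smooth_on UNIV h" unfolding h_def
    by (intro smooth_on_add open_UNIV smooth_on_bounded_linear[OF open_UNIV bounded_linear_scaleR_left]
      smooth_on_bounded_bilinear[OF open_UNIV bounded_bilinear_mult]
      smooth_on_bounded_linear[OF open_UNIV bounded_linear_compose[OF bounded_linear_snd bounded_linear_snd] smooth_on_id]
      smooth_on_bounded_linear[OF open_UNIV bounded_linear_fst smooth_on_id]
      smooth_on_bounded_linear[OF open_UNIV bounded_linear_compose[OF bounded_linear_fst bounded_linear_snd] smooth_on_id])
  have o\<Omega>: "open (h -` S)"
    using open_vimage[OF S(1)] smooth_on_continuous[OF smh] by blast
  have smG: "smooth_on (h -` S) G" unfolding G_def
    by (rule smooth_on_compose[OF o\<Omega> S(1) smooth_on_subset[OF smh] sm1]) auto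
  \<comment> \<open>The mean of the derivative along \<open>w\<close> over the segment from x to x +
    s w; by the fundamental theorem of calculus it is the difference quotient, and it stays smooth
    at s = 0.\<close>
  define J where "J q = integral {0..1} (\<lambda>c. G (c, q))" for q
  have smJ: "smooth_on (I \<times> B) J" unfolding J_def
    by (rule smooth_on_integral_param[OF oIB _ smG]) (auto simp: h_def intro: mem)
  note dJ = smooth_on_has_derivative[OF smJ]
  have line: "((\<lambda>c. x + (c * s) *\<^sub>R w) has_vector_derivative s *\<^sub>R w) (at c within T)" for x s c T
    by (auto intro!: derivative_eq_intros)
  have ftc: "f (x + s *\<^sub>R w) - f x = s *\<^sub>R J (s, x)" if "s \<in> I" "x \<in> B" for s x
  proof -
    have "((\<lambda>c. s *\<^sub>R G (c, s, x)) has_integral f (x + (1 * s) *\<^sub>R w) - f (x + (0 * s) *\<^sub>R w)) {0..1}"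
    proof (rule fundamental_theorem_of_calculus)
      fix c :: real assume c: "c \<in> {0..1}"
      have "(f has_derivative frechet_derivative f (at (x + (c * s) *\<^sub>R w))) (at (x + (c * s) *\<^sub>R w))"
        by (rule smooth_on_has_derivative[OF S(2) mem[OF c that(2,1)]])
      from has_vector_derivative_compose_derivative[OF line this, of "{0..1}"]
      show "((\<lambda>c. f (x + (c * s) *\<^sub>R w)) has_vector_derivative s *\<^sub>R G (c, s, x)) (at c within {0..1})"
        using smooth_on_linear_deriv[OF S(2) mem[OF c that(2,1)]]
        by (simp add: o_def G_def h_def f1_def linear_scale)
    qed simp
    then show ?thesis using integral_unique[of "\<lambda>c. s *\<^sub>R G (c, s, x)"] by (simp add: J_def)
  qed
  define L where "L s = frechet_derivative J (at (s, p)) (0, u)" for s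
  have dJx: "((\<lambda>x. J (s, x)) has_derivative (\<lambda>v. frechet_derivative J (at (s, p)) (0, v))) (at p)" if "s \<in> I" for s
  proof (rule has_derivative_compose[where f = "\<lambda>x. (s, x)" and g = J, OF _ dJ])
    show "(Pair s has_derivative Pair 0) (at p)" by (auto intro!: derivative_eq_intros)
  qed (use that pB in auto)
  have diff: "f1 u (p + s *\<^sub>R w) = f1 u p + s *\<^sub>R L s" if s: "s \<in> I" for s
  proof -
    have "((\<lambda>x. f (x + s *\<^sub>R w)) has_derivative (\<lambda>v. frechet_derivative f (at (p + s *\<^sub>R w)) v)) (at p)"
      by (rule has_derivative_compose[where f = "\<lambda>x. x + s *\<^sub>R w" and g = f])
        (auto intro!: derivative_eq_intros smooth_on_has_derivative[OF S(2) mem1[OF pB s]])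
    from has_derivative_diff[OF this smooth_on_has_derivative[OF S(2,3)]]
    have "((\<lambda>x. s *\<^sub>R J (s, x)) has_derivative
        (\<lambda>v. frechet_derivative f (at (p + s *\<^sub>R w)) v - frechet_derivative f (at p) v)) (at p)"
      by (rule has_derivative_transform_within_open[where s = B]) (use pB ftc s in \<open>auto simp: B_def\<close>)
    from has_derivative_unique[OF this has_derivative_scaleR_right[OF dJx[OF s]]]
    have "frechet_derivative f (at (p + s *\<^sub>R w)) u - frechet_derivative f (at p) u = s *\<^sub>R L s"
      unfolding L_def by meson
    then show ?thesis by (simp add: f1_def algebra_simps)
  qed
  have "smooth_on I L" unfolding L_def
    by (rule smooth_on_compose[OF _ oIB _ smooth_on_frechet_derivative[OF smJ], where f = "\<lambda>s. (s, p)"])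
      (auto simp: I_def pB[unfolded B_def] B_def r(1) intro!: smooth_on_Pair smooth_on_id smooth_on_const)
  from smooth_on_has_derivative[OF this I0]
  have dL: "(L has_derivative frechet_derivative L (at 0)) (at 0)" .
  have "((\<lambda>s. f1 u p + s *\<^sub>R L s) has_derivative (\<lambda>v. v *\<^sub>R L 0)) (at 0)"
    by (auto intro!: derivative_eq_intros dL)
  then have 1: "((\<lambda>s. f1 u (p + s *\<^sub>R w)) has_derivative (\<lambda>v. v *\<^sub>R L 0)) (at 0)"
    by (rule has_derivative_transform_within_open[where s = I]) (use I0 diff in \<open>auto simp: I_def\<close>)
  have 2: "((\<lambda>s. f1 u (p + s *\<^sub>R w)) has_derivative (\<lambda>v. frechet_derivative (f1 u) (at p) (v *\<^sub>R w))) (at 0)"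
    by (rule has_derivative_compose[where f = "\<lambda>s. p + s *\<^sub>R w" and g = "f1 u"])
      (use smooth_on_has_derivative[OF sm1 S(3)] in \<open>auto intro!: derivative_eq_intros\<close>)
  have "L 0 = frechet_derivative (f1 u) (at p) w"
    using fun_cong[OF has_derivative_unique[OF 1 2], of 1] by simp
  moreover have "((\<lambda>x. J (0, x)) has_derivative frechet_derivative (f1 w) (at p)) (at p)"
    by (rule has_derivative_transform_within_open[OF smooth_on_has_derivative[OF sm1 S(3)] S(1,3)])
      (simp add: J_def G_def h_def)
  from has_derivative_unique[OF this dJx[OF I0]]
  have "L 0 = frechet_derivative (f1 w) (at p) u" unfolding L_def by simp
  ultimately show ?thesis unfolding f1_def by simp
qed

section \<open>Smooth maps between manifolds\<close>

lemma smooth_atlas_chart: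
  assumes "smooth_atlas A" "C \<in> A"
  shows "open (fst C)" "open (chart_image C)" "continuous_on (fst C) (snd C)"
    "continuous_on (chart_image C) (chart_inv C)" "inj_on (snd C) (fst C)"
    "\<And>p. p \<in> fst C \<Longrightarrow> chart_inv C (snd C p) = p"
    "\<And>x. x \<in> chart_image C \<Longrightarrow> chart_inv C x \<in> fst C \<and> snd C (chart_inv C x) = x"
proof -
  have h: "open (fst C)" "open (chart_image C)" "homeomorphism (fst C) (chart_image C) (snd C) (chart_inv C)"
    using assms unfolding smooth_atlas_def by blast+
  show "open (fst C)" "open (chart_image C)" "continuous_on (fst C) (snd C)"
    "continuous_on (chart_image C) (chart_inv C)"
    "\<And>p. p \<in> fst C \<Longrightarrow> chart_inv C (snd C p) = p"
    "\<And>x. x \<in> chart_image C \<Longrightarrow> chart_inv C x \<in> fst C \<and> snd C (chart_inv C x) = x"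
    using h by (auto simp: homeomorphism_def)
  show "inj_on (snd C) (fst C)"
    using h(3) by (auto simp: homeomorphism_def intro: inj_on_inverseI)
qed

lemma smooth_atlas_cover: "smooth_atlas A \<Longrightarrow> \<exists>C\<in>A. p \<in> fst C"
  unfolding smooth_atlas_def by blast

lemma smooth_atlas_transition:
  "smooth_atlas A \<Longrightarrow> C \<in> A \<Longrightarrow> D \<in> A \<Longrightarrow> smooth_on (snd C ` (fst C \<inter> fst D)) (\<lambda>x. snd D (chart_inv C x))"
  unfolding smooth_atlas_def by (auto simp: o_def)

lemma smooth_atlas_open_image:
  assumes "smooth_atlas A" "C \<in> A" "open S"
  shows "open (snd C ` (fst C \<inter> S))"
proof -
  have "snd C ` (fst C \<inter> S) = chart_image C \<inter> chart_inv C -` S"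
    using smooth_atlas_chart(6,7)[OF assms(1,2)] by (auto simp: image_iff)
  then show ?thesis
    using continuous_open_preimage[OF smooth_atlas_chart(4)[OF assms(1,2)] smooth_atlas_chart(2)[OF assms(1,2)] assms(3)]
    by simp
qed

lemma smooth_map_on_chartD:
  "smooth_map_on A B S f \<Longrightarrow> C \<in> A \<Longrightarrow> D \<in> B \<Longrightarrow>
    smooth_on (snd C ` (fst C \<inter> S \<inter> f -` fst D)) (\<lambda>x. snd D (f (chart_inv C x)))"
  unfolding smooth_map_on_def by (auto simp: o_def)

lemma smooth_map_onD: "smooth_map_on A B S f \<Longrightarrow> open S" "smooth_map_on A B S f \<Longrightarrow> continuous_on S f"
  by (auto simp: smooth_map_on_def)

lemma smooth_map_on_open_preimage: "smooth_map_on A B S f \<Longrightarrow> open T \<Longrightarrow> open (S \<inter> f -` T)"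
  using continuous_open_preimage smooth_map_onD by metis

lemma smooth_map_on_chart_open:
  assumes "smooth_atlas A" "smooth_atlas B" "smooth_map_on A B S f" "C \<in> A" "D \<in> B"
  shows "open (snd C ` (fst C \<inter> S \<inter> f -` fst D))"
  using smooth_atlas_open_image[OF assms(1,4)]
    smooth_map_on_open_preimage[OF assms(3) smooth_atlas_chart(1)[OF assms(2,5)]]
  by (simp add: Int_assoc)

text \<open>The middle chart \<open>D\<close> can be inserted only near a given point, where
  \<open>f\<close> stays in its domain; smoothness is therefore obtained on small sets
  \<open>V\<close> and glued.\<close>

lemma smooth_map_on_compose:
  fixes A :: "('p::{t2_space,second_countable_topology}, 'e::euclidean_space) chart set"
    and B :: "('q::{t2_space,second_countable_topology}, 'f::euclidean_space) chart set"
    and K :: "('r::{t2_space,second_countable_topology}, 'g::euclidean_space) chart set"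
  assumes A: "smooth_atlas A" and B: "smooth_atlas B" and K: "smooth_atlas K"
    and f: "smooth_map_on A B S f" and g: "smooth_map_on B K T g" and sub: "\<And>p. p \<in> S \<Longrightarrow> f p \<in> T"
  shows "smooth_map_on A K S (\<lambda>p. g (f p))"
  unfolding smooth_map_on_def o_def
proof (intro conjI ballI)
  show oS: "open S" using smooth_map_onD(1)[OF f] .
  show "continuous_on S (\<lambda>p. g (f p))"
    using continuous_on_compose2[OF smooth_map_onD(2)[OF g] smooth_map_onD(2)[OF f]] sub by blast
  fix C E assume C: "C \<in> A" and E: "E \<in> K"
  show "smooth_on (snd C ` (fst C \<inter> S \<inter> (\<lambda>p. g (f p)) -` fst E)) (\<lambda>x. snd E (g (f (chart_inv C x))))"
  proof (rule smooth_on_local)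
    fix x assume "x \<in> snd C ` (fst C \<inter> S \<inter> (\<lambda>p. g (f p)) -` fst E)"
    then obtain p where p: "p \<in> fst C" "p \<in> S" "g (f p) \<in> fst E" "x = snd C p" by auto
    obtain D where D: "D \<in> B" "f p \<in> fst D" using smooth_atlas_cover[OF B] by blast
    define W where "W = snd D ` (fst D \<inter> T \<inter> g -` fst E)"
    define N where "N = T \<inter> g -` fst E \<inter> fst D"
    define V where "V = snd C ` (fst C \<inter> (S \<inter> f -` N))"
    have oW: "open W" unfolding W_def by (rule smooth_map_on_chart_open[OF B K g D(1) E])
    have oN: "open N" unfolding N_def
      using smooth_map_on_open_preimage[OF g smooth_atlas_chart(1)[OF K E]] smooth_atlas_chart(1)[OF B D(1)] by blast
    have oV: "open V" unfolding V_def
      by (rule smooth_atlas_open_image[OF A C smooth_map_on_open_preimage[OF f oN]])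
    have "smooth_on V (\<lambda>x. snd E (g (chart_inv D (snd D (f (chart_inv C x))))))"
    proof (rule smooth_on_compose[OF oV oW])
      show "smooth_on V (\<lambda>x. snd D (f (chart_inv C x)))"
        by (rule smooth_on_subset[OF smooth_map_on_chartD[OF f C D(1)]]) (auto simp: V_def N_def)
      show "smooth_on W (\<lambda>x. snd E (g (chart_inv D x)))"
        unfolding W_def by (rule smooth_map_on_chartD[OF g D(1) E])
      show "snd D (f (chart_inv C y)) \<in> W" if "y \<in> V" for y
        using that smooth_atlas_chart(6)[OF A C] unfolding V_def W_def N_def by auto
    qed
    then have "smooth_on V (\<lambda>x. snd E (g (f (chart_inv C x))))"
      by (rule smooth_on_cong[OF oV, rotated])
        (auto simp: V_def N_def smooth_atlas_chart(6)[OF A C] smooth_atlas_chart(6)[OF B D(1)])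
    moreover have "x \<in> V" using p D sub unfolding V_def N_def by auto
    ultimately show "\<exists>V. open V \<and> x \<in> V \<and> smooth_on V (\<lambda>x. snd E (g (f (chart_inv C x))))" using oV by blast
  qed
qed

lemma smooth_map_on_subset:
  assumes "smooth_map_on A B S f" "open T" "T \<subseteq> S"
  shows "smooth_map_on A B T f"
  unfolding smooth_map_on_def o_def
proof (intro conjI ballI assms(2))
  show "continuous_on T f" using continuous_on_subset[OF smooth_map_onD(2)[OF assms(1)] assms(3)] .
  show "smooth_on (snd C ` (fst C \<inter> T \<inter> f -` fst D)) (\<lambda>x. snd D (f (chart_inv C x)))"
    if "C \<in> A" "D \<in> B" for C D
    by (rule smooth_on_subset[OF smooth_map_on_chartD[OF assms(1) that]]) (use assms(3) in blast)
qed

lemma smooth_map_on_local: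
  assumes A: "smooth_atlas A" and B: "smooth_atlas B"
    and loc: "\<And>p. p \<in> S \<Longrightarrow> \<exists>T. p \<in> T \<and> smooth_map_on A B T f" and S: "open S"
  shows "smooth_map_on A B S f"
  unfolding smooth_map_on_def o_def
proof (intro conjI ballI S)
  have "isCont f p" if p: "p \<in> S" for p
  proof -
    obtain T where T: "p \<in> T" "smooth_map_on A B T f" using loc[OF p] by blast
    then show ?thesis
      using continuous_on_eq_continuous_at[OF smooth_map_onD(1)[OF T(2)]] smooth_map_onD(2)[OF T(2)] by blast
  qed
  then show "continuous_on S f" using continuous_at_imp_continuous_on by blast
  fix C D assume C: "C \<in> A" and D: "D \<in> B"
  show "smooth_on (snd C ` (fst C \<inter> S \<inter> f -` fst D)) (\<lambda>x. snd D (f (chart_inv C x)))"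
  proof (rule smooth_on_local)
    fix x assume "x \<in> snd C ` (fst C \<inter> S \<inter> f -` fst D)"
    then obtain p where p: "p \<in> fst C" "p \<in> S" "f p \<in> fst D" "x = snd C p" by auto
    obtain T where T: "p \<in> T" "smooth_map_on A B T f" using loc[OF p(2)] by blast
    show "\<exists>V. open V \<and> x \<in> V \<and> smooth_on V (\<lambda>x. snd D (f (chart_inv C x)))"
      by (rule exI[of _ "snd C ` (fst C \<inter> T \<inter> f -` fst D)"])
        (use smooth_map_on_chart_open[OF A B T(2) C D] smooth_map_on_chartD[OF T(2) C D] p T(1) in auto)
  qed
qed

lemma smooth_map_on_cong:
  assumes "smooth_atlas A" "smooth_atlas B" "smooth_map_on A B S f" "\<And>p. p \<in> S \<Longrightarrow> f p = g p"
  shows "smooth_map_on A B S g"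
  unfolding smooth_map_on_def o_def
proof (intro conjI ballI)
  show "open S" using smooth_map_onD(1)[OF assms(3)] .
  show "continuous_on S g" using smooth_map_onD(2)[OF assms(3)] assms(4) by (simp cong: continuous_on_cong)
  fix C D assume C: "C \<in> A" and D: "D \<in> B"
  have eq: "fst C \<inter> S \<inter> f -` fst D = fst C \<inter> S \<inter> g -` fst D" using assms(4) by auto
  show "smooth_on (snd C ` (fst C \<inter> S \<inter> g -` fst D)) (\<lambda>x. snd D (g (chart_inv C x)))"
    by (rule smooth_on_cong[OF _ _ smooth_map_on_chartD[OF assms(3) C D, unfolded eq]])
      (use smooth_map_on_chart_open[OF assms(1-3) C D, unfolded eq] assms(4) smooth_atlas_chart(6)[OF assms(1) C] in auto)
qed

section \<open>Euclidean spaces and products as manifolds\<close>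

lemma smooth_atlas_euclid: "smooth_atlas (euclid_atlas :: ('a::euclidean_space, 'a) chart set)"
  unfolding smooth_atlas_def euclid_atlas_def
  by (auto simp: homeomorphism_def o_def smooth_on_id inv_id)

lemma smooth_map_on_euclid_iff:
  "smooth_map_on euclid_atlas euclid_atlas S f \<longleftrightarrow> open S \<and> smooth_on S f"
  unfolding smooth_map_on_def euclid_atlas_def
  by (auto simp: o_def inv_id smooth_on_continuous)

lemma smooth_map_on_chart:
  fixes A :: "('p::{t2_space,second_countable_topology}, 'e::euclidean_space) chart set"
  assumes "smooth_atlas A" "C \<in> A"
  shows "smooth_map_on A euclid_atlas (fst C) (snd C)"
  unfolding smooth_map_on_def o_def
proof (intro conjI ballI smooth_atlas_chart[OF assms])
  fix D and E :: "('e, 'e) chart" assume D: "D \<in> A" and E: "E \<in> euclid_atlas"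
  have "fst D \<inter> fst C \<inter> snd C -` fst E = fst D \<inter> fst C" using E by (auto simp: euclid_atlas_def)
  then show "smooth_on (snd D ` (fst D \<inter> fst C \<inter> snd C -` fst E)) (\<lambda>x. snd E (snd C (chart_inv D x)))"
    using E smooth_atlas_transition[OF assms(1) D assms(2)] by (simp add: euclid_atlas_def)
qed

lemma smooth_map_on_chart_inv:
  fixes A :: "('p::{t2_space,second_countable_topology}, 'e::euclidean_space) chart set"
  assumes "smooth_atlas A" "C \<in> A"
  shows "smooth_map_on euclid_atlas A (chart_image C) (chart_inv C)"
  unfolding smooth_map_on_def o_def
proof (intro conjI ballI smooth_atlas_chart[OF assms])
  fix D and E :: "('e, 'e) chart" assume D: "D \<in> A" and E: "E \<in> euclid_atlas"
  show "smooth_on (snd E ` (fst E \<inter> chart_image C \<inter> chart_inv C -` fst D)) (\<lambda>x. snd D (chart_inv C (chart_inv E x)))"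
    by (rule smooth_on_subset)
      (use E smooth_atlas_transition[OF assms D] smooth_atlas_chart(6,7)[OF assms] in
        \<open>auto simp: euclid_atlas_def inv_id image_iff\<close>)
qed

lemma prod_chart_inv:
  assumes "smooth_atlas A" "smooth_atlas B" "C \<in> A" "D \<in> B" "x \<in> chart_image C" "y \<in> chart_image D"
  shows "inv_into (fst C \<times> fst D) (map_prod (snd C) (snd D)) (x, y) = (chart_inv C x, chart_inv D y)"
proof (rule inv_into_f_eq)
  show "inj_on (map_prod (snd C) (snd D)) (fst C \<times> fst D)"
    by (rule map_prod_inj_on) (use smooth_atlas_chart(5) assms in blast)+
qed (use smooth_atlas_chart(7)[OF assms(1,3)] smooth_atlas_chart(7)[OF assms(2,4)] assms(5,6) in auto)

lemma smooth_atlas_prod: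
  fixes A :: "('p::{t2_space,second_countable_topology}, 'e::euclidean_space) chart set"
    and B :: "('q::{t2_space,second_countable_topology}, 'f::euclidean_space) chart set"
  assumes A: "smooth_atlas A" and B: "smooth_atlas B"
  shows "smooth_atlas (prod_atlas A B)"
  unfolding smooth_atlas_def o_def
proof (intro conjI ballI)
  show "(\<Union>C\<in>prod_atlas A B. fst C) = UNIV"
    using smooth_atlas_cover[OF A] smooth_atlas_cover[OF B] unfolding prod_atlas_def by fastforce
  fix E assume "E \<in> prod_atlas A B"
  then obtain C D where E: "C \<in> A" "D \<in> B" "E = (fst C \<times> fst D, map_prod (snd C) (snd D))"
    by (auto simp: prod_atlas_def)
  note c = smooth_atlas_chart[OF A E(1)] and d = smooth_atlas_chart[OF B E(2)]
  have im: "chart_image E = chart_image C \<times> chart_image D" by (auto simp: E(3))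
  show "open (fst E)" using c(1) d(1) by (simp add: E(3) open_Times)
  show "open (chart_image E)" using c(2) d(2) by (simp add: im open_Times)
  have inv: "chart_inv E z = (chart_inv C (fst z), chart_inv D (snd z))" if "z \<in> chart_image E" for z
    using prod_chart_inv[OF A B E(1,2), of "fst z" "snd z"] that by (auto simp: E(3))
  show "homeomorphism (fst E) (chart_image E) (snd E) (chart_inv E)"
  proof (rule homeomorphismI)
    show "continuous_on (fst E) (snd E)"
      unfolding E(3) map_prod_def split_def
      by (auto intro!: continuous_intros continuous_on_compose2[OF c(3)] continuous_on_compose2[OF d(3)])
    have "continuous_on (chart_image E) (\<lambda>z. (chart_inv C (fst z), chart_inv D (snd z)))"
      unfolding im
      by (auto intro!: continuous_intros continuous_on_compose2[OF c(4)] continuous_on_compose2[OF d(4)])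
    then show "continuous_on (chart_image E) (chart_inv E)"
      by (rule continuous_on_eq) (simp add: inv)
    show "chart_inv E ` chart_image E \<subseteq> fst E"
      using inv c(7) d(7) by (auto simp: im E(3))
    show "chart_inv E (snd E p) = p" if "p \<in> fst E" for p
      using inv[of "snd E p"] c(6) d(6) that by (auto simp: E(3))
    show "snd E (chart_inv E z) = z" if "z \<in> chart_image E" for z
      using inv[OF that] c(7) d(7) that by (auto simp: im E(3))
  qed auto
  fix E' assume "E' \<in> prod_atlas A B"
  then obtain C' D' where E': "C' \<in> A" "D' \<in> B" "E' = (fst C' \<times> fst D', map_prod (snd C') (snd D'))"
    by (auto simp: prod_atlas_def)
  define P where "P = snd C ` (fst C \<inter> fst C')"
  define Q where "Q = snd D ` (fst D \<inter> fst D')"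
  have oPQ: "open P" "open Q" "open (P \<times> Q)"
    unfolding P_def Q_def using smooth_atlas_open_image[OF A E(1) smooth_atlas_chart(1)[OF A E'(1)]]
      smooth_atlas_open_image[OF B E(2) smooth_atlas_chart(1)[OF B E'(2)]] by (auto intro: open_Times)
  have PQ: "snd E ` (fst E \<inter> fst E') = P \<times> Q" unfolding E E' P_def Q_def by auto
  have 1: "smooth_on (P \<times> Q) (\<lambda>z. snd C' (chart_inv C (fst z)))"
    by (rule smooth_on_compose[OF oPQ(3,1) smooth_on_bounded_linear[OF oPQ(3) bounded_linear_fst smooth_on_id[OF oPQ(3)]]
          smooth_atlas_transition[OF A E(1) E'(1), folded P_def]]) auto
  have 2: "smooth_on (P \<times> Q) (\<lambda>z. snd D' (chart_inv D (snd z)))"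
    by (rule smooth_on_compose[OF oPQ(3,2) smooth_on_bounded_linear[OF oPQ(3) bounded_linear_snd smooth_on_id[OF oPQ(3)]]
          smooth_atlas_transition[OF B E(2) E'(2), folded Q_def]]) auto
  from smooth_on_Pair[OF oPQ(3) 1 2]
  have "smooth_on (P \<times> Q) (\<lambda>z. (snd C' (chart_inv C (fst z)), snd D' (chart_inv D (snd z))))" .
  then show "smooth_on (snd E ` (fst E \<inter> fst E')) (\<lambda>z. snd E' (chart_inv E z))"
    unfolding PQ by (rule smooth_on_cong[OF oPQ(3), rotated]) (auto simp: inv im P_def Q_def E'(3))
qed

text \<open>An equality of chart sets: pairing two maps into Euclidean spaces by
  \<open>smooth_map_on_Pair\<close> thus gives a map that is smooth in the plain Euclidean
  sense.\<close>

lemma prod_atlas_euclid: "prod_atlas euclid_atlas euclid_atlas = euclid_atlas"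
  by (simp add: prod_atlas_def euclid_atlas_def prod.map_id0)

lemma smooth_map_on_Pair:
  fixes A :: "('p::{t2_space,second_countable_topology}, 'e::euclidean_space) chart set"
    and B :: "('q::{t2_space,second_countable_topology}, 'f::euclidean_space) chart set"
    and K :: "('r::{t2_space,second_countable_topology}, 'g::euclidean_space) chart set"
  assumes A: "smooth_atlas A" and B: "smooth_atlas B" and K: "smooth_atlas K"
    and f: "smooth_map_on A B S f" and g: "smooth_map_on A K S g"
  shows "smooth_map_on A (prod_atlas B K) S (\<lambda>p. (f p, g p))"
  unfolding smooth_map_on_def o_def
proof (intro conjI ballI)
  show oS: "open S" using smooth_map_onD(1)[OF f] .
  show cont: "continuous_on S (\<lambda>p. (f p, g p))"
    using smooth_map_onD(2)[OF f] smooth_map_onD(2)[OF g] by (rule continuous_on_Pair)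
  fix C E assume C: "C \<in> A" and "E \<in> prod_atlas B K"
  then obtain D D' where E: "D \<in> B" "D' \<in> K" "E = (fst D \<times> fst D', map_prod (snd D) (snd D'))"
    by (auto simp: prod_atlas_def)
  define V where "V = snd C ` (fst C \<inter> (S \<inter> (\<lambda>p. (f p, g p)) -` fst E))"
  have "open (fst E)" using smooth_atlas_chart(1)[OF smooth_atlas_prod[OF B K] \<open>E \<in> prod_atlas B K\<close>] .
  then have oV: "open V"
    unfolding V_def using smooth_atlas_open_image[OF A C continuous_open_preimage[OF cont oS]] by blast
  have "smooth_on V (\<lambda>x. (snd D (f (chart_inv C x)), snd D' (g (chart_inv C x))))"
    by (rule smooth_on_Pair[OF oV smooth_on_subset[OF smooth_map_on_chartD[OF f C E(1)]]
          smooth_on_subset[OF smooth_map_on_chartD[OF g C E(2)]]]) (auto simp: V_def E(3))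
  then show "smooth_on (snd C ` (fst C \<inter> S \<inter> (\<lambda>p. (f p, g p)) -` fst E))
      (\<lambda>x. snd E (f (chart_inv C x), g (chart_inv C x)))"
    by (simp add: V_def E(3) Int_assoc)
qed

lemma
  fixes A :: "('p::{t2_space,second_countable_topology}, 'e::euclidean_space) chart set"
    and B :: "('q::{t2_space,second_countable_topology}, 'f::euclidean_space) chart set"
  assumes A: "smooth_atlas A" and B: "smooth_atlas B"
  shows smooth_map_fst: "smooth_map (prod_atlas A B) A fst"
    and smooth_map_snd: "smooth_map (prod_atlas A B) B snd"
proof -
  \<comment> \<open>Both projections at once, since they share the decomposition of
    \<open>E\<close>; the price is that a chart of each factor has to be supplied, though each
    projection concerns only one.\<close>
  have "smooth_on (snd E ` (fst E \<inter> UNIV \<inter> fst -` fst C')) (\<lambda>z. snd C' (fst (chart_inv E z))) \<and>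
    smooth_on (snd E ` (fst E \<inter> UNIV \<inter> snd -` fst D')) (\<lambda>z. snd D' (snd (chart_inv E z)))"
    if CD': "C' \<in> A" "D' \<in> B" and "E \<in> prod_atlas A B" for E C' D'
  proof -
    obtain C D where E: "C \<in> A" "D \<in> B" "E = (fst C \<times> fst D, map_prod (snd C) (snd D))"
      using \<open>E \<in> prod_atlas A B\<close> by (auto simp: prod_atlas_def)
    define P where "P = snd C ` (fst C \<inter> fst C')"
    define Q where "Q = snd D ` (fst D \<inter> fst D')"
    have oP: "open P" and oQ: "open Q"
      unfolding P_def Q_def using smooth_atlas_open_image[OF A E(1) smooth_atlas_chart(1)[OF A CD'(1)]]
        smooth_atlas_open_image[OF B E(2) smooth_atlas_chart(1)[OF B CD'(2)]] by auto
    have o1: "open (P \<times> chart_image D)" and o2: "open (chart_image C \<times> Q)"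
      using oP oQ smooth_atlas_chart(2)[OF A E(1)] smooth_atlas_chart(2)[OF B E(2)] by (auto intro: open_Times)
    have inv: "chart_inv E (x, y) = (chart_inv C x, chart_inv D y)"
      if "x \<in> chart_image C" "y \<in> chart_image D" for x y
      using prod_chart_inv[OF A B E(1,2) that] by (simp add: E(3))
    have 1: "smooth_on (P \<times> chart_image D) (\<lambda>z. snd C' (chart_inv C (fst z)))"
      by (rule smooth_on_compose[OF o1 oP smooth_on_bounded_linear[OF o1 bounded_linear_fst smooth_on_id[OF o1]]])
        (use smooth_atlas_transition[OF A E(1) CD'(1), folded P_def] in auto)
    have 2: "smooth_on (chart_image C \<times> Q) (\<lambda>z. snd D' (chart_inv D (snd z)))"
      by (rule smooth_on_compose[OF o2 oQ smooth_on_bounded_linear[OF o2 bounded_linear_snd smooth_on_id[OF o2]]])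
        (use smooth_atlas_transition[OF B E(2) CD'(2), folded Q_def] in auto)
    have s1: "snd E ` (fst E \<inter> UNIV \<inter> fst -` fst C') = P \<times> chart_image D"
      by (auto simp: E(3) P_def image_iff)
    have s2: "snd E ` (fst E \<inter> UNIV \<inter> snd -` fst D') = chart_image C \<times> Q"
      by (auto simp: E(3) Q_def image_iff)
    show ?thesis unfolding s1 s2
    proof
      show "smooth_on (P \<times> chart_image D) (\<lambda>z. snd C' (fst (chart_inv E z)))"
        by (rule smooth_on_cong[OF o1 _ 1]) (auto simp: P_def inv)
      show "smooth_on (chart_image C \<times> Q) (\<lambda>z. snd D' (snd (chart_inv E z)))"
        by (rule smooth_on_cong[OF o2 _ 2]) (auto simp: Q_def inv)
    qed
  qed
  note * = this
  obtain C\<^sub>0 D\<^sub>0 where 0: "C\<^sub>0 \<in> A" "D\<^sub>0 \<in> B"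
    using smooth_atlas_cover[OF A] smooth_atlas_cover[OF B] by blast
  show "smooth_map (prod_atlas A B) A fst"
    unfolding smooth_map_on_def o_def
  proof (intro conjI ballI)
    show "smooth_on (snd E ` (fst E \<inter> UNIV \<inter> fst -` fst C)) (\<lambda>z. snd C (fst (chart_inv E z)))"
      if "E \<in> prod_atlas A B" "C \<in> A" for E C
      using *[OF that(2) 0(2) that(1)] by blast
  qed (auto intro: continuous_on_fst continuous_on_id)
  show "smooth_map (prod_atlas A B) B snd"
    unfolding smooth_map_on_def o_def
  proof (intro conjI ballI)
    show "smooth_on (snd E ` (fst E \<inter> UNIV \<inter> snd -` fst D)) (\<lambda>z. snd D (snd (chart_inv E z)))"
      if "E \<in> prod_atlas A B" "D \<in> B" for E D
      using *[OF 0(1) that(2,1)] by blast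
  qed (auto intro: continuous_on_snd continuous_on_id)
qed

lemma smooth_map_on_const:
  assumes "smooth_atlas A" "open S"
  shows "smooth_map_on A B S (\<lambda>_. q)"
  using assms(2) unfolding smooth_map_on_def o_def by (auto simp: smooth_on_const)

lemma smooth_map_id: "smooth_atlas A \<Longrightarrow> smooth_map A A (\<lambda>p. p)"
  unfolding smooth_map_on_def by (auto simp: o_def intro: smooth_on_subset[OF smooth_atlas_transition])

section \<open>Velocities and differentials\<close>

lemma charts_around_iff: "C \<in> charts_around A p \<longleftrightarrow> C \<in> A \<and> p \<in> fst C"
  by (simp add: charts_around_def)

lemma chart_at_charts_around: "smooth_atlas A \<Longrightarrow> chart_at A p \<in> charts_around A p"
  unfolding chart_at_def by (rule someI_ex) (use smooth_atlas_cover[of A p] in \<open>auto simp: charts_around_iff\<close>)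

lemma smooth_map_on_chart_has_derivative:
  assumes "smooth_map_on A B S f" "C \<in> charts_around A p" "D \<in> charts_around B (f p)" "p \<in> S"
  shows "((\<lambda>x. snd D (f (chart_inv C x))) has_derivative
    frechet_derivative (snd D \<circ> f \<circ> chart_inv C) (at (snd C p))) (at (snd C p))"
  using smooth_on_has_derivative[OF smooth_map_on_chartD[OF assms(1)], of C D "snd C p"] assms(2-4)
  by (auto simp: charts_around_iff o_def)

text \<open>The \<open>tangent_map\<close> of a map out of a normed space, with the direction a
  plain vector and not a family over charts. It serves curves and maps of several real parameters
  alike.\<close>

definition differential ::
  "('p, 'e::real_normed_vector) chart set \<Rightarrow> ('n::real_normed_vector \<Rightarrow> 'p) \<Rightarrow> 'n \<Rightarrow> 'n \<Rightarrow> ('p, 'e) tangent" where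
  "differential A F x w =
     (\<lambda>C. if C \<in> charts_around A (F x) then frechet_derivative (\<lambda>y. snd C (F y)) (at x) w else 0)"

lemma smooth_map_on_euclid_chartD:
  fixes F :: "'n::euclidean_space \<Rightarrow> 'p::topological_space"
  assumes "smooth_map_on euclid_atlas A S F" "C \<in> A"
  shows "smooth_on (S \<inter> F -` fst C) (\<lambda>y. snd C (F y))"
  using smooth_map_on_chartD[OF assms(1) _ assms(2), of "(UNIV, id)"] by (simp add: euclid_atlas_def inv_id)

lemma smooth_map_on_to_euclid_chartD:
  assumes "smooth_map_on A euclid_atlas S f" "C \<in> A"
  shows "smooth_on (snd C ` (fst C \<inter> S)) (\<lambda>x. f (chart_inv C x))"
  using smooth_map_on_chartD[OF assms(1,2), of "(UNIV, id)"] by (simp add: euclid_atlas_def)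

context
  fixes A :: "('p::{t2_space,second_countable_topology}, 'e::euclidean_space) chart set"
  assumes A: "smooth_atlas A"
begin

lemma smooth_map_on_euclid_open:
  assumes "smooth_map_on euclid_atlas A S F" "C \<in> A"
  shows "open (S \<inter> F -` fst C)"
  by (rule smooth_map_on_open_preimage[OF assms(1) smooth_atlas_chart(1)[OF A assms(2)]])

lemma differential_chart:
  fixes F :: "'n::euclidean_space \<Rightarrow> 'p"
  assumes "smooth_map_on euclid_atlas A S F" "x \<in> S" "C \<in> charts_around A (F x)"
  shows "((\<lambda>y. snd C (F y)) has_derivative (\<lambda>w. differential A F x w C)) (at x)"
  using smooth_on_has_derivative[OF smooth_map_on_euclid_chartD[OF assms(1)], of C x] assms(2,3)
  by (simp add: charts_around_iff differential_def)

text \<open>Chain rule in each chart. Partial velocities of a map with several parameters become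
  values of one linear map, which is how they are compared later.\<close>

lemma velocity_eq_differential:
  fixes F :: "'n::euclidean_space \<Rightarrow> 'p"
  assumes F: "smooth_map_on euclid_atlas A S F" "c t \<in> S" and c: "(c has_vector_derivative v) (at t)"
  shows "velocity A (\<lambda>s. F (c s)) t = differential A F (c t) v"
proof
  fix C
  show "velocity A (\<lambda>s. F (c s)) t C = differential A F (c t) v C"
  proof (cases "C \<in> charts_around A (F (c t))")
    case True
    from has_vector_derivative_compose_derivative[OF c differential_chart[OF F True]]
    have "((\<lambda>s. snd C (F (c s))) has_vector_derivative differential A F (c t) v C) (at t)" .
    then show ?thesis using True by (simp add: velocity_def o_def vector_derivative_at)
  qed (simp add: velocity_def differential_def)
qed

lemma velocity_differential_1:
  assumes "smooth_map_on euclid_atlas A S c" "t \<in> S"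
  shows "velocity A c t = differential A c t 1"
  using velocity_eq_differential[OF assms(1), of "\<lambda>s. s" t 1] assms(2) by (simp add: has_vector_derivative_id)

lemma velocity_chart:
  assumes "smooth_map_on euclid_atlas A S c" "t \<in> S" "C \<in> charts_around A (c t)"
  shows "((\<lambda>s. snd C (c s)) has_vector_derivative velocity A c t C) (at t)"
  using has_vector_derivative_compose_derivative[OF has_vector_derivative_id differential_chart[OF assms]]
  by (simp add: velocity_differential_1[OF assms(1,2)] o_def)

lemma velocity_cong:
  assumes "open T" "t \<in> T" "\<And>s. s \<in> T \<Longrightarrow> c s = d s" 
    and d: "smooth_map_on euclid_atlas A S d" "t \<in> S"
  shows "velocity A c t = velocity A d t"
proof
  fix C
  show "velocity A c t C = velocity A d t C"
  proof (cases "C \<in> charts_around A (d t)")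
    case True
    have "((\<lambda>s. snd C (c s)) has_vector_derivative velocity A d t C) (at t)"
      by (rule has_vector_derivative_transform_within_open[OF velocity_chart[OF d True] assms(1,2)])
        (simp add: assms(3))
    then show ?thesis using True assms(2,3) by (simp add: velocity_def o_def vector_derivative_at)
  qed (use assms(2,3) in \<open>simp add: velocity_def\<close>)
qed

text \<open>\<open>tangent_map\<close> is computed in one arbitrarily chosen source chart; on the
  velocity of a curve the choice cancels, by the chain rule.\<close>

lemma tangent_map_velocity:
  fixes B :: "('q::{t2_space,second_countable_topology}, 'f::euclidean_space) chart set"
  assumes c: "smooth_map_on euclid_atlas A S c" "t \<in> S" and f: "smooth_map_on A B T f" "c t \<in> T"
  shows "tangent_map A B f (c t) (velocity A c t) = velocity B (\<lambda>s. f (c s)) t"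
proof
  fix D
  define C where "C = chart_at A (c t)"
  have C: "C \<in> charts_around A (c t)" unfolding C_def by (rule chart_at_charts_around[OF A])
  then have CA: "C \<in> A" "c t \<in> fst C" by (auto simp: charts_around_iff)
  show "tangent_map A B f (c t) (velocity A c t) D = velocity B (\<lambda>s. f (c s)) t D"
  proof (cases "D \<in> charts_around B (f (c t))")
    case True
    from has_vector_derivative_compose_derivative[OF velocity_chart[OF c C]
        smooth_map_on_chart_has_derivative[OF f(1) C True f(2)]]
    have "((\<lambda>s. snd D (f (c s))) has_vector_derivative
      frechet_derivative (snd D \<circ> f \<circ> chart_inv C) (at (snd C (c t))) (velocity A c t C)) (at t)"
      by (rule has_vector_derivative_transform_within_open[OF _ smooth_map_on_euclid_open[OF c(1) CA(1)]])
        (use c(2) CA smooth_atlas_chart(6)[OF A CA(1)] in auto)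
    then show ?thesis using True
      by (simp add: tangent_map_def C_def[symmetric] velocity_def[of B] o_def vector_derivative_at)
  qed (simp add: tangent_map_def velocity_def Let_def)
qed

section \<open>Tangent vectors as velocities of curves\<close>

lemma tangent_space_chart_change:
  "v \<in> tangent_space A p \<Longrightarrow> C \<in> charts_around A p \<Longrightarrow> D \<in> charts_around A p \<Longrightarrow>
    v D = frechet_derivative (snd D \<circ> chart_inv C) (at (snd C p)) (v C)"
  unfolding tangent_space_def by blast

lemma tangent_space_outside: "v \<in> tangent_space A p \<Longrightarrow> C \<notin> charts_around A p \<Longrightarrow> v C = 0"
  unfolding tangent_space_def by blast

lemma tangent_space_eqI:
  assumes "u \<in> tangent_space A p" "v \<in> tangent_space A p" "C \<in> charts_around A p" "u C = v C"
  shows "u = v"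
proof
  show "u D = v D" for D
    using tangent_space_chart_change[OF assms(1,3), of D] tangent_space_chart_change[OF assms(2,3), of D]
      tangent_space_outside[OF assms(1), of D] tangent_space_outside[OF assms(2), of D] assms(4)
    by (cases "D \<in> charts_around A p") simp_all
qed

lemma velocity_tangent_space:
  assumes c: "smooth_map_on euclid_atlas A S c" "t \<in> S"
  shows "velocity A c t \<in> tangent_space A (c t)"
  unfolding tangent_space_def
proof (intro CollectI conjI ballI allI impI)
  fix C D assume C: "C \<in> charts_around A (c t)" and D: "D \<in> charts_around A (c t)"
  from has_vector_derivative_compose_derivative[OF velocity_chart[OF c C]
      smooth_map_on_chart_has_derivative[OF smooth_map_id[OF A] C D UNIV_I]]
  have "((\<lambda>s. snd D (c s)) has_vector_derivative
      frechet_derivative (snd D \<circ> (\<lambda>p. p) \<circ> chart_inv C) (at (snd C (c t))) (velocity A c t C)) (at t)"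
    by (rule has_vector_derivative_transform_within_open[OF _ smooth_map_on_euclid_open[OF c(1), of C]])
      (use C c(2) smooth_atlas_chart(6)[OF A, of C] in \<open>auto simp: charts_around_iff\<close>)
  then show "velocity A c t D = frechet_derivative (snd D \<circ> chart_inv C) (at (snd C (c t))) (velocity A c t C)"
    using D by (simp add: velocity_def[of A c t] o_def vector_derivative_at)
qed (simp add: velocity_def)

lemma differential_tangent_space:
  fixes F :: "'n::euclidean_space \<Rightarrow> 'p"
  assumes F: "smooth_map_on euclid_atlas A S F" "x \<in> S"
  shows "differential A F x w \<in> tangent_space A (F x)"
proof -
  define l where "l h = x + h *\<^sub>R w" for h :: real
  have l: "(l has_vector_derivative w) (at 0)" unfolding l_def by (auto intro!: derivative_eq_intros)
  have oS: "open S" using F(1) smooth_map_onD by blast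
  have "continuous_on UNIV l" unfolding l_def by (intro continuous_intros)
  then have o: "open (l -` S)" using open_vimage[OF oS] by blast
  have "smooth_on (l -` S) l" unfolding l_def
    by (intro smooth_on_add smooth_on_const smooth_on_bounded_linear[OF _ bounded_linear_scaleR_left] smooth_on_id)
      (use o in \<open>simp_all add: l_def[abs_def]\<close>)
  then have "smooth_map_on euclid_atlas A (l -` S) (\<lambda>h. F (l h))"
    by (intro smooth_map_on_compose[OF smooth_atlas_euclid smooth_atlas_euclid A _ F(1)])
      (auto simp: smooth_map_on_euclid_iff o)
  from velocity_tangent_space[OF this, of 0] F(2) velocity_eq_differential[OF F(1) _ l]
  show ?thesis by (simp add: l_def)
qed

lemma differential_lincomb:
  fixes F :: "'n::euclidean_space \<Rightarrow> 'p"
  assumes F: "smooth_map_on euclid_atlas A S F" "x \<in> S"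
  shows "differential A F x (a *\<^sub>R u + b *\<^sub>R v) = (\<lambda>C. a *\<^sub>R differential A F x u C + b *\<^sub>R differential A F x v C)"
proof
  fix C
  show "differential A F x (a *\<^sub>R u + b *\<^sub>R v) C = a *\<^sub>R differential A F x u C + b *\<^sub>R differential A F x v C"
  proof (cases "C \<in> charts_around A (F x)")
    case True
    have l: "linear (\<lambda>w. differential A F x w C)"
      by (rule bounded_linear.linear[OF has_derivative_bounded_linear[OF differential_chart[OF F True]]])
    show ?thesis using linear_add[OF l] linear_scale[OF l] by simp
  qed (simp add: differential_def)
qed

text \<open>The curve is a straight line in the coordinates of \<open>C\<close>. It starts from an
  arbitrary vector \<open>e\<close>, not from a tangent vector, so that it also shows that every
  \<open>e\<close> is the component of some tangent vector.\<close>

lemma tangent_vector_curve: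
  assumes C: "C \<in> charts_around A p"
  obtains c S where "0 \<in> S" "smooth_map_on euclid_atlas A S c" "c 0 = p" "velocity A c 0 C = e"
    "\<And>v. v \<in> tangent_space A p \<Longrightarrow> v C = e \<Longrightarrow> velocity A c 0 = v"
proof -
  have CA: "C \<in> A" "p \<in> fst C" using C by (auto simp: charts_around_iff)
  note ch = smooth_atlas_chart[OF A CA(1)]
  have F: "smooth_map_on euclid_atlas A (chart_image C) (chart_inv C)" by (rule smooth_map_on_chart_inv[OF A CA(1)])
  define l where "l h = snd C p + h *\<^sub>R e" for h :: real
  have l: "(l has_vector_derivative e) (at 0)" unfolding l_def by (auto intro!: derivative_eq_intros)
  have "continuous_on UNIV l" unfolding l_def by (intro continuous_intros)
  then have o: "open (l -` chart_image C)" using open_vimage[OF ch(2)] by blast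
  have "smooth_on (l -` chart_image C) l" unfolding l_def
    by (intro smooth_on_add smooth_on_const smooth_on_bounded_linear[OF _ bounded_linear_scaleR_left] smooth_on_id)
      (use o in \<open>simp_all add: l_def[abs_def]\<close>)
  then have sm: "smooth_map_on euclid_atlas A (l -` chart_image C) (\<lambda>h. chart_inv C (l h))"
    by (intro smooth_map_on_compose[OF smooth_atlas_euclid smooth_atlas_euclid A _ F])
      (auto simp: smooth_map_on_euclid_iff o)
  have l0: "0 \<in> l -` chart_image C" "chart_inv C (l 0) = p" using CA ch(6) by (auto simp: l_def)
  have "((\<lambda>h. snd C (chart_inv C (l h))) has_vector_derivative e) (at 0)"
    by (rule has_vector_derivative_transform_within_open[OF l o l0(1)]) (use ch(7) in auto)
  moreover have "((\<lambda>h. snd C (chart_inv C (l h))) has_vector_derivative velocity A (\<lambda>h. chart_inv C (l h)) 0 C) (at 0)"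
    by (rule velocity_chart[OF sm l0(1)]) (use C l0(2) in simp)
  ultimately have e: "velocity A (\<lambda>h. chart_inv C (l h)) 0 C = e" by (rule vector_derivative_unique_at[rotated])
  have "velocity A (\<lambda>h. chart_inv C (l h)) 0 = v" if "v \<in> tangent_space A p" "v C = e" for v
    by (rule tangent_space_eqI[OF velocity_tangent_space[OF sm l0(1), unfolded l0(2)] that(1) C])
      (simp add: e that)
  then show thesis by (rule that[OF l0(1) sm l0(2) e])
qed

lemma tangent_space_velocity:
  assumes v: "v \<in> tangent_space A p"
  obtains c S where "0 \<in> S" "smooth_map_on euclid_atlas A S c" "c 0 = p" "velocity A c 0 = v"
  using tangent_vector_curve[OF chart_at_charts_around[OF A, of p], of "v (chart_at A p)"] v by metis

text \<open>A direct proof of the chart-change rule for the family \<open>coord_vec\<close> would be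
  another chain rule; instead the family is recognised as the velocity of a curve with component
  \<open>e\<close> in \<open>C\<close>.\<close>

lemma coord_vec:
  assumes C: "C \<in> charts_around A p"
  shows "coord_vec A C p e \<in> tangent_space A p" "coord_vec A C p e C = e"
proof -
  obtain c S where c: "0 \<in> S" "smooth_map_on euclid_atlas A S c" "c 0 = p" "velocity A c 0 C = e"
    using tangent_vector_curve[OF C] by metis
  have v: "velocity A c 0 \<in> tangent_space A p" using velocity_tangent_space[OF c(2,1)] c(3) by simp
  have "velocity A c 0 = coord_vec A C p e"
    using tangent_space_chart_change[OF v C] tangent_space_outside[OF v] c(4)
    by (simp add: coord_vec_def fun_eq_iff)
  then show "coord_vec A C p e \<in> tangent_space A p" "coord_vec A C p e C = e" using v c(4) by auto
qed

lemma tangent_map_tangent_space: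
  fixes B :: "('q::{t2_space,second_countable_topology}, 'f::euclidean_space) chart set"
  assumes "smooth_atlas B" "smooth_map_on A B T f" "p \<in> T" "v \<in> tangent_space A p"
  shows "tangent_map A B f p v \<in> tangent_space B (f p)"
proof -
  have dC: "(((\<lambda>x. snd D (f (chart_inv C x)))) has_derivative
      frechet_derivative (snd D \<circ> f \<circ> chart_inv C) (at (snd C p))) (at (snd C p))"
    if "C \<in> charts_around A p" "D \<in> charts_around B (f p)" for C D
    by (rule smooth_map_on_chart_has_derivative[OF assms(2) that assms(3)])
  show ?thesis
    unfolding tangent_space_def
  proof (intro CollectI conjI allI ballI impI)
    fix D E assume D: "D \<in> charts_around B (f p)" and E: "E \<in> charts_around B (f p)"
    define C where "C = chart_at A p"
    have C: "C \<in> charts_around A p" unfolding C_def by (rule chart_at_charts_around[OF A])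
    then have CA: "C \<in> A" "p \<in> fst C" by (auto simp: charts_around_iff)
    have DB: "D \<in> B" "f p \<in> fst D" using D by (auto simp: charts_around_iff)
    have trans: "((\<lambda>y. snd E (chart_inv D y)) has_derivative
        frechet_derivative (snd E \<circ> chart_inv D) (at (snd D (f p)))) (at (snd D (f (chart_inv C (snd C p)))))"
      using smooth_on_has_derivative[OF smooth_atlas_transition[OF assms(1)], of D E "snd D (f p)"] D E CA
        smooth_atlas_chart(6)[OF A CA(1)] by (auto simp: charts_around_iff o_def)
    have "((\<lambda>x. snd E (chart_inv D (snd D (f (chart_inv C x))))) has_derivative
       (\<lambda>w. frechet_derivative (snd E \<circ> chart_inv D) (at (snd D (f p)))
         (frechet_derivative (snd D \<circ> f \<circ> chart_inv C) (at (snd C p)) w))) (at (snd C p))"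
      using has_derivative_compose[OF dC[OF C D] trans] .
    then have "((\<lambda>x. snd E (f (chart_inv C x))) has_derivative
       (\<lambda>w. frechet_derivative (snd E \<circ> chart_inv D) (at (snd D (f p)))
         (frechet_derivative (snd D \<circ> f \<circ> chart_inv C) (at (snd C p)) w))) (at (snd C p))"
      by (rule has_derivative_transform_within_open[OF _ smooth_map_on_chart_open[OF A assms(1,2) CA(1) DB(1)]])
        (use CA DB assms(3) smooth_atlas_chart(6)[OF assms(1) DB(1)] smooth_atlas_chart(6)[OF A CA(1)] in auto)
    from has_derivative_unique[OF this dC[OF C E]]
    show "tangent_map A B f p v E =
        frechet_derivative (snd E \<circ> chart_inv D) (at (snd D (f p))) (tangent_map A B f p v D)"
      using D E by (simp add: tangent_map_def Let_def C_def[symmetric] fun_eq_iff)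
  qed (simp add: tangent_map_def Let_def)
qed

lemma tangent_map_lincomb:
  fixes B :: "('q::{t2_space,second_countable_topology}, 'f::euclidean_space) chart set"
  assumes "smooth_map_on A B T f" "p \<in> T"
  shows "tangent_map A B f p (\<lambda>C. a *\<^sub>R u C + b *\<^sub>R v C) =
    (\<lambda>D. a *\<^sub>R tangent_map A B f p u D + b *\<^sub>R tangent_map A B f p v D)"
proof
  fix D
  define C where "C = chart_at A p"
  have C: "C \<in> charts_around A p" unfolding C_def by (rule chart_at_charts_around[OF A])
  show "tangent_map A B f p (\<lambda>C. a *\<^sub>R u C + b *\<^sub>R v C) D =
    a *\<^sub>R tangent_map A B f p u D + b *\<^sub>R tangent_map A B f p v D"
  proof (cases "D \<in> charts_around B (f p)")
    case True
    show ?thesis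
      using bounded_linear.linear[OF has_derivative_bounded_linear[OF smooth_map_on_chart_has_derivative[OF assms(1) C True assms(2)]]] True
      by (simp add: tangent_map_def Let_def C_def[symmetric] linear_add linear_scale)
  qed (simp add: tangent_map_def Let_def)
qed

lemma tangent_space_lincomb:
  assumes "u \<in> tangent_space A p" "v \<in> tangent_space A p"
  shows "(\<lambda>C. a *\<^sub>R u C + b *\<^sub>R v C) \<in> tangent_space A p"
  unfolding tangent_space_def
proof (intro CollectI conjI allI ballI impI)
  fix C D assume CD: "C \<in> charts_around A p" "D \<in> charts_around A p"
  have "linear (frechet_derivative (snd D \<circ> chart_inv C) (at (snd C p)))"
    using smooth_on_linear_deriv[OF smooth_atlas_transition[OF A], of C D "snd C p"] CD
    by (auto simp: charts_around_iff o_def)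
  then show "a *\<^sub>R u D + b *\<^sub>R v D =
      frechet_derivative (snd D \<circ> chart_inv C) (at (snd C p)) (a *\<^sub>R u C + b *\<^sub>R v C)"
    using tangent_space_chart_change[OF assms(1) CD] tangent_space_chart_change[OF assms(2) CD]
    by (simp add: linear_add linear_scale)
qed (simp add: tangent_space_outside[OF assms(1)] tangent_space_outside[OF assms(2)])

section \<open>Forms evaluated along curves and maps\<close>

lemma d_fun_velocity:
  assumes c: "smooth_map_on euclid_atlas A S c" "t \<in> S" and f: "smooth_map_on A euclid_atlas T f" "c t \<in> T"
  shows "((\<lambda>s. f (c s)) has_vector_derivative d_fun A f (c t) (velocity A c t)) (at t)"
proof -
  define C where "C = chart_at A (c t)"
  have C: "C \<in> charts_around A (c t)" unfolding C_def by (rule chart_at_charts_around[OF A])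
  then have CA: "C \<in> A" "c t \<in> fst C" by (auto simp: charts_around_iff)
  have "((\<lambda>x. f (chart_inv C x)) has_derivative frechet_derivative (f \<circ> chart_inv C) (at (snd C (c t)))) (at (snd C (c t)))"
    using smooth_on_has_derivative[OF smooth_map_on_to_euclid_chartD[OF f(1) CA(1)], of "snd C (c t)"] CA f(2)
    by (auto simp: o_def)
  from has_vector_derivative_compose_derivative[OF velocity_chart[OF c C] this]
  show ?thesis
    unfolding d_fun_def Let_def C_def[symmetric]
    by (rule has_vector_derivative_transform_within_open[OF _ smooth_map_on_euclid_open[OF c(1) CA(1)]])
      (use c(2) CA smooth_atlas_chart(6)[OF A CA(1)] in auto)
qed

text \<open>\<open>one_form\<close> gives smoothness only for the coefficients on
  \<open>coord_vec\<close> and linearity only on tangent spaces; this expansion makes both usable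
  for arbitrary tangent vectors.\<close>

lemma one_form_coord:
  assumes \<alpha>: "one_form A \<alpha>" and C: "C \<in> charts_around A p" and v: "v \<in> tangent_space A p"
  shows "\<alpha> p v = (\<Sum>i\<in>Basis. (v C \<bullet> i) * \<alpha> p (coord_vec A C p i))"
proof -
  have lin: "\<alpha> p (\<lambda>C. a *\<^sub>R u C + b *\<^sub>R w C) = a * \<alpha> p u + b * \<alpha> p w"
    if "u \<in> tangent_space A p" "w \<in> tangent_space A p" for u w a b
    using \<alpha> that unfolding one_form_def by blast
  have add: "coord_vec A C p (a *\<^sub>R e + b *\<^sub>R e') = (\<lambda>D. a *\<^sub>R coord_vec A C p e D + b *\<^sub>R coord_vec A C p e' D)" for a b e e'
    by (rule tangent_space_eqI[OF coord_vec(1)[OF C] tangent_space_lincomb C]) (simp_all add: coord_vec[OF C])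
  have "\<alpha> p (coord_vec A C p (\<Sum>i\<in>I. k i *\<^sub>R i)) = (\<Sum>i\<in>I. k i * \<alpha> p (coord_vec A C p i))" for I :: "'e set" and k
  proof (induction I rule: infinite_finite_induct)
    case (insert i I)
    then show ?case
      using add[of "k i" i 1 "\<Sum>i\<in>I. k i *\<^sub>R i"] lin[OF coord_vec(1)[OF C] coord_vec(1)[OF C], of "k i" _ 1] by simp
  qed (use add[of 0 0 0 0] lin[OF v v, of 0 0] lin[OF coord_vec(1)[OF C] coord_vec(1)[OF C], of 0 _ 0] in simp_all)
  from this[of "\<lambda>i. v C \<bullet> i" Basis] have "\<alpha> p (coord_vec A C p (v C)) = (\<Sum>i\<in>Basis. (v C \<bullet> i) * \<alpha> p (coord_vec A C p i))"
    by (simp add: euclidean_representation)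
  moreover have "coord_vec A C p (v C) = v"
    by (rule tangent_space_eqI[OF coord_vec(1)[OF C] v C]) (simp add: coord_vec[OF C])
  ultimately show ?thesis by simp
qed

lemma one_form_differential_coord:
  fixes F :: "'n::euclidean_space \<Rightarrow> 'p"
  assumes \<alpha>: "one_form A \<alpha>" and F: "smooth_map_on euclid_atlas A S F" and CA: "C \<in> A" and x: "x \<in> S \<inter> F -` fst C"
  shows "\<alpha> (F x) (differential A F x w) = (\<Sum>i\<in>Basis. (frechet_derivative (\<lambda>y. snd C (F y)) (at x) w \<bullet> i) *
    \<alpha> (chart_inv C (snd C (F x))) (coord_vec A C (chart_inv C (snd C (F x))) i))"
proof -
  have "x \<in> S" "C \<in> charts_around A (F x)" using CA x by (auto simp: charts_around_iff)
  then show ?thesis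
    using one_form_coord[OF \<alpha> _ differential_tangent_space[OF F], of C x w] x smooth_atlas_chart(6)[OF A CA]
    by (simp add: differential_def)
qed

lemma one_form_coeff_smooth:
  assumes "one_form A \<alpha>" "C \<in> A"
  shows "smooth_on (chart_image C) (\<lambda>x. \<alpha> (chart_inv C x) (coord_vec A C (chart_inv C x) e))"
  using assms unfolding one_form_def by blast

text \<open>This is the coefficient along \<open>w\<close> of the pullback of \<alpha> by
  \<open>F\<close>. Near a point it is a sum of coordinate derivatives of \<open>F\<close> times
  coefficients of \<alpha>, both smooth.\<close>

lemma one_form_differential_smooth:
  fixes F :: "'n::euclidean_space \<Rightarrow> 'p"
  assumes \<alpha>: "one_form A \<alpha>" and F: "smooth_map_on euclid_atlas A S F"
  shows "smooth_on S (\<lambda>x. \<alpha> (F x) (differential A F x w))"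
proof (rule smooth_on_local)
  fix x assume x: "x \<in> S"
  obtain C where CA: "C \<in> A" "F x \<in> fst C" using smooth_atlas_cover[OF A] by blast
  define V where "V = S \<inter> F -` fst C"
  have oV: "open V" unfolding V_def by (rule smooth_map_on_euclid_open[OF F CA(1)])
  have f: "smooth_on V (\<lambda>y. snd C (F y))" unfolding V_def by (rule smooth_map_on_euclid_chartD[OF F CA(1)])
  have "smooth_on V (\<lambda>x. \<Sum>i\<in>Basis. (frechet_derivative (\<lambda>y. snd C (F y)) (at x) w \<bullet> i) *
    \<alpha> (chart_inv C (snd C (F x))) (coord_vec A C (chart_inv C (snd C (F x))) i))"
  proof (rule smooth_on_sum[OF oV], rule smooth_on_bounded_bilinear[OF oV bounded_bilinear_mult])
    fix i :: 'e
    show "smooth_on V (\<lambda>x. frechet_derivative (\<lambda>y. snd C (F y)) (at x) w \<bullet> i)"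
      by (rule smooth_on_bounded_linear[OF oV bounded_linear_inner_left smooth_on_frechet_derivative[OF f]])
    show "smooth_on V (\<lambda>x. \<alpha> (chart_inv C (snd C (F x))) (coord_vec A C (chart_inv C (snd C (F x))) i))"
      by (rule smooth_on_compose[OF oV smooth_atlas_chart(2)[OF A CA(1)] f one_form_coeff_smooth[OF \<alpha> CA(1)]])
        (auto simp: V_def)
  qed
  then have "smooth_on V (\<lambda>x. \<alpha> (F x) (differential A F x w))"
    by (rule smooth_on_cong[OF oV, rotated]) (simp add: one_form_differential_coord[OF \<alpha> F CA(1)] V_def)
  then show "\<exists>V. open V \<and> x \<in> V \<and> smooth_on V (\<lambda>x. \<alpha> (F x) (differential A F x w))"
    using oV x CA(2) by (intro exI[of _ V]) (simp add: V_def)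
qed

text \<open>The exterior derivative commutes with the pullback by \<open>F\<close>; the second derivatives of \<open>F\<close> cancel.\<close>

lemma d_one_form_differential:
  fixes F :: "'n::euclidean_space \<Rightarrow> 'p"
  assumes \<alpha>: "one_form A \<alpha>" and F: "smooth_map_on euclid_atlas A S F" and x: "x \<in> S"
  shows "frechet_derivative (\<lambda>y. \<alpha> (F y) (differential A F y w)) (at x) u -
    frechet_derivative (\<lambda>y. \<alpha> (F y) (differential A F y u)) (at x) w =
    d_one_form A \<alpha> (F x) (differential A F x u) (differential A F x w)"
proof -
  define C where "C = chart_at A (F x)"
  have C: "C \<in> charts_around A (F x)" unfolding C_def by (rule chart_at_charts_around[OF A])
  then have CA: "C \<in> A" "F x \<in> fst C" by (auto simp: charts_around_iff)
  define V where "V = S \<inter> F -` fst C"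
  have oV: "open V" unfolding V_def by (rule smooth_map_on_euclid_open[OF F CA(1)])
  have xV: "x \<in> V" using x CA by (simp add: V_def)
  define f where "f y = snd C (F y)" for y
  define f1 where "f1 w y = frechet_derivative f (at y) w" for w y
  define a where "a e z = \<alpha> (chart_inv C z) (coord_vec A C (chart_inv C z) e)" for e z
  define a' where "a' e = frechet_derivative (a e) (at (f x))" for e
  have sf: "smooth_on V f" unfolding V_def f_def by (rule smooth_map_on_euclid_chartD[OF F CA(1)])
  have fV: "f y \<in> chart_image C" if "y \<in> V" for y using that by (auto simp: V_def f_def)
  have da: "(a e has_derivative a' e) (at (f x))" for e
    unfolding a'_def a_def by (rule smooth_on_has_derivative[OF one_form_coeff_smooth[OF \<alpha> CA(1)] fV[OF xV]])
  have expand: "a e z = (\<Sum>i\<in>Basis. (e \<bullet> i) * a i z)" if "z \<in> chart_image C" for e z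
    using one_form_coord[OF \<alpha> _ coord_vec(1), of C "chart_inv C z" C e] coord_vec(2)[of C "chart_inv C z" e]
      smooth_atlas_chart(7)[OF A CA(1) that] CA(1) by (simp add: a_def charts_around_iff)
  \<comment> \<open>The coefficients are linear in \<open>e\<close> on the whole chart image, hence
    so are their derivatives; this gathers the first half of the product rule below into the
    derivative of a single coefficient.\<close>
  have a'_expand: "a' e v = (\<Sum>i\<in>Basis. (e \<bullet> i) * a' i v)" for e v
  proof -
    have "((\<lambda>z. \<Sum>i\<in>Basis. (e \<bullet> i) * a i z) has_derivative (\<lambda>v. \<Sum>i\<in>Basis. (e \<bullet> i) * a' i v)) (at (f x))"
      by (intro has_derivative_sum has_derivative_mult_right da)
    then have "(a e has_derivative (\<lambda>v. \<Sum>i\<in>Basis. (e \<bullet> i) * a' i v)) (at (f x))"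
      by (rule has_derivative_transform_within_open[OF _ smooth_atlas_chart(2)[OF A CA(1)] fV[OF xV]])
        (simp add: expand)
    from has_derivative_unique[OF this da] show ?thesis by metis
  qed
  have deriv: "frechet_derivative (\<lambda>y. \<alpha> (F y) (differential A F y w)) (at x) u =
      a' (f1 w x) (f1 u x) + (\<Sum>i\<in>Basis. (frechet_derivative (f1 w) (at x) u \<bullet> i) * a i (f x))" for u w
  proof -
    have d1: "(f1 w has_derivative frechet_derivative (f1 w) (at x)) (at x)"
      unfolding f1_def by (rule smooth_on_has_derivative[OF smooth_on_frechet_derivative[OF sf] xV])
    have d2: "((\<lambda>y. a i (f y)) has_derivative (\<lambda>v. a' i (f1 v x))) (at x)" for i
      using has_derivative_compose[OF smooth_on_has_derivative[OF sf xV] da] by (simp add: f1_def)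
    have "((\<lambda>y. \<Sum>i\<in>Basis. (f1 w y \<bullet> i) * a i (f y)) has_derivative
      (\<lambda>v. \<Sum>i\<in>Basis. (f1 w x \<bullet> i) * a' i (f1 v x) + (frechet_derivative (f1 w) (at x) v \<bullet> i) * a i (f x))) (at x)"
      by (intro has_derivative_sum has_derivative_mult has_derivative_inner_left d1 d2)
    then have "((\<lambda>y. \<alpha> (F y) (differential A F y w)) has_derivative
      (\<lambda>v. \<Sum>i\<in>Basis. (f1 w x \<bullet> i) * a' i (f1 v x) + (frechet_derivative (f1 w) (at x) v \<bullet> i) * a i (f x))) (at x)"
      by (rule has_derivative_transform_within_open[OF _ oV xV])
        (use one_form_differential_coord[OF \<alpha> F CA(1)] in \<open>simp add: V_def f1_def f_def[abs_def] a_def\<close>)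
    from frechet_derivative_at[OF this, symmetric] show ?thesis
      by (simp add: sum.distrib a'_expand[of "f1 w x"])
  qed
  have sym: "frechet_derivative (f1 w) (at x) u = frechet_derivative (f1 u) (at x) w"
    using smooth_on_symmetric_second_derivative[OF oV sf xV] by (simp add: f1_def[abs_def])
  have "d_one_form A \<alpha> (F x) (differential A F x u) (differential A F x w) = a' (f1 w x) (f1 u x) - a' (f1 u x) (f1 w x)"
    using C unfolding d_one_form_def Let_def C_def[symmetric]
    by (simp add: differential_def f1_def f_def[abs_def] a'_def a_def[abs_def])
  then show ?thesis unfolding deriv sym[of] by simp
qed

end

section \<open>Principal circle bundles\<close>

lemma cis_Arg_unit:
  assumes "norm z = 1"
  shows "cis (Arg z) = z"
proof -
  have "z \<noteq> 0" using assms by auto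
  then show ?thesis using cis_Arg[of z] assms by (simp add: sgn_div_norm)
qed

text \<open>A branch of the angle near \<open>c\<close>: multiplying by the conjugate moves
  \<open>c\<close> to 1, away from the cut of \<open>Ln\<close>. The domain is an open half-plane
  and not an arc, since smoothness is meant for open sets of complex numbers.\<close>

lemma circle_angle:
  fixes c :: complex
  assumes c: "norm c = 1"
  defines "L \<equiv> \<lambda>w. Im (Ln (w * cnj c)) + Arg c" and "V \<equiv> {w. Re (w * cnj c) > 0}"
  shows "open V" "c \<in> V" "smooth_on V L" "\<And>w. w \<in> V \<Longrightarrow> norm w = 1 \<Longrightarrow> cis (L w) = w"
    "(L has_derivative (\<lambda>h. Im (h * cnj c))) (at c)" "L c = Arg c"
proof -
  have cc: "c * cnj c = 1" "cnj c * c = 1" using c complex_norm_square[of c] by (simp_all add: mult.commute)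
  show oV: "open V" unfolding V_def by (intro open_Collect_less continuous_intros)
  show cV: "c \<in> V" by (simp only: V_def mem_Collect_eq cc one_complex.sel zero_less_one)
  have np: "w * cnj c \<notin> \<real>\<^sub>\<le>\<^sub>0" if "w \<in> V" for w
    using that by (auto simp: V_def complex_nonpos_Reals_iff)
  have o: "open (- \<real>\<^sub>\<le>\<^sub>0 :: complex set)" by auto
  have bl: "bounded_linear (\<lambda>w. w * cnj c)" by (rule bounded_linear_mult_left)
  have 1: "smooth_on V (\<lambda>w. Ln (w * cnj c))"
    by (rule smooth_on_compose[OF oV o smooth_on_bounded_linear[OF oV bl smooth_on_id[OF oV]] smooth_on_Ln])
      (use np in auto)
  show "smooth_on V L" unfolding L_def
    by (rule smooth_on_add[OF oV smooth_on_bounded_linear[OF oV bounded_linear_Im 1] smooth_on_const])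
  show "cis (L w) = w" if w: "w \<in> V" "norm w = 1" for w
  proof -
    have n: "norm (w * cnj c) = 1" using w c by (simp add: norm_mult)
    then have "w * cnj c \<noteq> 0" by auto
    then have "w * cnj c = cis (Im (Ln (w * cnj c)))"
      using cis_Arg_unit[OF n] Arg_eq_Im_Ln by simp
    moreover have "c = cis (Arg c)" using cis_Arg_unit[OF c] by simp
    ultimately have "cis (L w) = (w * cnj c) * c" unfolding L_def by (simp add: cis_mult[symmetric])
    then show ?thesis using cc by (simp add: mult.assoc)
  qed
  have "(Ln has_derivative (\<lambda>h. h)) (at (c * cnj c))"
    using has_field_derivative_Ln[of 1] by (simp add: cc has_field_derivative_def mult_1[abs_def])
  from has_derivative_compose[OF bounded_linear_imp_has_derivative[OF bl] this]
  have "((\<lambda>w. Ln (w * cnj c)) has_derivative (\<lambda>h. h * cnj c)) (at c)" .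
  from has_derivative_add_const[OF bounded_linear.has_derivative[OF bounded_linear_Im this]]
  show "(L has_derivative (\<lambda>h. Im (h * cnj c))) (at c)" unfolding L_def .
  show "L c = Arg c" by (simp add: L_def cc)
qed

section \<open>Local trivialisations and angular speed\<close>

locale circle_bundle =
  fixes AB :: "('b::{t2_space,second_countable_topology}, 'e::euclidean_space) chart set"
    and AM :: "('m::{t2_space,second_countable_topology}, 'f::euclidean_space) chart set"
    and \<pi> :: "'m \<Rightarrow> 'b"
    and \<rho> :: "real \<Rightarrow> 'm \<Rightarrow> 'm"
  assumes AB: "smooth_atlas AB" and AM: "smooth_atlas AM" and principal: "principal_circle_bundle AM AB \<pi> \<rho>"
begin

definition triv :: "'b set \<Rightarrow> ('m \<Rightarrow> complex) \<Rightarrow> bool" where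
  "triv U \<tau> \<longleftrightarrow> open U \<and> smooth_map_on AM euclid_atlas (\<pi> -` U) \<tau> \<and>
    (\<forall>m\<in>\<pi> -` U. \<forall>t. \<tau> (\<rho> t m) = cis t * \<tau> m) \<and>
    bij_betw (\<lambda>m. (\<pi> m, \<tau> m)) (\<pi> -` U) (U \<times> sphere 0 1) \<and>
    smooth_map_on (prod_atlas AB euclid_atlas) AM (U \<times> UNIV)
      (\<lambda>(x, t). inv_into (\<pi> -` U) (\<lambda>m. (\<pi> m, \<tau> m)) (x, cis t))"

text \<open>The inverse of the trivialisation; for fixed \<open>z\<close> of modulus 1 it is a
  section over \<open>U\<close>, and only such \<open>z\<close> are meaningful.\<close>

definition pt :: "'b set \<Rightarrow> ('m \<Rightarrow> complex) \<Rightarrow> 'b \<Rightarrow> complex \<Rightarrow> 'm" where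
  "pt U \<tau> x z = inv_into (\<pi> -` U) (\<lambda>m. (\<pi> m, \<tau> m)) (x, z)"

lemma triv_exists: "\<exists>U \<tau>. triv U \<tau> \<and> b \<in> U"
proof -
  have "\<exists>U. \<exists>\<tau> :: 'm \<Rightarrow> complex. open U \<and> b \<in> U \<and>
        smooth_map_on AM euclid_atlas (\<pi> -` U) \<tau> \<and>
        (\<forall>m\<in>\<pi> -` U. \<forall>t. \<tau> (\<rho> t m) = cis t * \<tau> m) \<and>
        bij_betw (\<lambda>m. (\<pi> m, \<tau> m)) (\<pi> -` U) (U \<times> sphere 0 1) \<and>
        smooth_map_on (prod_atlas AB euclid_atlas) AM (U \<times> UNIV)
          (\<lambda>(x, t). inv_into (\<pi> -` U) (\<lambda>m. (\<pi> m, \<tau> m)) (x, cis t))"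
    using principal unfolding principal_circle_bundle_def by blast
  then show ?thesis unfolding triv_def by blast
qed

lemma smooth_proj: "smooth_map AM AB \<pi>" and proj_act [simp]: "\<pi> (\<rho> t m) = \<pi> m"
  and act_flow: "flow AM \<rho>"
  using principal by (auto simp: principal_circle_bundle_def circle_action_def)

lemma act_0 [simp]: "\<rho> 0 m = m"
  using act_flow by (simp add: flow_def)

lemma trivD:
  assumes "triv U \<tau>"
  shows "open U" "open (\<pi> -` U)" "smooth_map_on AM euclid_atlas (\<pi> -` U) \<tau>"
    "\<And>m t. \<pi> m \<in> U \<Longrightarrow> \<tau> (\<rho> t m) = cis t * \<tau> m"
    "\<And>m. \<pi> m \<in> U \<Longrightarrow> norm (\<tau> m) = 1"
    "\<And>x z. x \<in> U \<Longrightarrow> norm z = 1 \<Longrightarrow> \<pi> (pt U \<tau> x z) = x"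
    "\<And>x z. x \<in> U \<Longrightarrow> norm z = 1 \<Longrightarrow> \<tau> (pt U \<tau> x z) = z"
    "\<And>m. \<pi> m \<in> U \<Longrightarrow> pt U \<tau> (\<pi> m) (\<tau> m) = m"
    "smooth_map_on (prod_atlas AB euclid_atlas) AM (U \<times> UNIV) (\<lambda>z. pt U \<tau> (fst z) (cis (snd z)))"
proof -
  have bij: "bij_betw (\<lambda>m. (\<pi> m, \<tau> m)) (\<pi> -` U) (U \<times> sphere 0 1)" using assms by (simp add: triv_def)
  show "open U" "smooth_map_on AM euclid_atlas (\<pi> -` U) \<tau>"
    "\<And>m t. \<pi> m \<in> U \<Longrightarrow> \<tau> (\<rho> t m) = cis t * \<tau> m"
    "smooth_map_on (prod_atlas AB euclid_atlas) AM (U \<times> UNIV) (\<lambda>z. pt U \<tau> (fst z) (cis (snd z)))"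
    using assms by (auto simp: triv_def pt_def split_def)
  then show "open (\<pi> -` U)" using smooth_map_onD(1) by blast
  show "norm (\<tau> m) = 1" if "\<pi> m \<in> U" for m
    using bij_betwE[OF bij] that by auto
  have *: "(\<pi> (pt U \<tau> x z), \<tau> (pt U \<tau> x z)) = (x, z)" if "x \<in> U" "norm z = 1" for x z
    unfolding pt_def by (rule bij_betw_inv_into_right[OF bij, where ?a' = "(x, z)"]) (use that in auto)
  show "\<pi> (pt U \<tau> x z) = x" "\<tau> (pt U \<tau> x z) = z" if "x \<in> U" "norm z = 1" for x z
    using *[OF that] by auto
  show "pt U \<tau> (\<pi> m) (\<tau> m) = m" if "\<pi> m \<in> U" for m
    using bij_betw_inv_into_left[OF bij, of m] that by (simp add: pt_def)
qed

lemma triv_eqI: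
  assumes "triv U \<tau>" "\<pi> m \<in> U" "\<pi> n = \<pi> m" "\<tau> m = \<tau> n"
  shows "m = n"
  using trivD(8)[OF assms(1)] assms(2-4) by metis

lemma act_pt:
  assumes "triv U \<tau>" "x \<in> U" "norm z = 1"
  shows "\<rho> t (pt U \<tau> x z) = pt U \<tau> x (cis t * z)"
  by (rule triv_eqI[OF assms(1)]) (simp_all add: trivD(4,6,7)[OF assms(1)] assms(2,3) norm_mult)

lemma smooth_act: "smooth_map AM AM (\<rho> t)"
proof -
  have "smooth_map (prod_atlas euclid_atlas AM) AM (\<lambda>(t, p). \<rho> t p)" using act_flow by (simp add: flow_def)
  from smooth_map_on_compose[OF AM smooth_atlas_prod[OF smooth_atlas_euclid AM] AM
      smooth_map_on_Pair[OF AM smooth_atlas_euclid AM smooth_map_on_const[OF AM open_UNIV, of _ t] smooth_map_id[OF AM]] this]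
  show ?thesis by simp
qed

lemma smooth_act_orbit: "smooth_map euclid_atlas AM (\<lambda>t. \<rho> t m)"
proof -
  have "smooth_map (prod_atlas euclid_atlas AM) AM (\<lambda>(t, p). \<rho> t p)" using act_flow by (simp add: flow_def)
  from smooth_map_on_compose[OF smooth_atlas_euclid smooth_atlas_prod[OF smooth_atlas_euclid AM] AM
      smooth_map_on_Pair[OF smooth_atlas_euclid smooth_atlas_euclid AM smooth_map_id[OF smooth_atlas_euclid]
       smooth_map_on_const[OF smooth_atlas_euclid open_UNIV, of _ m]] this]
  show ?thesis by simp
qed

text \<open>The bundle structure provides smoothness of the inverse only in a lifted angle; the
  fixed \<open>z\<close> is fed in as \<open>cis (Arg z)\<close>.\<close>

lemma smooth_pt:
  assumes "triv U \<tau>" "norm z = 1"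
  shows "smooth_map_on AB AM U (\<lambda>x. pt U \<tau> x z)"
proof -
  note z = cis_Arg_unit[OF assms(2)]
  from smooth_map_on_compose[OF AB smooth_atlas_prod[OF AB smooth_atlas_euclid] AM
      smooth_map_on_Pair[OF AB AB smooth_atlas_euclid
        smooth_map_on_subset[OF smooth_map_id[OF AB] trivD(1)[OF assms(1)]] smooth_map_on_const[OF AB trivD(1)[OF assms(1)], of _ "Arg z"]]
      trivD(9)[OF assms(1)]]
  show ?thesis by (simp add: z)
qed

text \<open>With \<open>z = \<tau> \<circ> c\<close> of modulus one, this is \<open>z' / (\<i> z)\<close>.\<close>

definition angular :: "('m \<Rightarrow> complex) \<Rightarrow> (real \<Rightarrow> 'm) \<Rightarrow> real \<Rightarrow> real" where
  "angular \<tau> c t = Im (vector_derivative (\<lambda>s. \<tau> (c s)) (at t) * cnj (\<tau> (c t)))"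

lemma smooth_triv_curve:
  fixes c :: "real \<Rightarrow> 'm"
  assumes "triv U \<tau>" "smooth_map_on euclid_atlas AM S c"
  shows "open (S \<inter> c -` (\<pi> -` U))" "smooth_on (S \<inter> c -` (\<pi> -` U)) (\<lambda>s. \<tau> (c s))"
proof -
  show o: "open (S \<inter> c -` (\<pi> -` U))" by (rule smooth_map_on_open_preimage[OF assms(2) trivD(2)[OF assms(1)]])
  have "smooth_map_on euclid_atlas euclid_atlas (S \<inter> c -` (\<pi> -` U)) (\<lambda>s. \<tau> (c s))"
    by (rule smooth_map_on_compose[OF smooth_atlas_euclid AM smooth_atlas_euclid
          smooth_map_on_subset[OF assms(2) o Int_lower1] trivD(3)[OF assms(1)]]) auto
  then show "smooth_on (S \<inter> c -` (\<pi> -` U)) (\<lambda>s. \<tau> (c s))" by (simp add: smooth_map_on_euclid_iff)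
qed

text \<open>Since \<tau> has modulus 1 along the curve near \<open>t\<close>, its derivative is
  orthogonal to it, hence a real multiple of i times its value; the multiple is
  \<open>angular\<close>.\<close>

lemma triv_curve_derivative:
  assumes "triv U \<tau>" "smooth_map_on euclid_atlas AM S c" "t \<in> S" "\<pi> (c t) \<in> U"
  shows "((\<lambda>s. \<tau> (c s)) has_vector_derivative \<i> * angular \<tau> c t * \<tau> (c t)) (at t)"
proof -
  define z where "z s = \<tau> (c s)" for s
  define z' where "z' = vector_derivative z (at t)"
  define T where "T = S \<inter> c -` (\<pi> -` U)"
  have T: "open T" "t \<in> T" using smooth_triv_curve(1)[OF assms(1,2)] assms(3,4) by (auto simp: T_def)
  have z: "(z has_vector_derivative z') (at t)"
    unfolding z'_def z_def using smooth_on_has_derivative[OF smooth_triv_curve(2)[OF assms(1,2)], of t] assms(3,4)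
    by (auto simp: vector_derivative_works[symmetric] intro: differentiableI)
  have n: "z s \<bullet> z s = 1" if "s \<in> T" for s
    using trivD(5)[OF assms(1), of "c s"] that by (simp add: T_def z_def norm_eq_1)
  have "((\<lambda>s. z s \<bullet> z s) has_vector_derivative (z t \<bullet> z' + z' \<bullet> z t)) (at t)"
    using bounded_bilinear.has_vector_derivative[OF bounded_bilinear_inner z z] .
  moreover have "((\<lambda>s. z s \<bullet> z s) has_vector_derivative 0) (at t)"
    by (rule has_vector_derivative_transform_within_open[OF has_vector_derivative_const[of 1] T]) (simp add: n)
  ultimately have orth: "z' \<bullet> z t = 0" using vector_derivative_unique_at by (fastforce simp: inner_commute)
  have "Re (z' * cnj (z t)) = 0" using orth by (simp add: inner_complex_def)
  then have "z' * cnj (z t) = \<i> * angular \<tau> c t"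
    by (simp add: complex_eq_iff angular_def z'_def z_def[abs_def])
  then have "z' * (cnj (z t) * z t) = \<i> * angular \<tau> c t * z t" by (simp only: mult.assoc[symmetric])
  moreover have "cnj (z t) * z t = 1"
    using n[OF T(2)] complex_norm_square[of "z t"] by (simp add: mult.commute dot_square_norm)
  ultimately have "z' = \<i> * angular \<tau> c t * z t" by (metis mult.right_neutral)
  then show ?thesis using z by (simp add: z_def[abs_def])
qed

text \<open>Near \<open>t\<close>, write \<open>c s = pt U \<tau> (\<pi> (c s)) (cis (\<theta> s))\<close> and differentiate in the two arguments separately.\<close>

lemma velocity_decomposition:
  assumes tr: "triv U \<tau>" and c: "smooth_map_on euclid_atlas AM S c" "t \<in> S" "\<pi> (c t) \<in> U"
  shows "velocity AM c t = (\<lambda>C. 1 *\<^sub>R tangent_map AB AM (\<lambda>x. pt U \<tau> x (\<tau> (c t))) (\<pi> (c t)) (velocity AB (\<lambda>s. \<pi> (c s)) t) C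
    + angular \<tau> c t *\<^sub>R velocity AM (\<lambda>s. \<rho> s (c t)) 0 C)"
proof -
  define z where "z = \<tau> (c t)"
  have nz: "norm z = 1" using trivD(5)[OF tr c(3)] by (simp add: z_def)
  define L where "L = (\<lambda>w. Im (Ln (w * cnj z)) + Arg z)"
  define W where "W = {w. Re (w * cnj z) > 0}"
  note L = circle_angle[OF nz, folded L_def W_def]
  have Lc: "cis (L w) = w" if "w \<in> W" "norm w = 1" for w
    using L(4)[OF that] by (simp add: L_def)
  define \<theta> where "\<theta> s = L (\<tau> (c s))" for s
  obtain C where C: "C \<in> AB" "\<pi> (c t) \<in> fst C" using smooth_atlas_cover[OF AB] by blast
  note ch = smooth_atlas_chart[OF AB C(1)]
  define x where "x s = snd C (\<pi> (c s))" for s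
  define Y where "Y = snd C ` (fst C \<inter> U)"
  have oY: "open Y" unfolding Y_def by (rule smooth_atlas_open_image[OF AB C(1) trivD(1)[OF tr]])
  \<comment> \<open>Parametrises the part of the bundle over the chart piece \<open>Y\<close> by
    base coordinates and a lifted angle. Linearity of its differential is what splits the velocity
    into the directions \<open>(x', 0)\<close> and \<open>(0, 1)\<close>.\<close>
  define F where "F = (\<lambda>q. pt U \<tau> (chart_inv C (fst q)) (cis (snd q)))"
  have oYU: "open (Y \<times> (UNIV :: real set))" using oY by (simp add: open_Times)
  have Yim: "Y \<subseteq> chart_image C" by (auto simp: Y_def)
  have fY: "smooth_on (Y \<times> (UNIV :: real set)) fst"
    by (rule smooth_on_bounded_linear[OF oYU bounded_linear_fst smooth_on_id[OF oYU]])
  have se: "smooth_map_on euclid_atlas AB (Y \<times> (UNIV :: real set)) (\<lambda>q. chart_inv C (fst q))"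
    by (rule smooth_map_on_compose[OF smooth_atlas_euclid smooth_atlas_euclid AB _ smooth_map_on_chart_inv[OF AB C(1)]])
      (use fY oYU Yim in \<open>auto simp: smooth_map_on_euclid_iff\<close>)
  have ss: "smooth_map_on euclid_atlas euclid_atlas (Y \<times> (UNIV :: real set)) snd"
    unfolding smooth_map_on_euclid_iff
    using oYU smooth_on_bounded_linear[OF oYU bounded_linear_snd smooth_on_id[OF oYU]] by simp
  have F: "smooth_map_on euclid_atlas AM (Y \<times> UNIV) F"
  proof -
    have "smooth_map_on euclid_atlas AM (Y \<times> UNIV)
        (\<lambda>q. pt U \<tau> (fst (chart_inv C (fst q), snd q)) (cis (snd (chart_inv C (fst q), snd q))))"
      by (rule smooth_map_on_compose[OF smooth_atlas_euclid smooth_atlas_prod[OF AB smooth_atlas_euclid] AM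
         smooth_map_on_Pair[OF smooth_atlas_euclid AB smooth_atlas_euclid se ss] trivD(9)[OF tr]])
        (auto simp: Y_def ch(6))
    then show ?thesis by (simp add: F_def)
  qed
  have q: "(x t, \<theta> t) \<in> Y \<times> UNIV" using C c(3) by (auto simp: x_def Y_def)
  have xt: "chart_inv C (x t) = \<pi> (c t)" using C ch(6) by (simp add: x_def)
  have \<theta>t: "cis (\<theta> t) = z" using Lc[OF L(2) nz] by (simp add: \<theta>_def z_def)
  have Ft: "F (x t, \<theta> t) = c t" using trivD(8)[OF tr c(3)] by (simp add: F_def xt \<theta>t z_def)
  have \<pi>c: "smooth_map_on euclid_atlas AB S (\<lambda>s. \<pi> (c s))"
    by (rule smooth_map_on_compose[OF smooth_atlas_euclid AM AB c(1) smooth_proj]) simp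
  define T where "T = S \<inter> c -` (\<pi> -` U)"
  have T: "open T" "smooth_on T (\<lambda>s. \<tau> (c s))" "t \<in> T" "T \<subseteq> S"
    using smooth_triv_curve[OF tr c(1)] c by (auto simp: T_def)
  \<comment> \<open>The times at which the curve lies over \<open>U\<close> and over the chart, with
    \<tau> in the domain \<open>W\<close> of the branch \<open>L\<close>; there the curve is
    recovered from its coordinates.\<close>
  define V where "V = T \<inter> (\<lambda>s. \<tau> (c s)) -` W \<inter> (S \<inter> (\<lambda>s. \<pi> (c s)) -` fst C)"
  have oV: "open V" unfolding V_def
    using continuous_open_preimage[OF smooth_on_continuous[OF T(2)] T(1) L(1)] smooth_map_on_open_preimage[OF \<pi>c ch(1)] by blast
  have tV: "t \<in> V" using T(3) L(2) c(2) C by (auto simp: V_def z_def)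
  have cF: "F (x s, \<theta> s) = c s" if s: "s \<in> V" for s
  proof -
    have U: "\<pi> (c s) \<in> U" using s by (auto simp: V_def T_def)
    have "cis (\<theta> s) = \<tau> (c s)" using s Lc trivD(5)[OF tr U] by (auto simp: \<theta>_def V_def)
    moreover have "chart_inv C (x s) = \<pi> (c s)" using s ch(6) by (auto simp: x_def V_def)
    ultimately show ?thesis using trivD(8)[OF tr U] by (simp add: F_def)
  qed
  have xd: "(x has_vector_derivative velocity AB (\<lambda>s. \<pi> (c s)) t C) (at t)" unfolding x_def
    by (rule velocity_chart[OF AB \<pi>c c(2)]) (use C in \<open>simp add: charts_around_iff\<close>)
  define x' where "x' = velocity AB (\<lambda>s. \<pi> (c s)) t C"
  have "((\<lambda>s. \<tau> (c s)) has_vector_derivative vector_derivative (\<lambda>s. \<tau> (c s)) (at t)) (at t)"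
    using triv_curve_derivative[OF tr c] vector_derivative_at by fastforce
  from has_vector_derivative_compose_derivative[OF this L(5)[unfolded z_def]]
  have \<theta>d: "(\<theta> has_vector_derivative angular \<tau> c t) (at t)" by (simp add: \<theta>_def[abs_def] angular_def)
  define D where "D = differential AM F (x t, \<theta> t)"
  have "((\<lambda>s. (x s, \<theta> s)) has_vector_derivative (x', angular \<tau> c t)) (at t)"
    using has_vector_derivative_Pair[OF xd \<theta>d] by (simp add: x'_def)
  from velocity_eq_differential[OF AM F q this]
  have "velocity AM (\<lambda>s. F (x s, \<theta> s)) t = D (x', angular \<tau> c t)" by (simp add: D_def)
  moreover have "velocity AM (\<lambda>s. F (x s, \<theta> s)) t = velocity AM c t"
    by (rule velocity_cong[OF AM oV tV cF c(1,2)])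
  ultimately have v: "velocity AM c t = D (x', angular \<tau> c t)" by simp
  have "((\<lambda>s. (x s, \<theta> t)) has_vector_derivative (x', 0)) (at t)"
    using has_vector_derivative_Pair[OF xd has_vector_derivative_const] by (simp add: x'_def)
  from velocity_eq_differential[OF AM F q this]
  have "D (x', 0) = velocity AM (\<lambda>s. F (x s, \<theta> t)) t" by (simp add: D_def)
  also have "\<dots> = velocity AM (\<lambda>s. pt U \<tau> (\<pi> (c s)) z) t"
  proof (rule velocity_cong[OF AM oV tV])
    show "F (x s, \<theta> t) = pt U \<tau> (\<pi> (c s)) z" if "s \<in> V" for s
      using that ch(6) by (auto simp: F_def \<theta>t x_def V_def)
    show "smooth_map_on euclid_atlas AM T (\<lambda>s. pt U \<tau> (\<pi> (c s)) z)"
      by (rule smooth_map_on_compose[OF smooth_atlas_euclid AB AM smooth_map_on_subset[OF \<pi>c T(1,4)] smooth_pt[OF tr nz]])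
        (auto simp: T_def)
  qed (fact T(3))
  also have "\<dots> = tangent_map AB AM (\<lambda>x. pt U \<tau> x z) (\<pi> (c t)) (velocity AB (\<lambda>s. \<pi> (c s)) t)"
    by (rule tangent_map_velocity[OF AB \<pi>c c(2) smooth_pt[OF tr nz] c(3), symmetric])
  finally have v1: "D (x', 0) = tangent_map AB AM (\<lambda>x. pt U \<tau> x z) (\<pi> (c t)) (velocity AB (\<lambda>s. \<pi> (c s)) t)" .
  have "((\<lambda>s. (x t, \<theta> t + s)) has_vector_derivative (0, 1)) (at 0)"
    by (auto intro!: has_vector_derivative_Pair derivative_eq_intros)
  from velocity_eq_differential[OF AM F _ this]
  have "D (0, 1) = velocity AM (\<lambda>s. F (x t, \<theta> t + s)) 0" using q by (simp add: D_def)
  \<comment> \<open>Increasing the lifted angle is the circle action, by equivariance of the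
    trivialisation.\<close>
  also have "(\<lambda>s. F (x t, \<theta> t + s)) = (\<lambda>s. \<rho> s (c t))"
  proof
    fix s
    have "\<rho> s (c t) = \<rho> s (pt U \<tau> (\<pi> (c t)) z)" using trivD(8)[OF tr c(3)] by (simp add: z_def)
    also have "\<dots> = pt U \<tau> (\<pi> (c t)) (cis s * z)" by (rule act_pt[OF tr c(3) nz])
    also have "cis s * z = cis (\<theta> t + s)" by (simp add: cis_mult[symmetric] \<theta>t mult.commute)
    finally show "F (x t, \<theta> t + s) = \<rho> s (c t)" by (simp add: F_def xt)
  qed
  finally have v2: "D (0, 1) = velocity AM (\<lambda>s. \<rho> s (c t)) 0" .
  have "D (x', angular \<tau> c t) = (\<lambda>C. 1 *\<^sub>R D (x', 0) C + angular \<tau> c t *\<^sub>R D (0, 1) C)"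
    using differential_lincomb[OF AM F q, of 1 "(x', 0)" "angular \<tau> c t" "(0, 1)"] by (simp add: D_def)
  then show ?thesis by (simp add: v v1 v2 z_def)
qed

end

section \<open>Connection forms in a trivialisation\<close>

locale connection_bundle = circle_bundle AB AM \<pi> \<rho>
  for AB :: "('b::{t2_space,second_countable_topology}, 'e::euclidean_space) chart set"
    and AM :: "('m::{t2_space,second_countable_topology}, 'f::euclidean_space) chart set"
    and \<pi> :: "'m \<Rightarrow> 'b"
    and \<rho> :: "real \<Rightarrow> 'm \<Rightarrow> 'm" +
  fixes \<alpha> :: "'m \<Rightarrow> ('m, 'f) tangent \<Rightarrow> real"
  assumes connection: "connection_form AM \<rho> \<alpha>"
begin

lemma one_form_\<alpha>: "one_form AM \<alpha>"
  and \<alpha>_act: "v \<in> tangent_space AM m \<Longrightarrow> \<alpha> (\<rho> t m) (tangent_map AM AM (\<rho> t) m v) = \<alpha> m v"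
  and \<alpha>_vertical: "\<alpha> m (velocity AM (\<lambda>t. \<rho> t m) 0) = 1"
  using connection by (auto simp: connection_form_def)

lemma \<alpha>_lincomb: "u \<in> tangent_space AM m \<Longrightarrow> v \<in> tangent_space AM m \<Longrightarrow>
    \<alpha> m (\<lambda>C. a *\<^sub>R u C + b *\<^sub>R v C) = a * \<alpha> m u + b * \<alpha> m v"
  using one_form_\<alpha> unfolding one_form_def by blast

text \<open>The local connection form (gauge potential): the pullback of \<alpha> by the section
  with angular coordinate 1.\<close>

definition base_form :: "'b set \<Rightarrow> ('m \<Rightarrow> complex) \<Rightarrow> 'b \<Rightarrow> ('b, 'e) tangent \<Rightarrow> real" where
  "base_form U \<tau> x w = \<alpha> (pt U \<tau> x 1) (tangent_map AB AM (\<lambda>x. pt U \<tau> x 1) x w)"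

text \<open>The section with coordinate \<open>z\<close> is the section with coordinate 1 translated
  by \<open>\<rho> (Arg z)\<close>, and \<alpha> is invariant. So one \<open>base_form\<close>
  serves every point of a fibre.\<close>

lemma \<alpha>_tangent_map_pt:
  assumes tr: "triv U \<tau>" and x: "x \<in> U" and z: "norm z = 1" and w: "w \<in> tangent_space AB x"
  shows "\<alpha> (pt U \<tau> x z) (tangent_map AB AM (\<lambda>x. pt U \<tau> x z) x w) = base_form U \<tau> x w"
proof -
  obtain c S where c: "0 \<in> S" "smooth_map_on euclid_atlas AB S c" "c 0 = x" "velocity AB c 0 = w"
    using tangent_space_velocity[OF AB w] by metis
  define T where "T = S \<inter> c -` U"
  have T: "open T" unfolding T_def by (rule smooth_map_on_open_preimage[OF c(2) trivD(1)[OF tr]])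
  have cT: "smooth_map_on euclid_atlas AB T c" by (rule smooth_map_on_subset[OF c(2) T]) (auto simp: T_def)
  have T0: "0 \<in> T" using c x by (simp add: T_def)
  have sec: "smooth_map_on euclid_atlas AM T (\<lambda>s. pt U \<tau> (c s) z)" if "norm z = 1" for z
    by (rule smooth_map_on_compose[OF smooth_atlas_euclid AB AM cT smooth_pt[OF tr that]]) (auto simp: T_def)
  have vel: "tangent_map AB AM (\<lambda>x. pt U \<tau> x z) x w = velocity AM (\<lambda>s. pt U \<tau> (c s) z) 0" if "norm z = 1" for z
    using tangent_map_velocity[OF AB cT T0 smooth_pt[OF tr that]] c(3,4) x by simp
  have n1: "norm (1 :: complex) = 1" by simp
  have act: "pt U \<tau> y z = \<rho> (Arg z) (pt U \<tau> y 1)" if "y \<in> U" for y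
    using act_pt[OF tr that n1, of "Arg z"] cis_Arg_unit[OF z] by simp
  have sA: "smooth_map_on euclid_atlas AM T (\<lambda>s. \<rho> (Arg z) (pt U \<tau> (c s) 1))"
    by (rule smooth_map_on_compose[OF smooth_atlas_euclid AM AM sec[OF n1] smooth_act]) simp
  have "velocity AM (\<lambda>s. pt U \<tau> (c s) z) 0 = velocity AM (\<lambda>s. \<rho> (Arg z) (pt U \<tau> (c s) 1)) 0"
    by (rule velocity_cong[OF AM T T0 _ sA T0]) (simp add: act T_def)
  also have "\<dots> = tangent_map AM AM (\<rho> (Arg z)) (pt U \<tau> x 1) (velocity AM (\<lambda>s. pt U \<tau> (c s) 1) 0)"
    using tangent_map_velocity[OF AM sec[OF n1] T0 smooth_act[of "Arg z"]] c(3) by simp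
  finally have "\<alpha> (pt U \<tau> x z) (tangent_map AB AM (\<lambda>x. pt U \<tau> x z) x w) =
      \<alpha> (\<rho> (Arg z) (pt U \<tau> x 1)) (tangent_map AM AM (\<rho> (Arg z)) (pt U \<tau> x 1) (velocity AM (\<lambda>s. pt U \<tau> (c s) 1) 0))"
    by (simp add: vel[OF z] act[OF x])
  also have "\<dots> = \<alpha> (pt U \<tau> x 1) (velocity AM (\<lambda>s. pt U \<tau> (c s) 1) 0)"
    using velocity_tangent_space[OF AM sec[OF n1] T0] c(3) by (simp add: \<alpha>_act)
  finally show ?thesis by (simp add: base_form_def vel)
qed

lemma smooth_proj_curve: "smooth_map_on euclid_atlas AM S c \<Longrightarrow> smooth_map_on euclid_atlas AB S (\<lambda>s. \<pi> (c s))"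
  for c :: "real \<Rightarrow> 'm"
  using smooth_map_on_compose[OF smooth_atlas_euclid AM AB _ smooth_proj] by simp

lemma velocity_proj:
  "smooth_map_on euclid_atlas AM S c \<Longrightarrow> t \<in> S \<Longrightarrow>
    velocity AB (\<lambda>s. \<pi> (c s)) t = tangent_map AM AB \<pi> (c t) (velocity AM c t)"
  using tangent_map_velocity[OF AM _ _ smooth_proj] by simp

lemma tangent_map_pt_tangent_space:
  assumes "triv U \<tau>" "\<pi> m \<in> U" "w \<in> tangent_space AB (\<pi> m)"
  shows "tangent_map AB AM (\<lambda>x. pt U \<tau> x (\<tau> m)) (\<pi> m) w \<in> tangent_space AM m"
  using tangent_map_tangent_space[OF AB AM smooth_pt[OF assms(1) trivD(5)[OF assms(1,2)]] assms(2,3)]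
    trivD(8)[OF assms(1,2)] by simp

lemma vertical_tangent_space: "velocity AM (\<lambda>s. \<rho> s m) 0 \<in> tangent_space AM m"
  using velocity_tangent_space[OF AM smooth_act_orbit, of 0] by simp

text \<open>The formula \<alpha> = pi^*A + d theta for a connection in a trivialisation, with A =
  \<open>base_form\<close>, evaluated on velocities.\<close>

lemma \<alpha>_velocity:
  assumes tr: "triv U \<tau>" and c: "smooth_map_on euclid_atlas AM S c" "t \<in> S" "\<pi> (c t) \<in> U"
  shows "\<alpha> (c t) (velocity AM c t) = base_form U \<tau> (\<pi> (c t)) (velocity AB (\<lambda>s. \<pi> (c s)) t) + angular \<tau> c t"
proof -
  have w: "velocity AB (\<lambda>s. \<pi> (c s)) t \<in> tangent_space AB (\<pi> (c t))"
    by (rule velocity_tangent_space[OF AB smooth_proj_curve[OF c(1)] c(2)])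
  show ?thesis
    unfolding velocity_decomposition[OF tr c]
    using \<alpha>_lincomb[OF tangent_map_pt_tangent_space[OF tr c(3) w] vertical_tangent_space[of "c t"], of 1 "angular \<tau> c t"]
      \<alpha>_tangent_map_pt[OF tr c(3) trivD(5)[OF tr c(3)] w] trivD(8)[OF tr c(3)]
    by (simp add: \<alpha>_vertical)
qed

text \<open>By the splitting of velocities, vectors with equal projection differ by a multiple of
  the vertical generator, on which \<alpha> is 1. This is why projection and \<alpha>-value
  characterise the lifted field.\<close>

lemma tangent_vector_eqI:
  assumes u: "u \<in> tangent_space AM m" and v: "v \<in> tangent_space AM m"
    and "tangent_map AM AB \<pi> m u = tangent_map AM AB \<pi> m v" "\<alpha> m u = \<alpha> m v"
  shows "u = v"
proof -
  obtain U \<tau> where tr: "triv U \<tau>" "\<pi> m \<in> U" using triv_exists by blast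
  have "\<exists>a. v = (\<lambda>C. 1 *\<^sub>R tangent_map AB AM (\<lambda>x. pt U \<tau> x (\<tau> m)) (\<pi> m) (tangent_map AM AB \<pi> m v) C
      + a *\<^sub>R velocity AM (\<lambda>s. \<rho> s m) 0 C)" (is "\<exists>a. v = ?G v a") if v: "v \<in> tangent_space AM m" for v
  proof -
    obtain c S where c: "0 \<in> S" "smooth_map_on euclid_atlas AM S c" "c 0 = m" "velocity AM c 0 = v"
      using tangent_space_velocity[OF AM v] by metis
    show ?thesis
      using velocity_decomposition[OF tr(1) c(2,1)] velocity_proj[OF c(2,1)] c(3,4) tr(2) by auto
  qed
  from this[OF u] this[OF v] obtain a b where ab: "u = ?G u a" "v = ?G v b" by blast
  note Q = tangent_map_pt_tangent_space[OF tr tangent_map_tangent_space[OF AM AB smooth_proj UNIV_I v]]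
  have "\<alpha> m (?G v a) = \<alpha> m (?G v b)" using ab assms(3,4) by metis
  then have "a = b" unfolding \<alpha>_lincomb[OF Q vertical_tangent_space] by (simp add: \<alpha>_vertical)
  then show ?thesis using ab assms(3) by metis
qed

text \<open>The lift moves along the section of constant angular coordinate \<open>\<tau> m\<close>.
  Together with nondegeneracy of \<omega>, surjectivity will force the Reeb field to be
  vertical.\<close>

lemma tangent_map_proj_surj:
  assumes "w \<in> tangent_space AB (\<pi> m)"
  obtains v where "v \<in> tangent_space AM m" "tangent_map AM AB \<pi> m v = w"
proof -
  obtain U \<tau> where tr: "triv U \<tau>" "\<pi> m \<in> U" using triv_exists by blast
  obtain c S where c: "0 \<in> S" "smooth_map_on euclid_atlas AB S c" "c 0 = \<pi> m" "velocity AB c 0 = w"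
    using tangent_space_velocity[OF AB assms] by metis
  define T where "T = S \<inter> c -` U"
  have T: "open T" unfolding T_def by (rule smooth_map_on_open_preimage[OF c(2) trivD(1)[OF tr(1)]])
  have T0: "0 \<in> T" using c tr by (simp add: T_def)
  have n: "norm (\<tau> m) = 1" by (rule trivD(5)[OF tr])
  have s: "smooth_map_on euclid_atlas AM T (\<lambda>s. pt U \<tau> (c s) (\<tau> m))"
    by (rule smooth_map_on_compose[OF smooth_atlas_euclid AB AM smooth_map_on_subset[OF c(2) T] smooth_pt[OF tr(1) n]])
      (auto simp: T_def)
  have m: "pt U \<tau> (c 0) (\<tau> m) = m" using trivD(8)[OF tr] c(3) by simp
  show thesis
  proof
    show "velocity AM (\<lambda>s. pt U \<tau> (c s) (\<tau> m)) 0 \<in> tangent_space AM m"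
      using velocity_tangent_space[OF AM s T0] m by simp
    have "velocity AB (\<lambda>s. \<pi> (pt U \<tau> (c s) (\<tau> m))) 0 = velocity AB c 0"
      by (rule velocity_cong[OF AB T T0 _ c(2,1)]) (simp add: T_def trivD(6)[OF tr(1) _ n])
    then show "tangent_map AM AB \<pi> m (velocity AM (\<lambda>s. pt U \<tau> (c s) (\<tau> m)) 0) = w"
      using velocity_proj[OF s T0] m c(4) by simp
  qed
qed

end

text \<open>Of \<omega> only its contraction with \<open>X\<close> remains: the last assumption says
  that i_Z d \<alpha> is minus the differential of \<open>H\<close> pulled back to the bundle. The
  flow \<open>\<psi>\<close> of \<open>X\<close> is part of the data.\<close>

locale hamiltonian_lift = connection_bundle AB AM \<pi> \<rho> \<alpha>
  for AB :: "('b::{t2_space,second_countable_topology}, 'e::euclidean_space) chart set"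
    and AM :: "('m::{t2_space,second_countable_topology}, 'f::euclidean_space) chart set"
    and \<pi> :: "'m \<Rightarrow> 'b"
    and \<rho> :: "real \<Rightarrow> 'm \<Rightarrow> 'm"
    and \<alpha> :: "'m \<Rightarrow> ('m, 'f) tangent \<Rightarrow> real" +
  fixes H :: "'b \<Rightarrow> real" and X :: "'b \<Rightarrow> ('b, 'e) tangent" and \<psi> :: "real \<Rightarrow> 'b \<Rightarrow> 'b"
    and Z :: "'m \<Rightarrow> ('m, 'f) tangent"
  assumes smooth_H: "smooth_map AB euclid_atlas H"
    and flow_X: "flow_of AB X \<psi>"
    and Z_tangent: "Z m \<in> tangent_space AM m"
    and Z_proj: "tangent_map AM AB \<pi> m (Z m) = X (\<pi> m)"
    and \<alpha>_Z: "\<alpha> m (Z m) = H (\<pi> m)"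
    and d\<alpha>_Z: "v \<in> tangent_space AM m \<Longrightarrow>
      d_one_form AM \<alpha> m (Z m) v = - d_fun AB H (\<pi> m) (tangent_map AM AB \<pi> m v)"
begin

lemma smooth_\<psi>: "smooth_map (prod_atlas euclid_atlas AB) AB (\<lambda>z. \<psi> (fst z) (snd z))"
  and \<psi>_0 [simp]: "\<psi> 0 x = x" and \<psi>_add: "\<psi> (s + t) x = \<psi> s (\<psi> t x)"
  and velocity_\<psi>: "velocity AB (\<lambda>t. \<psi> t x) t = X (\<psi> t x)"
  using flow_X by (auto simp: flow_of_def flow_def split_def)

lemma smooth_\<psi>_compose:
  fixes A :: "('p::{t2_space,second_countable_topology}, 'g::euclidean_space) chart set"
  assumes "smooth_atlas A" "smooth_map_on A euclid_atlas S t" "smooth_map_on A AB S x"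
  shows "smooth_map_on A AB S (\<lambda>p. \<psi> (t p) (x p))"
  using smooth_map_on_compose[OF assms(1) smooth_atlas_prod[OF smooth_atlas_euclid AB] AB
    smooth_map_on_Pair[OF assms(1) smooth_atlas_euclid AB assms(2,3)] smooth_\<psi>] by simp

lemma smooth_\<psi>_orbit: "smooth_map euclid_atlas AB (\<lambda>t. \<psi> t x)"
  by (rule smooth_\<psi>_compose[OF smooth_atlas_euclid smooth_map_id[OF smooth_atlas_euclid]
    smooth_map_on_const[OF smooth_atlas_euclid open_UNIV]])

text \<open>In a trivialisation, integral curves of \<open>Z\<close> over an integral curve of \<open>X\<close> rotate with this speed.\<close>

definition rotation :: "'b set \<Rightarrow> ('m \<Rightarrow> complex) \<Rightarrow> 'b \<Rightarrow> real" where
  "rotation U \<tau> x = H x - base_form U \<tau> x (X x)"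

text \<open>\<open>base_form U \<tau> x (X x)\<close> is \<alpha> on the velocity at time 0 of the
  constant-angle lift of the orbit through \<open>x\<close>. In coordinates this is a coefficient of
  the pullback of \<alpha> by a map of time and base coordinates, hence smooth in
  \<open>x\<close>.\<close>

lemma smooth_rotation:
  assumes tr: "triv U \<tau>"
  shows "smooth_map_on AB euclid_atlas U (rotation U \<tau>)"
proof (rule smooth_map_on_local[OF AB smooth_atlas_euclid _ trivD(1)[OF tr]])
  fix p assume p: "p \<in> U"
  obtain C where C: "C \<in> AB" "p \<in> fst C" using smooth_atlas_cover[OF AB] by blast
  note ch = smooth_atlas_chart[OF AB C(1)]
  define N where "N = (UNIV :: real set) \<times> chart_image C"
  have oN: "open N" using ch(2) by (simp add: N_def open_Times)
  have 1: "smooth_map_on euclid_atlas euclid_atlas N fst" "smooth_map_on euclid_atlas euclid_atlas N snd"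
    unfolding smooth_map_on_euclid_iff
    using oN smooth_on_bounded_linear[OF oN bounded_linear_fst smooth_on_id[OF oN]]
      smooth_on_bounded_linear[OF oN bounded_linear_snd smooth_on_id[OF oN]] by auto
  have 2: "smooth_map_on euclid_atlas AB N (\<lambda>q. \<psi> (fst q) (chart_inv C (snd q)))"
    by (rule smooth_\<psi>_compose[OF smooth_atlas_euclid 1(1)
          smooth_map_on_compose[OF smooth_atlas_euclid smooth_atlas_euclid AB 1(2) smooth_map_on_chart_inv[OF AB C(1)]]])
      (auto simp: N_def)
  define Q where "Q = N \<inter> (\<lambda>q. \<psi> (fst q) (chart_inv C (snd q))) -` U"
  have oQ: "open Q" unfolding Q_def by (rule smooth_map_on_open_preimage[OF 2 trivD(1)[OF tr]])
  define G where "G q = pt U \<tau> (\<psi> (fst q) (chart_inv C (snd q))) 1" for q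
  have G: "smooth_map_on euclid_atlas AM Q G" unfolding G_def
    by (rule smooth_map_on_compose[OF smooth_atlas_euclid AB AM smooth_map_on_subset[OF 2 oQ] smooth_pt[OF tr]])
      (auto simp: Q_def)
  define V where "V = fst C \<inter> U"
  have oV: "open V" using ch(1) trivD(1)[OF tr] by (auto simp: V_def)
  have sV: "smooth_map_on AB euclid_atlas V (snd C)"
    by (rule smooth_map_on_subset[OF smooth_map_on_chart[OF AB C(1)] oV]) (auto simp: V_def)
  have VQ: "(0, snd C x) \<in> Q" "G (0, snd C x) = pt U \<tau> x 1" if "x \<in> V" for x
    using that ch(6) by (auto simp: V_def Q_def N_def G_def)
  have "smooth_map_on euclid_atlas euclid_atlas Q (\<lambda>q. \<alpha> (G q) (differential AM G q (1, 0)))"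
    unfolding smooth_map_on_euclid_iff using one_form_differential_smooth[OF AM one_form_\<alpha> G] oQ by blast
  moreover have "smooth_map_on AB euclid_atlas V (\<lambda>x. (0 :: real, snd C x))"
    using smooth_map_on_Pair[OF AB smooth_atlas_euclid smooth_atlas_euclid smooth_map_on_const[OF AB oV] sV]
    by (simp add: prod_atlas_euclid)
  ultimately have 3: "smooth_map_on AB euclid_atlas V (\<lambda>x. \<alpha> (G (0, snd C x)) (differential AM G (0, snd C x) (1, 0)))"
    using smooth_map_on_compose[OF AB smooth_atlas_euclid smooth_atlas_euclid] VQ(1) by blast
  have eq: "\<alpha> (G (0, snd C x)) (differential AM G (0, snd C x) (1, 0)) = base_form U \<tau> x (X x)" if x: "x \<in> V" for x
  proof -
    have "((\<lambda>h. (h, snd C x)) has_vector_derivative (1, 0)) (at 0)"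
      by (auto intro!: has_vector_derivative_Pair derivative_eq_intros)
    from velocity_eq_differential[OF AM G VQ(1)[OF x] this]
    have "differential AM G (0, snd C x) (1, 0) = velocity AM (\<lambda>h. pt U \<tau> (\<psi> h x) 1) 0"
      using x ch(6) by (simp add: G_def V_def)
    also have "\<dots> = tangent_map AB AM (\<lambda>x. pt U \<tau> x 1) x (X x)"
      using tangent_map_velocity[OF AB smooth_\<psi>_orbit[of x] UNIV_I[of 0] smooth_pt[OF tr, of 1]] x
      by (simp add: velocity_\<psi> V_def)
    finally show ?thesis using VQ(2)[OF x] by (simp add: base_form_def)
  qed
  have "smooth_map_on AB euclid_atlas V (\<lambda>x. (H x, \<alpha> (G (0, snd C x)) (differential AM G (0, snd C x) (1, 0))))"
    using smooth_map_on_Pair[OF AB smooth_atlas_euclid smooth_atlas_euclid smooth_map_on_subset[OF smooth_H oV] 3]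
    by (simp add: prod_atlas_euclid)
  moreover have "smooth_map euclid_atlas euclid_atlas (\<lambda>q :: real \<times> real. fst q - snd q)"
    unfolding smooth_map_on_euclid_iff
    by (auto intro!: smooth_on_diff smooth_on_bounded_linear[OF open_UNIV bounded_linear_fst smooth_on_id]
      smooth_on_bounded_linear[OF open_UNIV bounded_linear_snd smooth_on_id])
  ultimately have "smooth_map_on AB euclid_atlas V
      (\<lambda>x. H x - \<alpha> (G (0, snd C x)) (differential AM G (0, snd C x) (1, 0)))"
    using smooth_map_on_compose[OF AB smooth_atlas_euclid smooth_atlas_euclid] by fastforce
  then have "smooth_map_on AB euclid_atlas V (rotation U \<tau>)"
    by (rule smooth_map_on_cong[OF AB smooth_atlas_euclid]) (simp add: eq rotation_def)
  then show "\<exists>T. p \<in> T \<and> smooth_map_on AB euclid_atlas T (rotation U \<tau>)"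
    using p C(2) by (intro exI[of _ V]) (auto simp: V_def)
qed

lemma angular_integral_curve:
  assumes "triv U \<tau>" "smooth_map_on euclid_atlas AM S c" "t \<in> S" "\<pi> (c t) \<in> U" "velocity AM c t = Z (c t)"
  shows "angular \<tau> c t = rotation U \<tau> (\<pi> (c t))"
  using \<alpha>_velocity[OF assms(1-4)] velocity_proj[OF assms(2,3)] assms(5)
  by (simp add: Z_proj \<alpha>_Z rotation_def)

text \<open>Converse to the preceding lemma: \<open>Z\<close> is the only tangent vector with its
  projection and \<alpha>-value.\<close>

lemma velocity_eq_Z:
  assumes "triv U \<tau>" "smooth_map_on euclid_atlas AM S c" "t \<in> S" "\<pi> (c t) \<in> U"
    and "velocity AB (\<lambda>s. \<pi> (c s)) t = X (\<pi> (c t))" "angular \<tau> c t = rotation U \<tau> (\<pi> (c t))"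
  shows "velocity AM c t = Z (c t)"
  using \<alpha>_velocity[OF assms(1-4)] velocity_proj[OF assms(2,3)] assms(5,6)
  by (intro tangent_vector_eqI[OF velocity_tangent_space[OF AM assms(2,3)] Z_tangent])
    (simp_all add: Z_proj \<alpha>_Z rotation_def)

end

section \<open>From local flows to flows\<close>

text \<open>The extension is the n-fold iterate of \<phi> at time t/n, for any n with |t|/n < e;
  passing to a common multiple shows independence of n. Near a given time one n suffices, whence
  smoothness.\<close>

lemma local_flow_extends:
  fixes A :: "('p::{t2_space,second_countable_topology}, 'e::euclidean_space) chart set"
  assumes A: "smooth_atlas A" and e: "e > 0"
    and smooth: "smooth_map_on (prod_atlas euclid_atlas A) A (ball 0 e \<times> UNIV) (\<lambda>q. \<phi> (fst q) (snd q))"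
    and \<phi>0: "\<And>p. \<phi> 0 p = p"
    and add: "\<And>s t p. \<bar>s\<bar> < e \<Longrightarrow> \<bar>t\<bar> < e \<Longrightarrow> \<bar>s + t\<bar> < e \<Longrightarrow> \<phi> (s + t) p = \<phi> s (\<phi> t p)"
  shows "\<exists>\<Phi>. flow A \<Phi> \<and> (\<forall>t p. \<bar>t\<bar> < e \<longrightarrow> \<Phi> t p = \<phi> t p)"
proof -
  have mult: "\<phi> (real k * s) = \<phi> s ^^ k" if "\<bar>real k * s\<bar> < e" for k s
    using that
  proof (induction k)
    case 0
    then show ?case by (auto simp: \<phi>0)
  next
    case (Suc k)
    have sum: "real (Suc k) * s = s + real k * s" by (simp add: algebra_simps)
    have "real k * \<bar>s\<bar> \<le> real (Suc k) * \<bar>s\<bar>" "1 * \<bar>s\<bar> \<le> real (Suc k) * \<bar>s\<bar>"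
      by (rule mult_right_mono; simp)+
    moreover have "real (Suc k) * \<bar>s\<bar> < e" using Suc.prems unfolding abs_mult abs_of_nat .
    ultimately have small: "\<bar>real k * s\<bar> < e" "\<bar>s\<bar> < e" unfolding abs_mult abs_of_nat by linarith+
    show ?case
      unfolding sum funpow.simps Suc.IH[OF small(1), symmetric] fun_eq_iff o_apply
      using add[OF small(2,1)] Suc.prems sum by simp
  qed
  \<comment> \<open>The added 1 makes |t|/e < \<open>N t\<close> strict and keeps \<open>N t\<close>
    positive at t = 0.\<close>
  define N where "N t = nat \<lceil>\<bar>t\<bar> / e\<rceil> + 1" for t
  have N: "N t > 0" "\<bar>t\<bar> / real (N t) < e" for t
  proof -
    show "N t > 0" by (simp add: N_def)
    then have pos: "real (N t) > 0" by simp
    have "\<bar>t\<bar> / e < real (N t)" unfolding N_def by linarith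
    then show "\<bar>t\<bar> / real (N t) < e" 
      unfolding pos_divide_less_eq[OF e] pos_divide_less_eq[OF pos] by (simp add: mult.commute)
  qed
  define \<Phi> where "\<Phi> t = \<phi> (t / real (N t)) ^^ N t" for t
  have refine: "\<phi> (t / real n) ^^ n = \<phi> (t / real (n * k)) ^^ (n * k)"
    if "n > 0" "k > 0" "\<bar>t\<bar> / real n < e" for t n k
  proof -
    have "real k * (t / real (n * k)) = t / real n" using that by simp
    then have "\<phi> (t / real n) = \<phi> (t / real (n * k)) ^^ k"
      using mult[of k "t / real (n * k)"] that by (simp add: abs_divide)
    then show ?thesis by (simp add: funpow_mult mult.commute)
  qed
  have \<Phi>: "\<Phi> t = \<phi> (t / real n) ^^ n" if "n > 0" "\<bar>t\<bar> / real n < e" for t n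
    unfolding \<Phi>_def using refine[OF N(1) that(1) N(2)] refine[OF that(1) N(1) that(2)] by (simp add: mult.commute)
  have \<Phi>1: "\<Phi> t p = \<phi> t p" if "\<bar>t\<bar> < e" for t p
    using \<Phi>[of 1 t] that by simp
  have \<Phi>_add: "\<Phi> (s + t) p = \<Phi> s (\<Phi> t p)" for s t p
  proof -
    define n where "n = N (\<bar>s\<bar> + \<bar>t\<bar>)"
    have n: "n > 0" "(\<bar>s\<bar> + \<bar>t\<bar>) / real n < e" using N[of "\<bar>s\<bar> + \<bar>t\<bar>"] by (simp_all add: n_def)
    have le: "\<bar>s\<bar> / real n \<le> (\<bar>s\<bar> + \<bar>t\<bar>) / real n" "\<bar>t\<bar> / real n \<le> (\<bar>s\<bar> + \<bar>t\<bar>) / real n"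
      "\<bar>s + t\<bar> / real n \<le> (\<bar>s\<bar> + \<bar>t\<bar>) / real n"
      by (auto intro!: divide_right_mono)
    have small: "\<bar>s\<bar> / real n < e" "\<bar>t\<bar> / real n < e" "\<bar>s + t\<bar> / real n < e" using n(2) le by linarith+
    define a where "a = \<phi> (s / real n)"
    define b where "b = \<phi> (t / real n)"
    have ab: "\<phi> ((s + t) / real n) = a \<circ> b"
      using add[of "s / real n" "t / real n"] small by (auto simp: a_def b_def add_divide_distrib[symmetric] abs_divide)
    have ba: "\<phi> ((s + t) / real n) = b \<circ> a"
      using add[of "t / real n" "s / real n"] small
      by (auto simp: a_def b_def add_divide_distrib[symmetric] abs_divide add.commute[of t s])
    \<comment> \<open>The maps commute because s + t = t + s, so that the iterates of the composite
      can be regrouped.\<close>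
    have com: "b ((a ^^ k) x) = (a ^^ k) (b x)" for k x
      using ab ba by (induction k) (simp_all add: fun_eq_iff)
    have "((a \<circ> b) ^^ k) x = (a ^^ k) ((b ^^ k) x)" for k x
      by (induction k) (simp_all add: com)
    then show ?thesis
      using \<Phi>[OF n(1) small(1)] \<Phi>[OF n(1) small(2)] \<Phi>[OF n(1) small(3)] ab by (simp add: a_def b_def)
  qed
  note EA = smooth_atlas_prod[OF smooth_atlas_euclid A]
  \<comment> \<open>The number \<open>k\<close> of iterations is decoupled from the step size, to
    allow an induction on \<open>k\<close> with the domain fixed.\<close>
  have sm: "smooth_map_on (prod_atlas euclid_atlas A) A (ball 0 (real n * e) \<times> UNIV)
      (\<lambda>q. (\<phi> (fst q / real n) ^^ k) (snd q))" if n: "n > 0" for n k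
  proof -
    have o: "open (ball 0 (real n * e) \<times> (UNIV :: 'p set))" by (simp add: open_Times)
    note f = smooth_map_on_subset[OF smooth_map_fst[OF smooth_atlas_euclid A] o subset_UNIV]
    note s = smooth_map_on_subset[OF smooth_map_snd[OF smooth_atlas_euclid A] o subset_UNIV]
    have div: "smooth_map euclid_atlas euclid_atlas (\<lambda>t::real. t / real n)"
      unfolding smooth_map_on_euclid_iff
      using smooth_on_bounded_linear[OF open_UNIV bounded_linear_divide smooth_on_id[OF open_UNIV]] by blast
    have fd: "smooth_map_on (prod_atlas euclid_atlas A) euclid_atlas (ball 0 (real n * e) \<times> UNIV) (\<lambda>q. fst q / real n)"
      by (rule smooth_map_on_compose[OF EA smooth_atlas_euclid smooth_atlas_euclid f div]) simp
    show ?thesis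
    proof (induction k)
      case 0
      then show ?case using s by simp
    next
      case (Suc k)
      have "smooth_map_on (prod_atlas euclid_atlas A) A (ball 0 (real n * e) \<times> UNIV)
        (\<lambda>q. \<phi> (fst (fst q / real n, (\<phi> (fst q / real n) ^^ k) (snd q)))
          (snd (fst q / real n, (\<phi> (fst q / real n) ^^ k) (snd q))))"
        by (rule smooth_map_on_compose[OF EA EA A smooth_map_on_Pair[OF EA smooth_atlas_euclid A fd Suc] smooth])
          (use n in \<open>auto simp: field_simps abs_divide\<close>)
      then show ?case by simp
    qed
  qed
  have "flow A \<Phi>"
    unfolding flow_def
  proof (intro conjI allI)
    have "smooth_map (prod_atlas euclid_atlas A) A (\<lambda>q. \<Phi> (fst q) (snd q))"
    proof (rule smooth_map_on_local[OF EA A _ open_UNIV])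
      fix q :: "real \<times> 'p"
      define n where "n = N (fst q)"
      have n: "n > 0" "\<bar>fst q\<bar> / real n < e" using N[of "fst q"] by (simp_all add: n_def)
      have "smooth_map_on (prod_atlas euclid_atlas A) A (ball 0 (real n * e) \<times> UNIV) (\<lambda>q. \<Phi> (fst q) (snd q))"
        by (rule smooth_map_on_cong[OF EA A sm[OF n(1), of n]])
          (use n(1) in \<open>auto simp: \<Phi>[OF n(1)] field_simps\<close>)
      moreover have "q \<in> ball 0 (real n * e) \<times> UNIV" using n by (cases q) (auto simp: field_simps)
      ultimately show "\<exists>T. q \<in> T \<and> smooth_map_on (prod_atlas euclid_atlas A) A T (\<lambda>q. \<Phi> (fst q) (snd q))"
        by (intro exI conjI)
    qed
    then show "smooth_map (prod_atlas euclid_atlas A) A (\<lambda>(t, p). \<Phi> t p)" by (simp add: split_def)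
  qed (use \<Phi>1[of 0] e \<phi>0 \<Phi>_add in auto)
  then show ?thesis using \<Phi>1 by blast
qed

lemma flow_smooth_orbit:
  fixes A :: "('p::{t2_space,second_countable_topology}, 'e::euclidean_space) chart set"
  assumes "smooth_atlas A" "flow A \<Phi>"
  shows "smooth_map euclid_atlas A (\<lambda>t. \<Phi> t p)"
  using smooth_map_on_compose[OF smooth_atlas_euclid smooth_atlas_prod[OF smooth_atlas_euclid assms(1)] assms(1)
     smooth_map_on_Pair[OF smooth_atlas_euclid smooth_atlas_euclid assms(1) smooth_map_id[OF smooth_atlas_euclid]
     smooth_map_on_const[OF smooth_atlas_euclid open_UNIV, of _ p]]]
    assms(2) by (fastforce simp: flow_def split_def)

text \<open>By the group law the orbit near time \<open>t\<close> is the orbit through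
  \<open>\<Phi> t p\<close> restarted, so the generator needs to be known only at time 0.\<close>

lemma flow_velocity:
  fixes A :: "('p::{t2_space,second_countable_topology}, 'e::euclidean_space) chart set"
  assumes A: "smooth_atlas A" and fl: "flow A \<Phi>"
  shows "velocity A (\<lambda>t. \<Phi> t p) t = velocity A (\<lambda>h. \<Phi> h (\<Phi> t p)) 0"
proof -
  have "\<Phi> s p = \<Phi> (s - t) (\<Phi> t p)" for s
    using fl unfolding flow_def by (metis diff_add_cancel)
  then have "(\<lambda>s. \<Phi> s p) = (\<lambda>s. \<Phi> (s - t) (\<Phi> t p))" by blast
  then have "velocity A (\<lambda>s. \<Phi> s p) t = velocity A (\<lambda>s. \<Phi> (s - t) (\<Phi> t p)) t"
    by (rule arg_cong[where f = "\<lambda>c. velocity A c t"])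
  also have "\<dots> = differential A (\<lambda>h. \<Phi> h (\<Phi> t p)) (t - t) 1"
    by (rule velocity_eq_differential[OF A flow_smooth_orbit[OF A fl]]) (auto intro!: derivative_eq_intros)
  also have "\<dots> = velocity A (\<lambda>h. \<Phi> h (\<Phi> t p)) 0"
    using velocity_differential_1[OF A flow_smooth_orbit[OF A fl]] by simp
  finally show ?thesis .
qed

text \<open>The integral of \<open>h\<close> from 0 to t, substituted to a fixed interval: it takes
  the shape of a parameter integral, and needs no distinction on the sign of t.\<close>

lemma scaled_integral_has_derivative:
  fixes h :: "real \<Rightarrow> real"
  assumes h: "continuous_on (ball 0 e) h" and t: "t \<in> ball 0 e"
  shows "((\<lambda>t. integral {0..1} (\<lambda>u. t * h (u * t))) has_vector_derivative h t) (at t)"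
proof -
  \<comment> \<open>An interval with \<open>t\<close> and 0 in its interior, so that one
    antiderivative \<open>P\<close> based at -a handles both signs of \<open>t\<close>.\<close>
  obtain a where a: "\<bar>t\<bar> < a" "a < e" using t dense[of "\<bar>t\<bar>" e] by auto
  have sub: "{-a..a} \<subseteq> ball 0 e" using a by auto
  define P where "P s = integral {-a..s} h" for s
  have P: "(P has_vector_derivative h s) (at s)" if "s \<in> {-a<..<a}" for s
  proof -
    have "(P has_vector_derivative h s) (at s within {-a..a})" unfolding P_def
      by (rule integral_has_vector_derivative[OF continuous_on_subset[OF h sub]]) (use that in auto)
    then show ?thesis using that by (simp add: at_within_Icc_at)
  qed
  have eq: "P s - P 0 = integral {0..1} (\<lambda>u. s * h (u * s))" if s: "s \<in> {-a<..<a}" for s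
  proof -
    have "((\<lambda>u. s *\<^sub>R h (u * s)) has_integral P (1 * s) - P (0 * s)) {0..1}"
    proof (rule fundamental_theorem_of_calculus)
      fix u :: real assume u: "u \<in> {0..1}"
      have "\<bar>u * s\<bar> \<le> 1 * \<bar>s\<bar>" unfolding abs_mult by (rule mult_right_mono) (use u in auto)
      then have us: "u * s \<in> {-a<..<a}" using s by auto
      have "((\<lambda>u. u * s) has_vector_derivative s) (at u within {0..1})" by (auto intro!: derivative_eq_intros)
      from has_vector_derivative_compose_derivative[OF this P[OF us, unfolded has_vector_derivative_def]]
      show "((\<lambda>u. P (u * s)) has_vector_derivative s *\<^sub>R h (u * s)) (at u within {0..1})" by simp
    qed simp
    from integral_unique[OF this] show ?thesis by simp
  qed
  have "((\<lambda>s. P s - P 0) has_vector_derivative h t - 0) (at t)"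
    by (intro has_vector_derivative_diff has_vector_derivative_const P) (use a in auto)
  then have "((\<lambda>s. P s - P 0) has_vector_derivative h t) (at t)" by simp
  then show ?thesis
    by (rule has_vector_derivative_transform_within_open[of _ _ _ "{-a<..<a}"]) (use a eq in auto)
qed

lemma smooth_map_on_to_euclid_add:
  fixes A :: "('p::{t2_space,second_countable_topology}, 'e::euclidean_space) chart set" and f g :: "'p \<Rightarrow> real"
  assumes A: "smooth_atlas A" and "smooth_map_on A euclid_atlas S f" "smooth_map_on A euclid_atlas S g"
  shows "smooth_map_on A euclid_atlas S (\<lambda>p. f p + g p)"
proof -
  have 1: "smooth_map_on A euclid_atlas S (\<lambda>p. (f p, g p))"
    using smooth_map_on_Pair[OF A smooth_atlas_euclid smooth_atlas_euclid assms(2,3)] by (simp add: prod_atlas_euclid)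
  have 2: "smooth_map euclid_atlas euclid_atlas (\<lambda>q :: real \<times> real. fst q + snd q)"
    unfolding smooth_map_on_euclid_iff
    by (auto intro!: smooth_on_add smooth_on_bounded_linear[OF open_UNIV bounded_linear_fst smooth_on_id]
      smooth_on_bounded_linear[OF open_UNIV bounded_linear_snd smooth_on_id])
  show ?thesis using smooth_map_on_compose[OF A smooth_atlas_euclid smooth_atlas_euclid 1 2] by simp
qed

section \<open>The flow of the lifted vector field\<close>

text \<open>Points of the unit circle that rotate with the same speed keep a constant quotient, the
  conjugate serving as inverse. The two curves may have different projections; only the speeds
  matter.\<close>

lemma (in circle_bundle) triv_ratio_const:
  fixes c d :: "real \<Rightarrow> 'm"
  assumes tr: "triv U \<tau>" and S: "convex S" "s \<in> S" "t \<in> S"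
    and c: "smooth_map_on euclid_atlas AM S c" "\<And>s. s \<in> S \<Longrightarrow> \<pi> (c s) \<in> U"
    and d: "smooth_map_on euclid_atlas AM S d" "\<And>s. s \<in> S \<Longrightarrow> \<pi> (d s) \<in> U"
    and eq: "\<And>s. s \<in> S \<Longrightarrow> angular \<tau> c s = angular \<tau> d s"
  shows "\<tau> (c t) * cnj (\<tau> (d t)) = \<tau> (c s) * cnj (\<tau> (d s))"
proof -
  define w where "w s = \<tau> (c s) * cnj (\<tau> (d s))" for s
  have "(w has_vector_derivative 0) (at s)" if s: "s \<in> S" for s
  proof -
    have 1: "((\<lambda>s. \<tau> (c s)) has_vector_derivative \<i> * angular \<tau> d s * \<tau> (c s)) (at s)"
      using triv_curve_derivative[OF tr c(1) s c(2)[OF s]] eq[OF s] by simp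
    have 2: "((\<lambda>s. cnj (\<tau> (d s))) has_vector_derivative cnj (\<i> * angular \<tau> d s * \<tau> (d s))) (at s)"
      using bounded_linear.has_vector_derivative[OF bounded_linear_cnj triv_curve_derivative[OF tr d(1) s d(2)[OF s]]] .
    show ?thesis
      using has_vector_derivative_mult[OF 1 2] by (simp add: w_def[abs_def])
  qed
  then have "w t = w s"
    using has_vector_derivative_zero_constant[OF S(1), of w] has_vector_derivative_at_within S(2,3) by metis
  then show ?thesis by (simp add: w_def)
qed

lemma (in circle_bundle) triv_ratio_1:
  assumes tr: "triv U \<tau>" and U: "\<pi> m \<in> U" "\<pi> n = \<pi> m"
  shows "\<tau> m * cnj (\<tau> n) = 1 \<longleftrightarrow> m = n"
proof
  have n: "\<tau> n * cnj (\<tau> n) = 1"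
    using trivD(5)[OF tr, of n] U complex_norm_square[of "\<tau> n"] by simp
  then show "m = n \<Longrightarrow> \<tau> m * cnj (\<tau> n) = 1" by simp
  assume "\<tau> m * cnj (\<tau> n) = 1"
  then have "\<tau> m = \<tau> n" using n by (metis mult_cancel_right zero_neq_one mult_zero_right)
  then show "m = n" by (rule triv_eqI[OF tr U])
qed

context hamiltonian_lift
begin

text \<open>Over the same base curve both curves rotate with the speed \<open>rotation\<close>, so
  the ratio of their angular coordinates stays 1. With the projections prescribed, this is all the
  uniqueness theory required.\<close>

lemma integral_curve_unique:
  fixes c d :: "real \<Rightarrow> 'm"
  assumes tr: "triv U \<tau>" and S: "convex S" "t\<^sub>0 \<in> S" "t \<in> S"
    and c: "smooth_map_on euclid_atlas AM S c" "\<And>s. s \<in> S \<Longrightarrow> velocity AM c s = Z (c s)"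
    and d: "smooth_map_on euclid_atlas AM S d" "\<And>s. s \<in> S \<Longrightarrow> velocity AM d s = Z (d s)"
    and proj: "\<And>s. s \<in> S \<Longrightarrow> \<pi> (c s) \<in> U" "\<And>s. s \<in> S \<Longrightarrow> \<pi> (c s) = \<pi> (d s)"
    and init: "c t\<^sub>0 = d t\<^sub>0"
  shows "c t = d t"
proof -
  have projd: "\<pi> (d s) \<in> U" if "s \<in> S" for s using proj[OF that] by simp
  have "angular \<tau> c s = angular \<tau> d s" if "s \<in> S" for s
    using angular_integral_curve[OF tr c(1) that proj(1)[OF that] c(2)[OF that]]
      angular_integral_curve[OF tr d(1) that projd[OF that] d(2)[OF that]] proj(2)[OF that] by simp
  from triv_ratio_const[OF tr S c(1) proj(1) d(1) projd this]
  have "\<tau> (c t) * cnj (\<tau> (d t)) = \<tau> (c t\<^sub>0) * cnj (\<tau> (d t\<^sub>0))" by simp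
  also have "\<dots> = 1" using triv_ratio_1[OF tr proj(1)[OF S(2)] proj(2)[OF S(2), symmetric]] init by blast
  finally show ?thesis using triv_ratio_1[OF tr proj(1)[OF S(3)] proj(2)[OF S(3), symmetric]] by blast
qed

section \<open>The lifted flow for short times\<close>

definition flow_box :: "'b set \<Rightarrow> ('m \<Rightarrow> complex) \<Rightarrow> 'b set \<Rightarrow> real \<Rightarrow> bool" where
  "flow_box U \<tau> W e \<longleftrightarrow> triv U \<tau> \<and> open W \<and> e > 0 \<and> (\<forall>x\<in>W. \<forall>s\<in>ball 0 e. \<psi> s x \<in> U)"

text \<open>The angle accumulated along the orbit of \<open>x\<close>, that is the integral of
  \<open>rotation\<close> from time 0 to \<open>t\<close>, rescaled to a fixed interval.\<close>

definition gain :: "'b set \<Rightarrow> ('m \<Rightarrow> complex) \<Rightarrow> 'b \<Rightarrow> real \<Rightarrow> real" where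
  "gain U \<tau> x t = integral {0..1} (\<lambda>u. t * rotation U \<tau> (\<psi> (u * t) x))"

definition local_flow :: "'b set \<Rightarrow> ('m \<Rightarrow> complex) \<Rightarrow> real \<Rightarrow> 'm \<Rightarrow> 'm" where
  "local_flow U \<tau> t m = pt U \<tau> (\<psi> t (\<pi> m)) (cis (gain U \<tau> (\<pi> m) t) * \<tau> m)"

lemma flow_boxD:
  assumes "flow_box U \<tau> W e"
  shows "triv U \<tau>" "open W" "e > 0" "\<And>x s. x \<in> W \<Longrightarrow> \<bar>s\<bar> < e \<Longrightarrow> \<psi> s x \<in> U" "\<And>x. x \<in> W \<Longrightarrow> x \<in> U"
proof -
  show "triv U \<tau>" "open W" "e > 0" and *: "\<And>x s. x \<in> W \<Longrightarrow> \<bar>s\<bar> < e \<Longrightarrow> \<psi> s x \<in> U"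
    using assms by (auto simp: flow_box_def)
  show "x \<in> U" if "x \<in> W" for x using *[OF that, of 0] \<open>e > 0\<close> by simp
qed

lemma local_flow_in_triv:
  assumes "flow_box U \<tau> W e" "\<pi> m \<in> W" "\<bar>t\<bar> < e"
  shows "\<pi> (local_flow U \<tau> t m) = \<psi> t (\<pi> m)" "\<tau> (local_flow U \<tau> t m) = cis (gain U \<tau> (\<pi> m) t) * \<tau> m"
  unfolding local_flow_def using trivD(5-7)[OF flow_boxD(1)[OF assms(1)]] flow_boxD(4,5)[OF assms(1)] assms(2,3)
  by (simp_all add: norm_mult)

lemma local_flow_0:
  assumes "flow_box U \<tau> W e" "\<pi> m \<in> W"
  shows "local_flow U \<tau> 0 m = m"
  using trivD(8)[OF flow_boxD(1)[OF assms(1)] flow_boxD(5)[OF assms]] by (simp add: local_flow_def gain_def)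

lemma gain_has_derivative:
  assumes box: "flow_box U \<tau> W e" and x: "x \<in> W" and t: "\<bar>t\<bar> < e"
  shows "(gain U \<tau> x has_vector_derivative rotation U \<tau> (\<psi> t x)) (at t)"
proof -
  have "smooth_map_on euclid_atlas euclid_atlas (ball 0 e) (\<lambda>t. rotation U \<tau> (\<psi> t x))"
    by (rule smooth_map_on_compose[OF smooth_atlas_euclid AB smooth_atlas_euclid
          smooth_map_on_subset[OF smooth_\<psi>_orbit open_ball subset_UNIV] smooth_rotation[OF flow_boxD(1)[OF box]]])
      (use flow_boxD(4)[OF box x] in auto)
  from scaled_integral_has_derivative[OF smooth_map_onD(2)[OF this]] t
  show ?thesis by (simp add: gain_def[abs_def])
qed

lemma smooth_gain:
  assumes box: "flow_box U \<tau> W e"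
  shows "smooth_map_on (prod_atlas euclid_atlas AB) euclid_atlas (ball 0 e \<times> W) (\<lambda>q. gain U \<tau> (snd q) (fst q))"
proof (rule smooth_map_on_local)
  note tr = flow_boxD(1)[OF box]
  show EB: "smooth_atlas (prod_atlas euclid_atlas AB)" by (rule smooth_atlas_prod[OF smooth_atlas_euclid AB])
  show "smooth_atlas (euclid_atlas :: (real, real) chart set)" by (rule smooth_atlas_euclid)
  show "open (ball 0 e \<times> W)" using flow_boxD(2)[OF box] by (simp add: open_Times)
  fix q :: "real \<times> 'b" assume q: "q \<in> ball 0 e \<times> W"
  obtain C where C: "C \<in> AB" "snd q \<in> fst C" using smooth_atlas_cover[OF AB] by blast
  note ch = smooth_atlas_chart[OF AB C(1)]
  define N where "N = (UNIV :: real set) \<times> (UNIV :: real set) \<times> chart_image C"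
  have oN: "open N" using ch(2) by (simp add: N_def open_Times)
  have pr: "smooth_on N fst" "smooth_on N (\<lambda>q. fst (snd q))" "smooth_on N (\<lambda>q. snd (snd q))"
    using smooth_on_bounded_linear[OF oN bounded_linear_fst smooth_on_id[OF oN]]
      smooth_on_bounded_linear[OF oN bounded_linear_compose[OF bounded_linear_fst bounded_linear_snd] smooth_on_id[OF oN]]
      smooth_on_bounded_linear[OF oN bounded_linear_compose[OF bounded_linear_snd bounded_linear_snd] smooth_on_id[OF oN]]
    by blast+
  have K: "smooth_map_on euclid_atlas AB N (\<lambda>q. \<psi> (fst q * fst (snd q)) (chart_inv C (snd (snd q))))"
    by (rule smooth_\<psi>_compose[OF smooth_atlas_euclid _
          smooth_map_on_compose[OF smooth_atlas_euclid smooth_atlas_euclid AB _ smooth_map_on_chart_inv[OF AB C(1)]]])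
      (use pr oN smooth_on_bounded_bilinear[OF oN bounded_bilinear_mult pr(1,2)] in
        \<open>auto simp: smooth_map_on_euclid_iff N_def\<close>)
  \<comment> \<open>Triples of the integration variable u, the time t and base coordinates for which
    the orbit at time u t lies in \<open>U\<close>. Since |u t| \<le> |t| for u between 0 and 1,
    this open set contains the whole range of integration.\<close>
  define \<Omega> where "\<Omega> = N \<inter> (\<lambda>q. \<psi> (fst q * fst (snd q)) (chart_inv C (snd (snd q)))) -` U"
  have o\<Omega>: "open \<Omega>" unfolding \<Omega>_def by (rule smooth_map_on_open_preimage[OF K trivD(1)[OF tr]])
  have "smooth_map_on euclid_atlas euclid_atlas \<Omega> (\<lambda>q. rotation U \<tau> (\<psi> (fst q * fst (snd q)) (chart_inv C (snd (snd q)))))"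
    by (rule smooth_map_on_compose[OF smooth_atlas_euclid AB smooth_atlas_euclid smooth_map_on_subset[OF K o\<Omega>] smooth_rotation[OF tr]])
      (auto simp: \<Omega>_def)
  then have "smooth_on \<Omega> (\<lambda>q. rotation U \<tau> (\<psi> (fst q * fst (snd q)) (chart_inv C (snd (snd q)))))"
    by (simp add: smooth_map_on_euclid_iff)
  from smooth_on_bounded_bilinear[OF o\<Omega> bounded_bilinear_mult smooth_on_subset[OF pr(2)] this]
  have G: "smooth_on \<Omega> (\<lambda>q. fst (snd q) * rotation U \<tau> (\<psi> (fst q * fst (snd q)) (chart_inv C (snd (snd q)))))"
    by (simp add: \<Omega>_def)
  define S where "S = ball (0::real) e \<times> snd C ` (fst C \<inter> W)"
  have oS: "open S" unfolding S_def using smooth_atlas_open_image[OF AB C(1) flow_boxD(2)[OF box]] by (simp add: open_Times)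
  have S\<Omega>: "{0..1} \<times> S \<subseteq> \<Omega>"
  proof
    fix q :: "real \<times> real \<times> 'e" assume "q \<in> {0..1} \<times> S"
    then obtain u t x where a: "q = (u, t, snd C x)" "0 \<le> u" "u \<le> 1" "\<bar>t\<bar> < e" "x \<in> fst C" "x \<in> W"
      by (auto simp: S_def)
    have "\<bar>u * t\<bar> \<le> 1 * \<bar>t\<bar>" unfolding abs_mult by (rule mult_right_mono) (use a in auto)
    then have "\<psi> (u * t) x \<in> U" using flow_boxD(4)[OF box a(6)] a(4) by simp
    then show "q \<in> \<Omega>" using a(5) ch(6) by (simp add: a(1) \<Omega>_def N_def)
  qed
  have I: "smooth_map_on euclid_atlas euclid_atlas S (\<lambda>p. gain U \<tau> (chart_inv C (snd p)) (fst p))"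
    using smooth_on_integral_param[OF oS S\<Omega> G] oS by (simp add: smooth_map_on_euclid_iff gain_def)
  define T where "T = ball (0::real) e \<times> (fst C \<inter> W)"
  have oT: "open T" using ch(1) flow_boxD(2)[OF box] by (auto simp: T_def intro: open_Times)
  note f = smooth_map_on_subset[OF smooth_map_fst[OF smooth_atlas_euclid AB] oT subset_UNIV]
  note s = smooth_map_on_subset[OF smooth_map_snd[OF smooth_atlas_euclid AB] oT subset_UNIV]
  have "smooth_map_on (prod_atlas euclid_atlas AB) euclid_atlas T (\<lambda>q. snd C (snd q))"
    by (rule smooth_map_on_compose[OF EB AB smooth_atlas_euclid s smooth_map_on_chart[OF AB C(1)]]) (auto simp: T_def)
  from smooth_map_on_Pair[OF EB smooth_atlas_euclid smooth_atlas_euclid f this]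
  have "smooth_map_on (prod_atlas euclid_atlas AB) euclid_atlas T (\<lambda>q. (fst q, snd C (snd q)))"
    by (simp add: prod_atlas_euclid)
  from smooth_map_on_compose[OF EB smooth_atlas_euclid smooth_atlas_euclid this I]
  have "smooth_map_on (prod_atlas euclid_atlas AB) euclid_atlas T
      (\<lambda>q. gain U \<tau> (chart_inv C (snd C (snd q))) (fst q))"
    by (simp add: T_def S_def split_beta mem_Times_iff)
  then have "smooth_map_on (prod_atlas euclid_atlas AB) euclid_atlas T (\<lambda>q. gain U \<tau> (snd q) (fst q))"
    by (rule smooth_map_on_cong[OF EB smooth_atlas_euclid]) (auto simp: T_def ch(6))
  then show "\<exists>T. q \<in> T \<and> smooth_map_on (prod_atlas euclid_atlas AB) euclid_atlas T (\<lambda>q. gain U \<tau> (snd q) (fst q))"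
    using q C(2) by (intro exI[of _ T]) (auto simp: T_def)
qed

text \<open>The inverse trivialisation is known to be smooth in a lifted angle, whereas the starting
  point enters through the circle-valued \<tau>. Near a given point a branch \<open>L\<close> of the
  angle bridges the two.\<close>

lemma smooth_local_flow:
  assumes box: "flow_box U \<tau> W e"
  shows "smooth_map_on (prod_atlas euclid_atlas AM) AM (ball 0 e \<times> \<pi> -` W) (\<lambda>q. local_flow U \<tau> (fst q) (snd q))"
proof (rule smooth_map_on_local)
  note tr = flow_boxD(1)[OF box]
  show EM: "smooth_atlas (prod_atlas euclid_atlas AM)" by (rule smooth_atlas_prod[OF smooth_atlas_euclid AM])
  show "smooth_atlas AM" by (rule AM)
  have oW: "open (\<pi> -` W)" using smooth_map_on_open_preimage[OF smooth_proj flow_boxD(2)[OF box]] by simp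
  then show "open (ball 0 e \<times> \<pi> -` W)" by (simp add: open_Times)
  fix q\<^sub>0 :: "real \<times> 'm" assume q\<^sub>0: "q\<^sub>0 \<in> ball 0 e \<times> \<pi> -` W"
  have nz: "norm (\<tau> (snd q\<^sub>0)) = 1" using q\<^sub>0 trivD(5)[OF tr] flow_boxD(5)[OF box] by auto
  obtain L V where L: "open V" "\<tau> (snd q\<^sub>0) \<in> V" "smooth_on V L" "\<And>w. w \<in> V \<Longrightarrow> norm w = 1 \<Longrightarrow> cis (L w) = w"
    by (rule that[OF circle_angle(1-4)[OF nz]])
  define N where "N = \<pi> -` U \<inter> \<tau> -` V \<inter> \<pi> -` W"
  have oN: "open N" unfolding N_def using smooth_map_on_open_preimage[OF trivD(3)[OF tr] L(1)] oW by blast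
  define T where "T = ball (0::real) e \<times> N"
  have oT: "open T" using oN by (simp add: T_def open_Times)
  note f = smooth_map_on_subset[OF smooth_map_fst[OF smooth_atlas_euclid AM] oT subset_UNIV]
  note s = smooth_map_on_subset[OF smooth_map_snd[OF smooth_atlas_euclid AM] oT subset_UNIV]
  note p = smooth_map_on_compose[OF EM AM AB s smooth_proj UNIV_I]
  have g: "smooth_map_on (prod_atlas euclid_atlas AM) euclid_atlas T (\<lambda>q. gain U \<tau> (snd (fst q, \<pi> (snd q))) (fst (fst q, \<pi> (snd q))))"
    by (rule smooth_map_on_compose[OF EM smooth_atlas_prod[OF smooth_atlas_euclid AB] smooth_atlas_euclid
        smooth_map_on_Pair[OF EM smooth_atlas_euclid AB f p] smooth_gain[OF box]]) (auto simp: T_def N_def)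
  have t: "smooth_map_on (prod_atlas euclid_atlas AM) euclid_atlas T (\<lambda>q. \<tau> (snd q))"
    by (rule smooth_map_on_compose[OF EM AM smooth_atlas_euclid s trivD(3)[OF tr]]) (auto simp: T_def N_def)
  have SL: "smooth_map_on euclid_atlas euclid_atlas V L" using L(1,3) by (simp add: smooth_map_on_euclid_iff)
  have a: "smooth_map_on (prod_atlas euclid_atlas AM) euclid_atlas T (\<lambda>q. L (\<tau> (snd q)))"
    by (rule smooth_map_on_compose[OF EM smooth_atlas_euclid smooth_atlas_euclid t SL]) (auto simp: T_def N_def)
  note ga = smooth_map_on_to_euclid_add[OF EM g a]
  note ps = smooth_\<psi>_compose[OF EM f p]
  have inU: "\<psi> t (\<pi> m) \<in> U" if "(t, m) \<in> T" for t m
    using that flow_boxD(4)[OF box] by (auto simp: T_def N_def)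
  from smooth_map_on_compose[OF EM smooth_atlas_prod[OF AB smooth_atlas_euclid] AM
      smooth_map_on_Pair[OF EM AB smooth_atlas_euclid ps ga] trivD(9)[OF tr]]
  have "smooth_map_on (prod_atlas euclid_atlas AM) AM T
     (\<lambda>q. pt U \<tau> (\<psi> (fst q) (\<pi> (snd q))) (cis (gain U \<tau> (\<pi> (snd q)) (fst q) + L (\<tau> (snd q)))))"
    using inU by (simp add: split_paired_all)
  then have "smooth_map_on (prod_atlas euclid_atlas AM) AM T (\<lambda>q. local_flow U \<tau> (fst q) (snd q))"
  proof (rule smooth_map_on_cong[OF EM AM])
    fix q assume "q \<in> T"
    then have "cis (L (\<tau> (snd q))) = \<tau> (snd q)"
      using L(4) trivD(5)[OF tr] by (auto simp: T_def N_def)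
    then show "pt U \<tau> (\<psi> (fst q) (\<pi> (snd q))) (cis (gain U \<tau> (\<pi> (snd q)) (fst q) + L (\<tau> (snd q)))) =
        local_flow U \<tau> (fst q) (snd q)"
      by (simp add: local_flow_def cis_mult[symmetric])
  qed
  moreover have "q\<^sub>0 \<in> T" using q\<^sub>0 L(2) flow_boxD(5)[OF box] by (auto simp: T_def N_def)
  ultimately show "\<exists>T. q\<^sub>0 \<in> T \<and> smooth_map_on (prod_atlas euclid_atlas AM) AM T (\<lambda>q. local_flow U \<tau> (fst q) (snd q))"
    by (intro exI conjI)
qed

lemma local_flow_curve:
  assumes box: "flow_box U \<tau> W e" and m: "\<pi> m \<in> W"
  shows "smooth_map_on euclid_atlas AM (ball 0 e) (\<lambda>t. local_flow U \<tau> t m)"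
    and "\<bar>t\<bar> < e \<Longrightarrow> velocity AM (\<lambda>t. local_flow U \<tau> t m) t = Z (local_flow U \<tau> t m)"
proof -
  note tr = flow_boxD(1)[OF box]
  let ?c = "\<lambda>t. local_flow U \<tau> t m"
  note in_triv = local_flow_in_triv[OF box m]
  have "smooth_map_on euclid_atlas AM (ball 0 e) (\<lambda>t. local_flow U \<tau> (fst (t, m)) (snd (t, m)))"
    by (rule smooth_map_on_compose[OF smooth_atlas_euclid smooth_atlas_prod[OF smooth_atlas_euclid AM] AM
          smooth_map_on_Pair[OF smooth_atlas_euclid smooth_atlas_euclid AM
            smooth_map_on_subset[OF smooth_map_id[OF smooth_atlas_euclid] open_ball subset_UNIV]
            smooth_map_on_const[OF smooth_atlas_euclid open_ball]] smooth_local_flow[OF box]])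
      (use m in auto)
  then show sm: "smooth_map_on euclid_atlas AM (ball 0 e) ?c" by simp
  assume t: "\<bar>t\<bar> < e"
  then have tb: "t \<in> ball 0 e" by simp
  show "velocity AM ?c t = Z (?c t)"
  proof (rule velocity_eq_Z[OF tr sm tb])
    show "\<pi> (?c t) \<in> U" using in_triv(1)[OF t] flow_boxD(4)[OF box m t] by simp
    have "velocity AB (\<lambda>s. \<pi> (?c s)) t = velocity AB (\<lambda>s. \<psi> s (\<pi> m)) t"
      by (rule velocity_cong[OF AB open_ball tb _ smooth_\<psi>_orbit UNIV_I]) (simp add: in_triv)
    then show "velocity AB (\<lambda>s. \<pi> (?c s)) t = X (\<pi> (?c t))" by (simp add: velocity_\<psi> in_triv(1)[OF t])
    define r where "r = rotation U \<tau> (\<psi> t (\<pi> m))"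
    have n: "norm (\<tau> m) = 1" using trivD(5)[OF tr] flow_boxD(5)[OF box m] by simp
    have dc: "(cis has_derivative (\<lambda>h. h *\<^sub>R (\<i> * cis y))) (at y)" for y
      by (rule has_derivative_cis[where f = "\<lambda>x. x" and d = "\<lambda>t. t"]) (rule has_derivative_ident)
    have "((\<lambda>s. cis (gain U \<tau> (\<pi> m) s)) has_vector_derivative r *\<^sub>R (\<i> * cis (gain U \<tau> (\<pi> m) t))) (at t)"
      using has_vector_derivative_compose_derivative[OF gain_has_derivative[OF box m t] dc] by (simp add: r_def)
    from has_vector_derivative_mult_left[OF this, of "\<tau> m"]
    have "((\<lambda>s. \<tau> (?c s)) has_vector_derivative r *\<^sub>R (\<i> * cis (gain U \<tau> (\<pi> m) t)) * \<tau> m) (at t)"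
      by (rule has_vector_derivative_transform_within_open[OF _ open_ball tb]) (simp add: in_triv)
    then have vd: "vector_derivative (\<lambda>s. \<tau> (?c s)) (at t) = (of_real r * \<i>) * \<tau> (?c t)"
      by (simp add: vector_derivative_at in_triv(2)[OF t] scaleR_conv_of_real mult.assoc)
    have "norm (\<tau> (?c t)) = 1" using in_triv(2)[OF t] n by (simp add: norm_mult)
    then have "\<tau> (?c t) * cnj (\<tau> (?c t)) = 1" using complex_norm_square[of "\<tau> (?c t)"] by simp
    then have "vector_derivative (\<lambda>s. \<tau> (?c s)) (at t) * cnj (\<tau> (?c t)) = of_real r * \<i>"
      unfolding vd by (simp only: mult.assoc mult_1_right)
    then show "angular \<tau> ?c t = rotation U \<tau> (\<pi> (?c t))"
      by (simp add: angular_def r_def in_triv(1)[OF t])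
  qed
qed

lemma flow_box_exists: "\<exists>U \<tau> W e. flow_box U \<tau> W e \<and> b \<in> W"
proof -
  obtain U \<tau> where tr: "triv U \<tau>" "b \<in> U" using triv_exists by blast
  have "open ((\<lambda>z. \<psi> (fst z) (snd z)) -` U)"
    using smooth_map_on_open_preimage[OF smooth_\<psi> trivD(1)[OF tr(1)]] by simp
  moreover have "(0, b) \<in> (\<lambda>z. \<psi> (fst z) (snd z)) -` U" using tr(2) by simp
  ultimately obtain I W where IW: "open I" "open W" "(0, b) \<in> I \<times> W" "I \<times> W \<subseteq> (\<lambda>z. \<psi> (fst z) (snd z)) -` U"
    by (rule open_prod_elim)
  obtain e where e: "e > 0" "ball 0 e \<subseteq> I" using openE[OF IW(1), of 0] IW(3) by blast
  have "\<psi> s x \<in> U" if "x \<in> W" "s \<in> ball 0 e" for x s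
    using subsetD[OF IW(4), of "(s, x)"] that e(2) by auto
  then have "flow_box U \<tau> W e" using IW(2) tr(1) e(1) by (simp add: flow_box_def)
  then show ?thesis using IW(3) by blast
qed

text \<open>A flow box stays one for shorter times, so a finite subcover provides a common
  time.\<close>

lemma flow_box_uniform:
  assumes "compact (UNIV :: 'b set)"
  shows "\<exists>e>0. \<forall>b. \<exists>U \<tau> W. flow_box U \<tau> W e \<and> b \<in> W"
proof -
  have "\<forall>b. \<exists>W e. (\<exists>U \<tau>. flow_box U \<tau> W e) \<and> b \<in> W" using flow_box_exists by blast
  then obtain W e where We: "\<And>b. (\<exists>U \<tau>. flow_box U \<tau> (W b) (e b)) \<and> b \<in> W b" by metis
  have oW: "open (W b)" and epos: "e b > 0" for b using We[of b] flow_boxD(2,3) by blast+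
  obtain B where B: "finite B" "UNIV \<subseteq> (\<Union>b\<in>B. W b)"
    by (rule compactE_image[OF assms, of UNIV W]) (use We oW in auto)
  \<comment> \<open>Inserting 1 makes the minimum well defined without asking whether
    \<open>B\<close> is empty.\<close>
  define d where "d = Min (insert 1 (e ` B))"
  have d: "d > 0" "\<And>b. b \<in> B \<Longrightarrow> d \<le> e b" using B(1) epos by (auto simp: d_def)
  show ?thesis
  proof (intro exI[of _ d] conjI d(1) allI)
    fix b
    obtain b' where b': "b' \<in> B" "b \<in> W b'" using B(2) by blast
    obtain U \<tau> where "flow_box U \<tau> (W b') (e b')" using We by blast
    then have "flow_box U \<tau> (W b') d" using d(1) d(2)[OF b'(1)] by (auto simp: flow_box_def)
    then show "\<exists>U \<tau> W. flow_box U \<tau> W d \<and> b \<in> W" using b'(2) by blast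
  qed
qed

theorem flow_exists:
  assumes "compact (UNIV :: 'b set)"
  obtains \<Phi> where "flow_of AM Z \<Phi>" "\<And>t m. \<pi> (\<Phi> t m) = \<psi> t (\<pi> m)"
proof -
  obtain d where d: "d > 0" "\<forall>b. \<exists>U \<tau> W. flow_box U \<tau> W d \<and> b \<in> W"
    using flow_box_uniform[OF assms] by blast
  \<comment> \<open>Half of the box time, so that s + t stays below \<open>d\<close> for |s|, |t| <
    \<open>e\<close> in the additive law.\<close>
  define e where "e = d / 2"
  have e: "e > 0" "2 * e = d" using d(1) by (simp_all add: e_def)
  from d(2) obtain U \<tau> W where "\<forall>b. flow_box (U b) (\<tau> b) (W b) d \<and> b \<in> W b" unfolding choice_iff by blast
  then have box: "flow_box (U b) (\<tau> b) (W b) d" "b \<in> W b" for b by blast+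
  define \<phi> where "\<phi> t m = local_flow (U (\<pi> m)) (\<tau> (\<pi> m)) t m" for t m
  have curve: "smooth_map_on euclid_atlas AM (ball 0 d) (\<lambda>t. \<phi> t m)"
    "\<bar>t\<bar> < d \<Longrightarrow> velocity AM (\<lambda>t. \<phi> t m) t = Z (\<phi> t m)"
    "\<bar>t\<bar> < d \<Longrightarrow> \<pi> (\<phi> t m) = \<psi> t (\<pi> m)" "\<phi> 0 m = m" for t m
    unfolding \<phi>_def
    using local_flow_curve[OF box(1)[of "\<pi> m"] box(2)[of "\<pi> m"]] local_flow_0[OF box(1)[of "\<pi> m"] box(2)[of "\<pi> m"]]
      local_flow_in_triv(1)[OF box(1)[of "\<pi> m"] box(2)[of "\<pi> m"]]
    by blast+
  \<comment> \<open>Different boxes give the same curve, by uniqueness; choosing a box for each base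
    point therefore does not spoil smoothness.\<close>
  have eq: "\<phi> t m = local_flow U' \<tau>' t m" if b: "flow_box U' \<tau>' W' d" "\<pi> m \<in> W'" and t: "\<bar>t\<bar> < d" for U' \<tau>' W' t m
    by (rule integral_curve_unique[OF flow_boxD(1)[OF b(1)], of "ball 0 d" 0 t "\<lambda>t. \<phi> t m" "\<lambda>t. local_flow U' \<tau>' t m"])
      (use t d(1) curve local_flow_curve[OF b] local_flow_in_triv[OF b] local_flow_0[OF b] flow_boxD(4)[OF b] in auto)
  have "smooth_map_on (prod_atlas euclid_atlas AM) AM (ball 0 d \<times> UNIV) (\<lambda>q. \<phi> (fst q) (snd q))"
  proof (rule smooth_map_on_local[OF smooth_atlas_prod[OF smooth_atlas_euclid AM] AM])
    fix q :: "real \<times> 'm" assume q: "q \<in> ball 0 d \<times> UNIV"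
    define b where "b = \<pi> (snd q)"
    have "smooth_map_on (prod_atlas euclid_atlas AM) AM (ball 0 d \<times> \<pi> -` W b) (\<lambda>q. \<phi> (fst q) (snd q))"
      by (rule smooth_map_on_cong[OF smooth_atlas_prod[OF smooth_atlas_euclid AM] AM smooth_local_flow[OF box(1)[of b]]])
        (use eq[OF box(1)[of b]] in auto)
    then show "\<exists>T. q \<in> T \<and> smooth_map_on (prod_atlas euclid_atlas AM) AM T (\<lambda>q. \<phi> (fst q) (snd q))"
      using q box(2)[of b] by (intro exI[of _ "ball 0 d \<times> \<pi> -` W b"]) (auto simp: b_def)
  qed (simp add: open_Times)
  then have sm: "smooth_map_on (prod_atlas euclid_atlas AM) AM (ball 0 e \<times> UNIV) (\<lambda>q. \<phi> (fst q) (snd q))"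
    by (rule smooth_map_on_subset) (use e in \<open>auto simp: open_Times\<close>)
  have add: "\<phi> (s + t) m = \<phi> s (\<phi> t m)" if st: "\<bar>s\<bar> < e" "\<bar>t\<bar> < e" for s t m
  proof -
    define n where "n = \<phi> t m"
    have n: "\<pi> n = \<psi> t (\<pi> m)" using curve(3)[of t m] st e by (simp add: n_def)
    have shift: "smooth_map_on euclid_atlas euclid_atlas (ball 0 e) (\<lambda>s. s + t)"
      unfolding smooth_map_on_euclid_iff by (auto intro!: smooth_on_add smooth_on_id smooth_on_const)
    have 1: "smooth_map_on euclid_atlas AM (ball 0 e) (\<lambda>s. \<phi> (s + t) m)"
      by (rule smooth_map_on_compose[OF smooth_atlas_euclid smooth_atlas_euclid AM shift curve(1)])
        (use st e in auto)
    have 2: "velocity AM (\<lambda>s. \<phi> (s + t) m) r = Z (\<phi> (r + t) m)" if "r \<in> ball 0 e" for r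
    proof -
      have rt: "\<bar>r + t\<bar> < d" using that st e by auto
      have "velocity AM (\<lambda>s. \<phi> (s + t) m) r = differential AM (\<lambda>s. \<phi> s m) (r + t) 1"
        by (rule velocity_eq_differential[OF AM curve(1)]) (use rt in \<open>auto intro!: derivative_eq_intros\<close>)
      also have "\<dots> = velocity AM (\<lambda>s. \<phi> s m) (r + t)"
        by (rule velocity_differential_1[OF AM curve(1), symmetric]) (use rt in auto)
      finally show ?thesis using curve(2)[OF rt] by simp
    qed
    have bm: "\<pi> (\<phi> (r + t) m) = \<psi> (r + t) (\<pi> m)" "\<psi> (r + t) (\<pi> m) \<in> U (\<pi> m)" "\<pi> (\<phi> r n) = \<psi> (r + t) (\<pi> m)" if "r \<in> ball 0 e" for r
    proof -
      have rt: "\<bar>r + t\<bar> < d" "\<bar>r\<bar> < d" using that st e by auto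
      show "\<pi> (\<phi> (r + t) m) = \<psi> (r + t) (\<pi> m)" by (rule curve(3)[OF rt(1)])
      show "\<psi> (r + t) (\<pi> m) \<in> U (\<pi> m)" by (rule flow_boxD(4)[OF box(1)[of "\<pi> m"] box(2)[of "\<pi> m"] rt(1)])
      show "\<pi> (\<phi> r n) = \<psi> (r + t) (\<pi> m)" using curve(3)[OF rt(2)] by (simp add: n \<psi>_add)
    qed
    have 3: "smooth_map_on euclid_atlas AM (ball 0 e) (\<lambda>s. \<phi> s n)"
      by (rule smooth_map_on_subset[OF curve(1)]) (use e in auto)
    \<comment> \<open>Both are integral curves over the orbit through
      \<open>\<psi> t (\<pi> m)\<close>, which stays in the trivialising set of the box around
      \<open>\<pi> m\<close>. One trivialisation thus suffices, though \<open>\<phi> s n\<close> is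
      defined by the box around \<open>\<pi> n\<close>.\<close>
    have "(\<lambda>s. \<phi> (s + t) m) s = (\<lambda>s. \<phi> s n) s"
      by (rule integral_curve_unique[OF flow_boxD(1)[OF box(1)[of "\<pi> m"]] convex_ball, of 0 0 e s, OF _ _ 1 2 3])
        (use st e bm curve(2)[of _ n] curve(4)[of n] in \<open>auto simp: n_def\<close>)
    then show ?thesis by (simp add: n_def)
  qed
  obtain \<Phi> where \<Phi>: "flow AM \<Phi>" "\<And>t m. \<bar>t\<bar> < e \<Longrightarrow> \<Phi> t m = \<phi> t m"
    using local_flow_extends[OF AM e(1) sm curve(4) add] by blast
  have vel0: "velocity AM (\<lambda>h. \<Phi> h m) 0 = Z m" for m
  proof -
    have "velocity AM (\<lambda>h. \<Phi> h m) 0 = velocity AM (\<lambda>h. \<phi> h m) 0"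
      by (rule velocity_cong[OF AM, of "ball 0 e" 0 _ _ "ball 0 d", OF _ _ _ curve(1)]) (use e d \<Phi>(2) in auto)
    then show ?thesis using curve(2)[of 0 m] curve(4)[of m] d(1) by simp
  qed
  have vel: "velocity AM (\<lambda>t. \<Phi> t m) t = Z (\<Phi> t m)" for t m
    using flow_velocity[OF AM \<Phi>(1), of m t] vel0 by simp
  show thesis
  proof
    show "flow_of AM Z \<Phi>" using \<Phi>(1) vel by (simp add: flow_of_def)
    \<comment> \<open>The projection is so far known only for times below \<open>e\<close>; longer
      times are reached in \<open>k\<close> equal steps.\<close>
    have steps: "\<pi> (\<Phi> (real k * s) m) = \<psi> (real k * s) (\<pi> m)" if s: "\<bar>s\<bar> < e" for k s m
    proof (induction k)
      case 0
      show ?case using \<Phi>(1) by (simp add: flow_def)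
    next
      case (Suc k)
      have "\<Phi> (s + real k * s) m = \<phi> s (\<Phi> (real k * s) m)"
        using \<Phi> s by (simp add: flow_def)
      then show ?case using Suc.IH curve(3)[of s] s e by (simp add: distrib_right \<psi>_add)
    qed
    show "\<pi> (\<Phi> t m) = \<psi> t (\<pi> m)" for t m
    proof -
      obtain k where k: "\<bar>t\<bar> / e < real k" using reals_Archimedean2 by blast
      have "0 \<le> \<bar>t\<bar> / e" using e(1) by simp
      with k have "k > 0" by (cases k) auto
      then have "\<bar>t / real k\<bar> < e" using k e(1) by (simp add: abs_divide field_simps)
      from steps[OF this, of k m] \<open>k > 0\<close> show ?thesis by simp
    qed
  qed
qed

end

section \<open>Holonomy\<close>

text \<open>A chart sees the curve only for a while, so local constancy in charts is combined with
  connectedness of the line: the set of times with the initial value is open and closed.\<close>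

lemma velocity_zero_imp_constant:
  fixes A :: "('p::{t2_space,second_countable_topology}, 'e::euclidean_space) chart set"
  assumes A: "smooth_atlas A" and c: "smooth_map euclid_atlas A c"
    and zero: "\<And>t. velocity A c t = (\<lambda>_. 0)"
  shows "c t = c 0"
proof -
  define K where "K = c -` {c 0}"
  have cont: "continuous_on UNIV c" by (rule smooth_map_onD(2)[OF c])
  have "closed K" unfolding K_def using continuous_closed_vimage[of "{c 0}" c] cont
    by (simp add: continuous_on_eq_continuous_at)
  moreover have "open K"
    unfolding open_contains_ball
  proof
    fix s assume s: "s \<in> K"
    obtain C where C: "C \<in> A" "c s \<in> fst C" using smooth_atlas_cover[OF A] by blast
    have "open (c -` fst C)" using open_vimage[OF smooth_atlas_chart(1)[OF A C(1)] cont] .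
    then obtain e where e: "e > 0" "ball s e \<subseteq> c -` fst C" using C(2) openE[of "c -` fst C" s] by auto
    have "((\<lambda>r. snd C (c r)) has_vector_derivative 0) (at r within ball s e)" if "r \<in> ball s e" for r
    proof (rule has_vector_derivative_at_within)
      have "C \<in> charts_around A (c r)" using that e(2) C(1) by (auto simp: charts_around_iff)
      from velocity_chart[OF A c UNIV_I this] show "((\<lambda>r. snd C (c r)) has_vector_derivative 0) (at r)"
        by (simp add: zero)
    qed
    then obtain k where k: "\<And>r. r \<in> ball s e \<Longrightarrow> snd C (c r) = k"
      using has_vector_derivative_zero_constant[OF convex_ball, of s e "\<lambda>r. snd C (c r)"] by blast
    have eq: "c r = c s" if r: "r \<in> ball s e" for r
    proof (rule inj_onD[OF smooth_atlas_chart(5)[OF A C(1)]])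
      show "snd C (c r) = snd C (c s)" using k[OF r] k[of s] e(1) by simp
    qed (use C r e in auto)
    have "r \<in> K" if "r \<in> ball s e" for r
      using eq[OF that] s unfolding K_def by simp
    then have "ball s e \<subseteq> K" by blast
    then show "\<exists>e>0. ball s e \<subseteq> K" using e(1) by blast
  qed
  ultimately have "K = {} \<or> K = UNIV" using clopen[of K] by blast
  moreover have "0 \<in> K" by (simp add: K_def)
  ultimately show ?thesis by (auto simp: K_def)
qed

context hamiltonian_lift
begin

text \<open>The orbit is written as the flow at time \<open>t\<close> applied to the shifted orbit;
  its velocity at \<open>t\<close> is thus the image of \<open>X p\<^sub>0\<close> under a linear
  map and vanishes.\<close>

lemma \<psi>_fixed_point:
  assumes "X p\<^sub>0 = (\<lambda>_. 0)"
  shows "\<psi> t p\<^sub>0 = p\<^sub>0"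
proof -
  have sm: "smooth_map AB AB (\<psi> t)" for t
    using smooth_\<psi>_compose[OF AB smooth_map_on_const[OF AB open_UNIV] smooth_map_id[OF AB], of t] by simp
  have "velocity AB (\<lambda>s. \<psi> s p\<^sub>0) t = (\<lambda>_. 0)" for t
  proof -
    have s0: "smooth_map euclid_atlas AB (\<lambda>s. \<psi> t (\<psi> s p\<^sub>0))"
      using smooth_map_on_compose[OF smooth_atlas_euclid AB AB smooth_\<psi>_orbit sm] by simp
    have "(\<lambda>s. \<psi> s p\<^sub>0) = (\<lambda>s. \<psi> t (\<psi> (s - t) p\<^sub>0))"
      by (simp add: \<psi>_add[symmetric])
    then have "velocity AB (\<lambda>s. \<psi> s p\<^sub>0) t = velocity AB (\<lambda>s. \<psi> t (\<psi> (s - t) p\<^sub>0)) t"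
      by (rule arg_cong[where f = "\<lambda>c. velocity AB c t"])
    also have "\<dots> = differential AB (\<lambda>s. \<psi> t (\<psi> s p\<^sub>0)) (t - t) 1"
      by (rule velocity_eq_differential[OF AB s0]) (auto intro!: derivative_eq_intros)
    also have "\<dots> = velocity AB (\<lambda>s. \<psi> t (\<psi> s p\<^sub>0)) 0"
      using velocity_differential_1[OF AB s0] by simp
    also have "\<dots> = tangent_map AB AB (\<psi> t) p\<^sub>0 (\<lambda>_. 0)"
      using tangent_map_velocity[OF AB smooth_\<psi>_orbit[of p\<^sub>0] UNIV_I[of 0] sm[of t] UNIV_I] assms
      by (simp add: velocity_\<psi>)
    also have "\<dots> = (\<lambda>_. 0)"
      using tangent_map_lincomb[OF AB sm[of t] UNIV_I, of p\<^sub>0 0 _ 0] by simp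
    finally show ?thesis .
  qed
  from velocity_zero_imp_constant[OF AB smooth_\<psi>_orbit this] show ?thesis by simp
qed

lemma rotation_fixed_point:
  assumes tr: "triv U \<tau>" and "p\<^sub>0 \<in> U" "X p\<^sub>0 = (\<lambda>_. 0)"
  shows "rotation U \<tau> p\<^sub>0 = H p\<^sub>0"
proof -
  have n: "norm (1 :: complex) = 1" by simp
  have "tangent_map AB AM (\<lambda>x. pt U \<tau> x 1) p\<^sub>0 (\<lambda>_. 0) = (\<lambda>_. 0)"
    using tangent_map_lincomb[OF AB smooth_pt[OF tr n] assms(2), of 0 _ 0] by simp
  moreover have "\<alpha> m (\<lambda>_. 0) = 0" for m
    using \<alpha>_lincomb[OF Z_tangent Z_tangent, of m 0 0] by simp
  ultimately show ?thesis by (simp add: rotation_def base_form_def assms(3))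
qed

text \<open>By Cartan's formula the Lie derivative of \<open>\<alpha>\<close> along \<open>Z\<close> is \<open>d(\<alpha>(Z)) + i\<^sub>Z d\<alpha> = dH - dH = 0\<close>,
  where \<open>H\<close> is pulled back to the bundle.\<close>

lemma flow_preserves_\<alpha>:
  assumes \<Phi>: "flow_of AM Z \<Phi>" and c: "smooth_map_on euclid_atlas AM S c" "r \<in> S"
  shows "\<alpha> (\<Phi> s (c r)) (velocity AM (\<lambda>r. \<Phi> s (c r)) r) = \<alpha> (c r) (velocity AM c r)"
proof -
  have fl: "flow AM \<Phi>" and vel: "velocity AM (\<lambda>t. \<Phi> t m) t = Z (\<Phi> t m)" for t m
    using \<Phi> by (auto simp: flow_of_def)
  have sm\<Phi>: "smooth_map (prod_atlas euclid_atlas AM) AM (\<lambda>z. \<Phi> (fst z) (snd z))"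
    using fl by (simp add: flow_def split_def)
  define N where "N = (UNIV :: real set) \<times> S"
  have oN: "open N" using smooth_map_onD(1)[OF c(1)] by (simp add: N_def open_Times)
  define F where "F q = \<Phi> (fst q) (c (snd q))" for q
  have pr: "smooth_map_on euclid_atlas euclid_atlas N fst" "smooth_map_on euclid_atlas euclid_atlas N snd"
    unfolding smooth_map_on_euclid_iff
    using oN smooth_on_bounded_linear[OF oN bounded_linear_fst smooth_on_id[OF oN]]
      smooth_on_bounded_linear[OF oN bounded_linear_snd smooth_on_id[OF oN]] by auto
  have cs: "smooth_map_on euclid_atlas AM N (\<lambda>q. c (snd q))"
    by (rule smooth_map_on_compose[OF smooth_atlas_euclid smooth_atlas_euclid AM pr(2) c(1)]) (auto simp: N_def)
  have F: "smooth_map_on euclid_atlas AM N F"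
    using smooth_map_on_compose[OF smooth_atlas_euclid smooth_atlas_prod[OF smooth_atlas_euclid AM] AM
        smooth_map_on_Pair[OF smooth_atlas_euclid smooth_atlas_euclid AM pr(1) cs] sm\<Phi>] by (simp add: F_def[abs_def])
  have mem: "(s, r) \<in> N" if "r \<in> S" for s r using that by (simp add: N_def)
  have l1: "((\<lambda>s. (s, r)) has_vector_derivative (1, 0)) (at s)" for s r :: real
    by (auto intro!: has_vector_derivative_Pair derivative_eq_intros)
  have l2: "((\<lambda>r. (s, r)) has_vector_derivative (0, 1)) (at r)" for s r :: real
    by (auto intro!: has_vector_derivative_Pair derivative_eq_intros)
  have d1: "differential AM F (s, r) (1, 0) = Z (F (s, r))" if "r \<in> S" for s r
    using velocity_eq_differential[OF AM F mem[OF that] l1] vel[of "c r" s] by (simp add: F_def)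
  have d2: "differential AM F (s, r) (0, 1) = velocity AM (\<lambda>r. \<Phi> s (c r)) r" if "r \<in> S" for s r
    using velocity_eq_differential[OF AM F mem[OF that] l2] by (simp add: F_def)
  \<comment> \<open>The coefficients of the pullback of \<alpha> by \<open>F\<close>. The one along
    \<open>(1, 0)\<close> is \<open>H\<close> on the projection, by \<open>\<alpha>_Z\<close>; the
    one along \<open>(0, 1)\<close> is the quantity to be shown constant in
    \<open>s\<close>.\<close>
  define a where "a w q = \<alpha> (F q) (differential AM F q w)" for w q
  have sa: "smooth_on N (a w)" for w
    unfolding a_def by (rule one_form_differential_smooth[OF AM one_form_\<alpha> F])
  have a': "(a w has_derivative frechet_derivative (a w) (at (s, r))) (at (s, r))" if "r \<in> S" for w s r
    by (rule smooth_on_has_derivative[OF sa mem[OF that]])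
  have zero: "frechet_derivative (a (0, 1)) (at (s, r)) (1, 0) = 0" for s
  proof -
    define d where "d r = F (s, r)" for r
    have dd: "smooth_map_on euclid_atlas AM S d"
    proof -
      have "smooth_map_on euclid_atlas euclid_atlas S (\<lambda>r. (s, r))"
        unfolding smooth_map_on_euclid_iff using smooth_map_onD(1)[OF c(1)]
        by (auto intro!: smooth_on_Pair smooth_on_const smooth_on_id)
      from smooth_map_on_compose[OF smooth_atlas_euclid smooth_atlas_euclid AM this F] mem
      show ?thesis by (simp add: d_def[abs_def])
    qed
    have dv: "velocity AM d r = differential AM F (s, r) (0, 1)"
      using d2[OF c(2)] by (simp add: d_def[abs_def] F_def)
    have "((\<lambda>r. a (1, 0) (s, r)) has_vector_derivative frechet_derivative (a (1, 0)) (at (s, r)) (0, 1)) (at r)"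
      by (rule has_vector_derivative_compose_derivative[OF l2 a'[OF c(2)]])
    then have 1: "((\<lambda>r. H (\<pi> (d r))) has_vector_derivative frechet_derivative (a (1, 0)) (at (s, r)) (0, 1)) (at r)"
      by (rule has_vector_derivative_transform_within_open[OF _ smooth_map_onD(1)[OF c(1)] c(2)])
        (simp add: a_def d1 \<alpha>_Z d_def)
    have 2: "((\<lambda>r. H (\<pi> (d r))) has_vector_derivative
        d_fun AB H (\<pi> (d r)) (tangent_map AM AB \<pi> (d r) (velocity AM d r))) (at r)"
      using d_fun_velocity[OF AB smooth_proj_curve[OF dd] c(2) smooth_H] velocity_proj[OF dd c(2)] by simp
    have 3: "frechet_derivative (a (1, 0)) (at (s, r)) (0, 1) =
        d_fun AB H (\<pi> (d r)) (tangent_map AM AB \<pi> (d r) (velocity AM d r))"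
      by (rule vector_derivative_unique_at[OF 1 2])
    \<comment> \<open>Cartan's formula in the coordinates s and r: the left side is d \<alpha> on
      the two partial velocities. Its subtracted term is the r-derivative of \<open>H\<close> on the
      projection, and the right side is minus the same derivative, so the first term
      vanishes.\<close>
    have "frechet_derivative (a (0, 1)) (at (s, r)) (1, 0) - frechet_derivative (a (1, 0)) (at (s, r)) (0, 1) =
        d_one_form AM \<alpha> (F (s, r)) (Z (F (s, r))) (velocity AM d r)"
      using d_one_form_differential[OF AM one_form_\<alpha> F mem[OF c(2), of s], where w = "(0, 1)" and u = "(1, 0)"]
      by (simp add: a_def[abs_def] d1[OF c(2)] dv)
    also have "\<dots> = - d_fun AB H (\<pi> (d r)) (tangent_map AM AB \<pi> (d r) (velocity AM d r))"
      using d\<alpha>_Z[OF velocity_tangent_space[OF AM dd c(2)]] by (simp add: d_def)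
    finally show ?thesis using 3 by simp
  qed
  have "((\<lambda>s. a (0, 1) (s, r)) has_vector_derivative 0) (at s)" for s
    using has_vector_derivative_compose_derivative[OF l1 a'[OF c(2), of "(0, 1)" s]] by (simp add: zero)
  then obtain k where "\<And>s. a (0, 1) (s, r) = k"
    using has_vector_derivative_zero_constant[OF convex_UNIV, of "\<lambda>s. a (0, 1) (s, r)"] by auto
  then have "a (0, 1) (s, r) = a (0, 1) (0, r)" by simp
  moreover have "\<Phi> 0 m = m" for m using fl by (simp add: flow_def)
  ultimately show ?thesis by (simp add: a_def d2[OF c(2)] F_def)
qed

theorem periodic:
  assumes compact: "compact (UNIV :: 'b set)" and connected: "connected (UNIV :: 'b set)"
    and period: "\<And>t x. \<psi> (t + 2 * pi) x = \<psi> t x"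
    and p\<^sub>0: "X p\<^sub>0 = (\<lambda>_. 0)" "H p\<^sub>0 \<in> \<nat>"
  shows "defines_circle_action AM Z"
proof -
  obtain \<Phi> where \<Phi>: "flow_of AM Z \<Phi>" "\<And>t m. \<pi> (\<Phi> t m) = \<psi> t (\<pi> m)" using flow_exists[OF compact] by blast
  have fl: "flow AM \<Phi>" and vel: "\<And>t m. velocity AM (\<lambda>t. \<Phi> t m) t = Z (\<Phi> t m)"
    using \<Phi>(1) by (auto simp: flow_of_def)
  have \<Phi>0: "\<Phi> 0 m = m" and \<Phi>_add: "\<Phi> (s + t) m = \<Phi> s (\<Phi> t m)" for s t m using fl by (auto simp: flow_def)
  define T where "T = 2 * pi"
  have \<pi>T: "\<pi> (\<Phi> T m) = \<pi> m" for m using \<Phi>(2)[of T m] period[of 0] by (simp add: T_def)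
  have sm\<Phi>: "smooth_map AM AM (\<Phi> T)"
  proof -
    have "smooth_map (prod_atlas euclid_atlas AM) AM (\<lambda>z. \<Phi> (fst z) (snd z))"
      using fl by (simp add: flow_def split_def)
    from smooth_map_on_compose[OF AM smooth_atlas_prod[OF smooth_atlas_euclid AM] AM
        smooth_map_on_Pair[OF AM smooth_atlas_euclid AM smooth_map_on_const[OF AM open_UNIV, of _ T] smooth_map_id[OF AM]] this]
    show ?thesis by simp
  qed
  \<comment> \<open>\<open>c\<close> and its image under \<open>\<Phi> T\<close> have equal
    projections, hence equal \<open>base_form\<close> parts; as \<alpha> is preserved, they rotate
    with equal speed.\<close>
  have holonomy: "\<tau> (\<Phi> T (c t)) * cnj (\<tau> (c t)) = \<tau> (\<Phi> T (c s)) * cnj (\<tau> (c s))"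
    if tr: "triv U \<tau>" and S: "convex S" "s \<in> S" "t \<in> S" and c: "smooth_map_on euclid_atlas AM S c"
      and U: "\<And>s. s \<in> S \<Longrightarrow> \<pi> (c s) \<in> U" for U \<tau> and S :: "real set" and s t c
  proof -
    have cT: "smooth_map_on euclid_atlas AM S (\<lambda>s. \<Phi> T (c s))"
      by (rule smooth_map_on_compose[OF smooth_atlas_euclid AM AM c sm\<Phi>]) simp
    show ?thesis
    proof (rule triv_ratio_const[OF tr S cT _ c U])
      show "\<pi> (\<Phi> T (c r)) \<in> U" if "r \<in> S" for r using U[OF that] by (simp add: \<pi>T)
      show "angular \<tau> (\<lambda>s. \<Phi> T (c s)) r = angular \<tau> c r" if r: "r \<in> S" for r
        using \<alpha>_velocity[OF tr cT r] \<alpha>_velocity[OF tr c r U[OF r]] flow_preserves_\<alpha>[OF \<Phi>(1) c r, of T] U[OF r]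
        by (simp add: \<pi>T)
    qed
  qed
  \<comment> \<open>A condition on base points that stands for a rotation angle in 2 pi Z, so that
    no angle has to be defined as a function on the base.\<close>
  define K where "K = {b. \<forall>m. \<pi> m = b \<longrightarrow> \<Phi> T m = m}"
  have K0: "p\<^sub>0 \<in> K"
    unfolding K_def
  proof (intro CollectI allI impI)
    fix m assume m: "\<pi> m = p\<^sub>0"
    obtain U \<tau> where tr: "triv U \<tau>" "p\<^sub>0 \<in> U" using triv_exists by blast
    have proj: "\<pi> (\<Phi> t m) = p\<^sub>0" for t using \<Phi>(2)[of t m] \<psi>_fixed_point[OF p\<^sub>0(1)] m by simp
    have U: "\<pi> (\<Phi> t m) \<in> U" for t using proj tr(2) by simp
    note orb = flow_smooth_orbit[OF AM fl, of m]
    \<comment> \<open>Over the fixed point the speed \<open>rotation\<close> is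
      \<open>H p\<^sub>0\<close>, so rotating back with that speed makes the angular coordinate
      constant.\<close>
    define w where "w t = \<tau> (\<Phi> t m) * cis (- (H p\<^sub>0 * t))" for t
    have "(w has_vector_derivative 0) (at t)" for t
    proof -
      have "angular \<tau> (\<lambda>t. \<Phi> t m) t = H p\<^sub>0"
        using angular_integral_curve[OF tr(1) orb UNIV_I U vel] rotation_fixed_point[OF tr p\<^sub>0(1)] by (simp add: proj)
      then have 1: "((\<lambda>t. \<tau> (\<Phi> t m)) has_vector_derivative \<i> * H p\<^sub>0 * \<tau> (\<Phi> t m)) (at t)"
        using triv_curve_derivative[OF tr(1) orb UNIV_I U, of t] by simp
      have "((\<lambda>t. - (H p\<^sub>0 * t)) has_derivative (\<lambda>h. - (H p\<^sub>0 * h))) (at t)"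
        by (auto intro!: derivative_eq_intros)
      from has_derivative_cis[OF this]
      have 2: "((\<lambda>t. cis (- (H p\<^sub>0 * t))) has_vector_derivative - (\<i> * H p\<^sub>0 * cis (- (H p\<^sub>0 * t)))) (at t)"
        unfolding has_vector_derivative_def by (rule has_derivative_eq_rhs) (auto simp: scaleR_conv_of_real)
      show ?thesis using has_vector_derivative_mult[OF 1 2] by (simp add: w_def[abs_def] algebra_simps)
    qed
    then obtain k where "\<And>t. w t = k" using has_vector_derivative_zero_constant[OF convex_UNIV, of w] by auto
    then have "w T = w 0" by simp
    \<comment> \<open>Integrality of \<open>H p\<^sub>0\<close> enters here: the counter-rotation
      closes up after time 2 pi.\<close>
    moreover have "cis (- (H p\<^sub>0 * T)) = 1"
    proof -
      obtain n :: nat where "H p\<^sub>0 = of_nat n" using p\<^sub>0(2) by (auto elim: Nats_cases)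
      then have "- (H p\<^sub>0 * T) = 2 * pi * of_int (- int n)" by (simp add: T_def)
      then show ?thesis by (simp only: cis_multiple_2pi Ints_of_int)
    qed
    ultimately have "\<tau> (\<Phi> T m) = \<tau> m" by (simp add: w_def \<Phi>0)
    then show "\<Phi> T m = m" using tr(2) \<pi>T m by (intro triv_eqI[OF tr(1)]) simp_all
  qed
  \<comment> \<open>Phrased as membership in \<open>K\<close> passing between any two points of
    \<open>N\<close>, which yields openness of \<open>K\<close> and of its complement alike.\<close>
  have loc: "\<exists>N. open N \<and> b \<in> N \<and> (\<forall>x\<in>N. \<forall>y\<in>N. x \<in> K \<longrightarrow> y \<in> K)" for b
  proof -
    obtain U \<tau> where tr: "triv U \<tau>" "b \<in> U" using triv_exists by blast
    obtain C where C: "C \<in> AB" "b \<in> fst C" using smooth_atlas_cover[OF AB] by blast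
    note ch = smooth_atlas_chart[OF AB C(1)]
    have oY: "open (snd C ` (fst C \<inter> U))" by (rule smooth_atlas_open_image[OF AB C(1) trivD(1)[OF tr(1)]])
    obtain e where e: "e > 0" "ball (snd C b) e \<subseteq> snd C ` (fst C \<inter> U)"
      using openE[OF oY, of "snd C b"] C(2) tr(2) by blast
    define Y where "Y = ball (snd C b) e"
    have YU: "chart_inv C y \<in> U" "y \<in> chart_image C" if "y \<in> Y" for y
      using that e(2) ch(6) by (auto simp: Y_def)
    define N where "N = fst C \<inter> snd C -` Y"
    have "open N" unfolding N_def Y_def by (rule continuous_open_preimage[OF ch(3,1) open_ball])
    moreover have "b \<in> N" using C(2) e(1) by (simp add: N_def Y_def)
    moreover have "y \<in> K" if x: "x \<in> N" "x \<in> K" and y: "y \<in> N" for x y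
      unfolding K_def
    proof (intro CollectI allI impI)
      fix m assume m: "\<pi> m = y"
      have yU: "y \<in> U" using y YU(1)[of "snd C y"] ch(6)[of y] by (auto simp: N_def)
      have n: "norm (\<tau> m) = 1" using trivD(5)[OF tr(1)] m yU by simp
      \<comment> \<open>A straight line in the chart from \<open>x\<close> to \<open>y\<close>. It
        is followed on all of \<open>S\<close> and not on [0, 1], because smooth curves have open
        domains; convexity of the ball makes \<open>S\<close> convex.\<close>
      define l where "l r = snd C x + r *\<^sub>R (snd C y - snd C x)" for r :: real
      have lc: "continuous_on UNIV l" unfolding l_def by (intro continuous_intros)
      define S where "S = l -` Y"
      have oS: "open S" unfolding S_def using open_vimage[OF _ lc] by (simp add: Y_def)
      have S01: "0 \<in> S" "1 \<in> S" using x(1) y by (auto simp: S_def l_def N_def)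
      have cS: "convex S"
      proof (rule convexI)
        fix r r' u v :: real assume *: "r \<in> S" "r' \<in> S" "0 \<le> u" "0 \<le> v" "u + v = 1"
        have "l (u * r + v * r') = (u + v) *\<^sub>R snd C x + (u * r + v * r') *\<^sub>R (snd C y - snd C x)"
          using *(5) by (simp add: l_def)
        also have "\<dots> = u *\<^sub>R l r + v *\<^sub>R l r'" by (simp add: l_def algebra_simps)
        finally have "l (u * r + v * r') = u *\<^sub>R l r + v *\<^sub>R l r'" .
        moreover have "u *\<^sub>R l r + v *\<^sub>R l r' \<in> Y"
          by (rule convexD[of Y]) (use * in \<open>auto simp: S_def Y_def\<close>)
        ultimately show "u *\<^sub>R r + v *\<^sub>R r' \<in> S" by (simp add: S_def)
      qed
      have sl: "smooth_map_on euclid_atlas euclid_atlas S l"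
        unfolding smooth_map_on_euclid_iff l_def
        by (intro conjI oS smooth_on_add[OF oS] smooth_on_const
            smooth_on_bounded_linear[OF oS bounded_linear_scaleR_left smooth_on_id[OF oS]])
      have s1: "smooth_map_on euclid_atlas AB S (\<lambda>r. chart_inv C (l r))"
        by (rule smooth_map_on_compose[OF smooth_atlas_euclid smooth_atlas_euclid AB sl smooth_map_on_chart_inv[OF AB C(1)]])
          (use YU(2) in \<open>auto simp: S_def\<close>)
      \<comment> \<open>The lift with constant angular coordinate \<open>\<tau> m\<close>, chosen to
        end at the given point \<open>m\<close> over \<open>y\<close>; it starts over
        \<open>x\<close>, where \<open>\<Phi> T\<close> is the identity.\<close>
      define c where "c r = pt U \<tau> (chart_inv C (l r)) (\<tau> m)" for r
      have c: "smooth_map_on euclid_atlas AM S c" unfolding c_def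
        by (rule smooth_map_on_compose[OF smooth_atlas_euclid AB AM s1 smooth_pt[OF tr(1) n]])
          (use YU(1) in \<open>auto simp: S_def\<close>)
      have \<pi>c: "\<pi> (c r) = chart_inv C (l r)" if "r \<in> S" for r
        using trivD(6)[OF tr(1) YU(1) n] that by (simp add: c_def S_def)
      have cU: "\<pi> (c r) \<in> U" if "r \<in> S" for r
        using \<pi>c[OF that] YU(1) that by (simp add: S_def)
      have c1: "c 1 = m"
        using trivD(8)[OF tr(1), of m] m yU y ch(6) by (simp add: c_def l_def N_def)
      have \<pi>TU: "\<pi> (\<Phi> T n) \<in> U" if "\<pi> n \<in> U" for n using that \<pi>T by simp
      have "\<Phi> T (c 0) = c 0"
        using x \<pi>c[OF S01(1)] ch(6) by (simp add: K_def l_def N_def)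
      then have "\<tau> (\<Phi> T (c 0)) * cnj (\<tau> (c 0)) = 1"
        using triv_ratio_1[OF tr(1) \<pi>TU[OF cU[OF S01(1)]] \<pi>T[symmetric]] by blast
      then have "\<tau> (\<Phi> T m) * cnj (\<tau> m) = 1"
        using holonomy[OF tr(1) cS S01 c cU] c1 by simp
      then show "\<Phi> T m = m"
        using triv_ratio_1[OF tr(1) \<pi>TU \<pi>T[symmetric], of m] m yU by blast
    qed
    ultimately show ?thesis by blast
  qed
  have "open K"
  proof (subst open_subopen, intro ballI)
    fix b assume b: "b \<in> K"
    obtain N where N: "open N" "b \<in> N" "\<forall>x\<in>N. \<forall>y\<in>N. x \<in> K \<longrightarrow> y \<in> K" using loc[of b] by (elim exE conjE)
    then have "N \<subseteq> K" using b by blast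
    then show "\<exists>T. open T \<and> b \<in> T \<and> T \<subseteq> K" using N(1,2) by (intro exI conjI)
  qed
  moreover have "open (- K)"
  proof (subst open_subopen, intro ballI)
    fix b assume b: "b \<in> - K"
    obtain N where N: "open N" "b \<in> N" "\<forall>x\<in>N. \<forall>y\<in>N. x \<in> K \<longrightarrow> y \<in> K" using loc[of b] by (elim exE conjE)
    then have "N \<subseteq> - K" using b by blast
    then show "\<exists>T. open T \<and> b \<in> T \<and> T \<subseteq> - K" using N(1,2) by (intro exI conjI)
  qed
  ultimately have "K = {} \<or> K = UNIV"
    using connected by (simp add: connected_clopen closed_def)
  with K0 have "K = UNIV" by blast
  then have fixed: "\<Phi> T m = m" for m unfolding K_def by blast
  have "\<Phi> (t + 2 * pi) m = \<Phi> t m" for t m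
    using \<Phi>_add[of t T m] fixed[of m] by (simp add: T_def)
  then have "circle_action AM \<Phi>"
    using fl by (simp add: circle_action_def)
  then show ?thesis using \<Phi>(1) unfolding defines_circle_action_def by blast
qed

end

theorem proposition4p3:
  fixes AB :: "('b::{t2_space,second_countable_topology}, 'e::euclidean_space) chart set"
    and AM :: "('m::{t2_space,second_countable_topology}, 'f::euclidean_space) chart set"
    and \<omega> :: "'b \<Rightarrow> ('b, 'e) tangent \<Rightarrow> ('b, 'e) tangent \<Rightarrow> real"
    and \<pi> :: "'m \<Rightarrow> 'b"
    and \<rho> :: "real \<Rightarrow> 'm \<Rightarrow> 'm"
    and \<alpha> :: "'m \<Rightarrow> ('m, 'f) tangent \<Rightarrow> real"
    and H :: "'b \<Rightarrow> real"
    and X :: "'b \<Rightarrow> ('b, 'e) tangent"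
    and p\<^sub>0 :: 'b
    and R X\<^sub>h :: "'m \<Rightarrow> ('m, 'f) tangent"
  assumes "smooth_atlas AB" and "compact (UNIV :: 'b set)" and "connected (UNIV :: 'b set)"
    and "symplectic_form AB \<omega>"
    and "integral_class AB (\<lambda>p u v. - \<omega> p u v / (2 * pi))"
    and "smooth_atlas AM" and "principal_circle_bundle AM AB \<pi> \<rho>"
    and "euler_class AM AB \<pi> \<rho> = de_rham_class AB (\<lambda>p u v. - \<omega> p u v / (2 * pi))"
    and "connection_form AM \<rho> \<alpha>" and "d_eq_pullback AM AB \<pi> \<alpha> \<omega>"
    and "smooth_map AB euclid_atlas H"
    and "hamiltonian_vector_field AB \<omega> H X" and "defines_circle_action AB X"
    and "\<And>p. H p > 0"
    and "X p\<^sub>0 = (\<lambda>_. 0)" and "H p\<^sub>0 \<in> \<nat>"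
    and "reeb_vector_field AM \<alpha> R"
    and "horizontal_lift AM AB \<pi> \<alpha> X X\<^sub>h"
  shows "defines_circle_action AM (\<lambda>m C. (H \<circ> \<pi>) m *\<^sub>R R m C + X\<^sub>h m C)"
proof -
  interpret connection_bundle AB AM \<pi> \<rho> \<alpha>
    using assms by unfold_locales
  obtain \<psi> where \<psi>: "flow_of AB X \<psi>" "circle_action AB \<psi>"
    using \<open>defines_circle_action AB X\<close> unfolding defines_circle_action_def by blast
  have d\<alpha>: "d_one_form AM \<alpha> m u v = \<omega> (\<pi> m) (tangent_map AM AB \<pi> m u) (tangent_map AM AB \<pi> m v)"
    if "u \<in> tangent_space AM m" "v \<in> tangent_space AM m" for m u v
    using \<open>d_eq_pullback AM AB \<pi> \<alpha> \<omega>\<close> that unfolding d_eq_pullback_def by blast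
  have R: "R m \<in> tangent_space AM m" "\<alpha> m (R m) = 1" "v \<in> tangent_space AM m \<Longrightarrow> d_one_form AM \<alpha> m (R m) v = 0" for m v
    using \<open>reeb_vector_field AM \<alpha> R\<close> unfolding reeb_vector_field_def vector_field_def by blast+
  have Xh: "X\<^sub>h m \<in> tangent_space AM m" "\<alpha> m (X\<^sub>h m) = 0" "tangent_map AM AB \<pi> m (X\<^sub>h m) = X (\<pi> m)" for m
    using \<open>horizontal_lift AM AB \<pi> \<alpha> X X\<^sub>h\<close> unfolding horizontal_lift_def vector_field_def by blast+
  \<comment> \<open>The contraction of \<open>R\<close> with d \<alpha> = pi^*\<omega> vanishes, so
    T pi (R) is \<omega>-orthogonal to the image of T pi, which is the whole tangent space;
    nondegeneracy leaves only 0.\<close>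
  have \<pi>R: "tangent_map AM AB \<pi> m (R m) = (\<lambda>_. 0)" for m
  proof -
    have "\<omega> (\<pi> m) (tangent_map AM AB \<pi> m (R m)) w = 0" if "w \<in> tangent_space AB (\<pi> m)" for w
      using tangent_map_proj_surj[OF that] d\<alpha>[OF R(1)] R(3) by metis
    then show ?thesis
      using \<open>symplectic_form AB \<omega>\<close> tangent_map_tangent_space[OF AM AB smooth_proj UNIV_I R(1)]
      unfolding symplectic_form_def by blast
  qed
  \<comment> \<open>The factor 1 gives the shape of a linear combination required by the linearity
    lemmas; it is simplified away at the end.\<close>
  define Z where "Z m = (\<lambda>C. H (\<pi> m) *\<^sub>R R m C + 1 *\<^sub>R X\<^sub>h m C)" for m
  have Z: "Z m \<in> tangent_space AM m" "\<alpha> m (Z m) = H (\<pi> m)" for m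
    unfolding Z_def
    by (rule tangent_space_lincomb[OF AM R(1) Xh(1)]) (simp only: \<alpha>_lincomb[OF R(1) Xh(1)] R(2) Xh(2); simp)
  have \<pi>Z: "tangent_map AM AB \<pi> m (Z m) = X (\<pi> m)" for m
    unfolding Z_def tangent_map_lincomb[OF AM smooth_proj UNIV_I] by (simp add: \<pi>R Xh(3))
  interpret hamiltonian_lift AB AM \<pi> \<rho> \<alpha> H X \<psi> Z
  proof
    \<comment> \<open>i_Z d \<alpha> is the pullback of i_X \<omega> = - dH, because
      \<open>Z\<close> projects to \<open>X\<close>.\<close>
    show "d_one_form AM \<alpha> m (Z m) v = - d_fun AB H (\<pi> m) (tangent_map AM AB \<pi> m v)"
      if "v \<in> tangent_space AM m" for m v
      using d\<alpha>[OF Z(1) that] \<open>hamiltonian_vector_field AB \<omega> H X\<close>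
        tangent_map_tangent_space[OF AM AB smooth_proj UNIV_I that]
      by (simp add: \<pi>Z hamiltonian_vector_field_def)
  qed (use \<psi>(1) Z \<pi>Z assms in auto)
  have "defines_circle_action AM Z"
    by (rule periodic) (use assms \<psi>(2) in \<open>auto simp: circle_action_def\<close>)
  then show ?thesis by (simp add: Z_def[abs_def])
qed

end
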